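(* Let $M$ be a quaternionic contact manifold of dimension $4n+3$, with associated corank three subbundle $Q\subset TM$, two-sphere bundle $\mathbb{I}$ of complex structures of $Q$ and conformal class $[\gamma]$ of metrics on $Q$. Then for any quaternionic CR structure on $M$ having $(Q,\mathbb{I})$ as the underlying structure, the conformal class consisting of all Levi forms of that quaternionic CR structure coincides with $[\gamma]$. Furthermore, if $\theta=(\theta_1,\theta_2,\theta_3)$ is a local $\mathbb{R}^3$-valued one-form compatible with a local hyper CR structure $\{(Q_a,I_a)\}_{a=1,2,3}$ constituting the quaternionic CR structure, then $\mathrm{Levi}_\theta(X,Y)=d\theta_a(X,I_aY)$ for $a=1,2,3$ and all $X,Y\in Q$. In particular, the quaternionic CR structure must be ultra-pseudoconvex.
   Context: Everything is smooth; $(a,b,c)$ always denotes a cyclic permutation of $(1,2,3)$; $d\theta(X,Y)=X\theta(Y)-Y\theta(X)-\theta([X,Y])$. $M$ is a connected orientable manifold of dimension $4n+3$. Quaternionic contact structure. On a $(4n+3)$-manifold $M$ this is a corank three subbundle $Q\subset TM$ with a conformal class $[\gamma]$ of metrics on $Q$ and a two-sphere bundle $\mathbb{I}$ over $M$ of complex structures $I:Q\to Q$, $I^2=-\mathrm{Id}$, such that: (i) $\gamma(IX,IY)=\gamma(X,Y)$ for $I\in\mathbb{I}$, $X,Y\in Q$; (ii) $\mathbb{I}$ locally admits sections $I_1,I_2,I_3$ with $I_1I_2=-I_2I_1=I_3$ and $\mathbb{I}=\{v_1I_1+v_2I_2+v_3I_3: v_1^2+v_2^2+v_3^2=1\}$;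 (iii) $Q$ is locally the kernel of an $\mathbb{R}^3$-valued one-form $\eta=(\eta_1,\eta_2,\eta_3)$ with $\gamma(I_aX,Y)=d\eta_a(X,Y)$, $a=1,2,3$, $X,Y\in Q$. If (iii) holds for one local triple $(I_a)$ as in (ii) and one metric in the class, then it holds (with other $\eta$) for any other such triple and metric. Almost hyper CR structures. An almost CR structure is a corank one subbundle of the tangent bundle together with a complex structure on it. An almost hyper CR structure is a pair of almost CR structures $(Q_1,I_1)$, $(Q_2,I_2)$ such that $Q_1,Q_2$ are transversal to each other and $I_1I_2=-I_2I_1$ on $I_1(Q_1\cap Q_2)\cap I_2(Q_1\cap Q_2)$. A third almost CR structure $(Q_3,I_3)$ is defined by $Q_3=I_1(Q_1\cap Q_2)+I_2(Q_1\cap Q_2)$, $I_3=-I_2I_1$ on $I_1(Q_1\cap Q_2)$ and $I_3=I_1I_2$ on $I_2(Q_1\cap Q_2)$. The bundle $Q_1\cap Q_2\cap Q_3$ is a corank three subbundle (denoted $Q$) preserved by $I_1,I_2,I_3$, which satisfy the quaternion relations on it. An admissible triple is a triple $(T_1,T_2,T_3)$ of vector fields transverse to $Q$ with $T_a\in\Gamma(Q_b\cap Q_c)$ and $I_aT_b=T_c$. Given one, extend $I_a$ to endomorphisms $\widetilde{I_a}$ of the tangent bundle by $\widetilde{I_a}T_a=0$; for an $S^2$-valued function $\mathbf v=(v_1,v_2,v_3)$ put $Q_{\mathbf v}=Q\oplus\{\sum x_aT_a:\sum x_av_a=0\}$ and $I_{\mathbf v}=(\sum v_a\widetilde{I_a})|_{Q_{\mathbf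 v}}$ (independent of the admissible triple). Hyper CR structures. The almost hyper CR structure is integrable, and is then called a hyper CR structure, if for $a=1,2,3$ and all $X,Y\in\Gamma(Q)$: $[X,Y]-[I_aX,I_aY]\in\Gamma(Q_a)$ and $I_a([X,Y]-[I_aX,I_aY])-[X,I_aY]-[I_aX,Y]\in\Gamma(Q)$. An $\mathbb{R}^3$-valued one-form $\theta$ is compatible if $\ker\theta_a=Q_a$ and $\theta_c\circ I_a=\theta_b$ on $Q_a$; it is unique up to multiplication by a nowhere vanishing function. Its Levi form is the bilinear form on $Q$, $\mathrm{Levi}_\theta(X,Y)=\frac12\big(d\theta_a(X,I_aY)+d\theta_a(I_bX,I_cY)\big)$, which is independent of $a$, symmetric and invariant under $I_1,I_2,I_3$, and satisfies $\mathrm{Levi}_{\lambda\theta}=\lambda\mathrm{Levi}_\theta$. The structure is ultra-pseudoconvex if $h(X,Y)=(2n+4)\,\mathrm{Levi}_\theta(X,Y)-\sum_{a=1}^3d\theta_a(X,I_aY)$ on $Q$ is positive or negative definite for some (hence any) compatible $\theta$. Quaternionic CR structures. A quaternionic CR structure on $M$ is a covering of $M$ by open sets $U$ carrying hyper CR structures such that for any two of them, $\{(Q_a,I_a)\}$ on $U$ and $\{(Q_a',I_a')\}$ on $U'$ with $U\cap U'\neq\emptyset$, there is a function $S:U\cap U'\to SO(3)$ with $Q'_{\mathbf v}=Q_{S\mathbf v}$, $I'_{\mathbf v}=I_{S\mathbf v}$ for all $\mathbf v\in S^2$. The local corank three bundles then agree and define a global bundle $Q$, and the complex structures $I_{\mathbf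 v}|_Q$ form a two-sphere bundle $\mathbb{I}$ over $M$; $(Q,\mathbb{I})$ is the underlying structure. Compatible local forms that are rotated by the same $SO(3)$-functions on overlaps have Levi forms that agree on overlaps; the resulting global form is a Levi form of the quaternionic CR structure. The Levi forms and the ultra-pseudoconvexity condition are thus globally defined. Since the compatible forms are determined only up to multiplication by nowhere vanishing (possibly negative) functions, so are the Levi forms, and the equality of conformal classes is understood with this (overall sign) convention. *)

theory Defs
  imports "HOL-Analysis.Analysis"
begin

section \<open>Smooth manifolds\<close>

text \<open>Meant for open \<open>S\<close> in a finite-dimensional space, where continuity of all iterated directional
  derivatives is the usual notion of smoothness.\<close>

primrec Ck_on :: "nat \<Rightarrow> 'e::real_normed_vector set \<Rightarrow> ('e \<Rightarrow> 'f::real_normed_vector) \<Rightarrow> bool" where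
  "Ck_on 0 S f \<longleftrightarrow> continuous_on S f"
| "Ck_on (Suc k) S f \<longleftrightarrow>
     (\<forall>x\<in>S. f differentiable (at x)) \<and>
     (\<forall>v. Ck_on k S (\<lambda>x. frechet_derivative f (at x) v))"

definition smooth_on :: "'e::real_normed_vector set \<Rightarrow> ('e \<Rightarrow> 'f::real_normed_vector) \<Rightarrow> bool" where
  "smooth_on S f \<longleftrightarrow> (\<forall>k. Ck_on k S f)"

type_synonym ('m, 'e) chart = "'m set \<times> ('m \<Rightarrow> 'e)"

abbreviation chart_inv :: "('m, 'e) chart \<Rightarrow> 'e \<Rightarrow> 'm" where
  "chart_inv c \<equiv> inv_into (fst c) (snd c)"

text \<open>The manifold is the whole type \<open>'m\<close>.  Hausdorffness and second countability are imposed as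
  type classes where a manifold is assumed.\<close>

definition smooth_atlas :: "('m::topological_space, 'e::euclidean_space) chart set \<Rightarrow> bool" where
  "smooth_atlas A \<longleftrightarrow>
     (\<forall>c\<in>A. open (fst c) \<and> open (snd c ` fst c) \<and>
            homeomorphism (fst c) (snd c ` fst c) (snd c) (chart_inv c)) \<and>
     (\<Union>c\<in>A. fst c) = UNIV \<and>
     (\<forall>c\<in>A. \<forall>d\<in>A. smooth_on (snd c ` (fst c \<inter> fst d)) (snd d \<circ> chart_inv c))"

text \<open>The derivative of the transition map from the chart \<open>c\<close> to the chart \<open>d\<close> at the point \<open>p\<close>.\<close>

definition trans_deriv :: "('m, 'e::euclidean_space) chart \<Rightarrow> ('m, 'e) chart \<Rightarrow> 'm \<Rightarrow> 'e \<Rightarrow> 'e" where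
  "trans_deriv c d p = frechet_derivative (snd d \<circ> chart_inv c) (at (snd c p))"

definition orientable :: "('m::topological_space, real^'n) chart set \<Rightarrow> bool" where
  "orientable A \<longleftrightarrow>
     (\<exists>B. smooth_atlas B \<and> smooth_atlas (A \<union> B) \<and>
          (\<forall>c\<in>B. \<forall>d\<in>B. \<forall>p\<in>fst c \<inter> fst d. det (matrix (trans_deriv c d p)) > 0))"

text \<open>Tangent spaces: every point \<open>p\<close> gets a fixed chart \<open>chart_at A p\<close> around it, and a tangent
  vector at \<open>p\<close> is represented by its coordinate vector in that chart.  So all tangent spaces are
  copies of the model space \<open>'e\<close>, but the components in any other chart, and in particular
  smoothness of a vector field, are obtained through the derivative of the transition map.\<close>

definition chart_at :: "('m, 'e) chart set \<Rightarrow> 'm \<Rightarrow> ('m, 'e) chart" where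
  "chart_at A p = (SOME c. c \<in> A \<and> p \<in> fst c)"

definition vf_in_chart ::
  "('m, 'e::euclidean_space) chart set \<Rightarrow> ('m, 'e) chart \<Rightarrow> ('m \<Rightarrow> 'e) \<Rightarrow> 'e \<Rightarrow> 'e" where
  "vf_in_chart A c X x =
     (let p = chart_inv c x in trans_deriv (chart_at A p) c p (X p))"

text \<open>The vector field on the domain of \<open>c\<close> with constant components \<open>w\<close> in the chart \<open>c\<close>.\<close>

definition coord_field ::
  "('m, 'e::euclidean_space) chart set \<Rightarrow> ('m, 'e) chart \<Rightarrow> 'e \<Rightarrow> 'm \<Rightarrow> 'e" where
  "coord_field A c w p = trans_deriv c (chart_at A p) p w"

definition smooth_fun :: "('m, 'e::euclidean_space) chart set \<Rightarrow> 'm set \<Rightarrow> ('m \<Rightarrow> real) \<Rightarrow> bool" where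
  "smooth_fun A V f \<longleftrightarrow> (\<forall>c\<in>A. smooth_on (snd c ` (fst c \<inter> V)) (f \<circ> chart_inv c))"

definition smooth_vf :: "('m, 'e::euclidean_space) chart set \<Rightarrow> 'm set \<Rightarrow> ('m \<Rightarrow> 'e) \<Rightarrow> bool" where
  "smooth_vf A V X \<longleftrightarrow> (\<forall>c\<in>A. smooth_on (snd c ` (fst c \<inter> V)) (vf_in_chart A c X))"

text \<open>The derivative of the function \<open>f\<close> at \<open>p\<close> in the direction of the tangent vector \<open>u\<close> at \<open>p\<close>.\<close>

definition dir_deriv :: "('m, 'e::euclidean_space) chart set \<Rightarrow> 'e \<Rightarrow> ('m \<Rightarrow> real) \<Rightarrow> 'm \<Rightarrow> real" where
  "dir_deriv A u f p =
     (let c = chart_at A p in frechet_derivative (f \<circ> chart_inv c) (at (snd c p)) u)"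

definition lie_bracket ::
  "('m, 'e::euclidean_space) chart set \<Rightarrow> ('m \<Rightarrow> 'e) \<Rightarrow> ('m \<Rightarrow> 'e) \<Rightarrow> 'm \<Rightarrow> 'e" where
  "lie_bracket A X Y p =
     (let c = chart_at A p in
        frechet_derivative (vf_in_chart A c Y) (at (snd c p)) (X p)
        - frechet_derivative (vf_in_chart A c X) (at (snd c p)) (Y p))"

definition d_fields ::
  "('m, 'e::euclidean_space) chart set \<Rightarrow> ('m \<Rightarrow> 'e \<Rightarrow> real) \<Rightarrow> ('m \<Rightarrow> 'e) \<Rightarrow> ('m \<Rightarrow> 'e) \<Rightarrow> 'm \<Rightarrow> real" where
  "d_fields A \<theta> X Y p =
     dir_deriv A (X p) (\<lambda>q. \<theta> q (Y q)) p - dir_deriv A (Y p) (\<lambda>q. \<theta> q (X q)) p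
     - \<theta> p (lie_bracket A X Y p)"

text \<open>The exterior derivative as a tensor: the value on two tangent vectors at \<open>p\<close> is that of
  \<open>d_fields\<close> on extensions of them to vector fields.  It does not depend on the extensions; the
  coordinate fields of the chart at \<open>p\<close> are used.\<close>

definition ext_d ::
  "('m, 'e::euclidean_space) chart set \<Rightarrow> ('m \<Rightarrow> 'e \<Rightarrow> real) \<Rightarrow> 'm \<Rightarrow> 'e \<Rightarrow> 'e \<Rightarrow> real" where
  "ext_d A \<theta> p u v =
     d_fields A \<theta> (coord_field A (chart_at A p) u) (coord_field A (chart_at A p) v) p"


section \<open>Subbundles of the tangent bundle and tensors on them\<close>

text \<open>Tensors on a subbundle \<open>Q\<close> are functions on all of \<open>'e\<close>, of which only the values on the
  fibres of \<open>Q\<close> matter.  Smoothness of a tensor is tested on smooth local sections.\<close>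

definition subbundle ::
  "('m::topological_space, 'e::euclidean_space) chart set \<Rightarrow> 'm set \<Rightarrow> nat \<Rightarrow> ('m \<Rightarrow> 'e set) \<Rightarrow> bool" where
  "subbundle A U k Q \<longleftrightarrow>
     (\<forall>p\<in>U. subspace (Q p) \<and> dim (Q p) = k) \<and>
     (\<forall>p\<in>U. \<exists>V E. open V \<and> p \<in> V \<and> V \<subseteq> U \<and> (\<forall>i<k. smooth_vf A V (E i)) \<and>
                  (\<forall>q\<in>V. Q q = span ((\<lambda>i. E i q) ` {..<k})))"

definition corank_subbundle ::
  "('m::topological_space, 'e::euclidean_space) chart set \<Rightarrow> 'm set \<Rightarrow> nat \<Rightarrow> ('m \<Rightarrow> 'e set) \<Rightarrow> bool" where
  "corank_subbundle A U r Q \<longleftrightarrow> (\<exists>k. k + r = DIM('e) \<and> subbundle A U k Q)"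

definition sections ::
  "('m, 'e::euclidean_space) chart set \<Rightarrow> 'm set \<Rightarrow> ('m \<Rightarrow> 'e set) \<Rightarrow> ('m \<Rightarrow> 'e) set" where
  "sections A V Q = {X. smooth_vf A V X \<and> (\<forall>p\<in>V. X p \<in> Q p)}"

definition one_form ::
  "('m::topological_space, 'e::euclidean_space) chart set \<Rightarrow> 'm set \<Rightarrow> ('m \<Rightarrow> 'e \<Rightarrow> real) \<Rightarrow> bool" where
  "one_form A U \<theta> \<longleftrightarrow>
     (\<forall>p\<in>U. linear (\<theta> p)) \<and>
     (\<forall>V X. open V \<and> V \<subseteq> U \<and> smooth_vf A V X \<longrightarrow> smooth_fun A V (\<lambda>p. \<theta> p (X p)))"

definition linear_within :: "'e::real_vector set \<Rightarrow> ('e \<Rightarrow> 'f::real_vector) \<Rightarrow> bool" where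
  "linear_within S f \<longleftrightarrow>
     (\<forall>x\<in>S. \<forall>y\<in>S. f (x + y) = f x + f y) \<and> (\<forall>r. \<forall>x\<in>S. f (r *\<^sub>R x) = r *\<^sub>R f x)"

definition complex_structure ::
  "('m::topological_space, 'e::euclidean_space) chart set \<Rightarrow> 'm set \<Rightarrow> ('m \<Rightarrow> 'e set) \<Rightarrow>
   ('m \<Rightarrow> 'e \<Rightarrow> 'e) \<Rightarrow> bool" where
  "complex_structure A U Q J \<longleftrightarrow>
     (\<forall>p\<in>U. linear_within (Q p) (J p) \<and> (\<forall>x\<in>Q p. J p x \<in> Q p \<and> J p (J p x) = - x)) \<and>
     (\<forall>V X. open V \<and> V \<subseteq> U \<and> X \<in> sections A V Q \<longrightarrow> (\<lambda>p. J p (X p)) \<in> sections A V Q)"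

definition bundle_metric ::
  "('m::topological_space, 'e::euclidean_space) chart set \<Rightarrow> ('m \<Rightarrow> 'e set) \<Rightarrow>
   ('m \<Rightarrow> 'e \<Rightarrow> 'e \<Rightarrow> real) \<Rightarrow> bool" where
  "bundle_metric A Q g \<longleftrightarrow>
     (\<forall>p. (\<forall>x\<in>Q p. linear_within (Q p) (g p x)) \<and>
          (\<forall>x\<in>Q p. \<forall>y\<in>Q p. g p x y = g p y x) \<and>
          (\<forall>x\<in>Q p. x \<noteq> 0 \<longrightarrow> g p x x > 0)) \<and>
     (\<forall>V X Y. open V \<and> X \<in> sections A V Q \<and> Y \<in> sections A V Q \<longrightarrow>
              smooth_fun A V (\<lambda>p. g p (X p) (Y p)))"

definition conformal_class ::
  "('m::topological_space, 'e::euclidean_space) chart set \<Rightarrow> ('m \<Rightarrow> 'e set) \<Rightarrow>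
   ('m \<Rightarrow> 'e \<Rightarrow> 'e \<Rightarrow> real) set \<Rightarrow> bool" where
  "conformal_class A Q C \<longleftrightarrow>
     (\<exists>g. bundle_metric A Q g \<and>
          C = {g'. bundle_metric A Q g' \<and>
                   (\<exists>f. smooth_fun A UNIV f \<and> (\<forall>p. f p > 0) \<and>
                        (\<forall>p. \<forall>x\<in>Q p. \<forall>y\<in>Q p. g' p x y = f p * g p x y))})"


section \<open>Quaternionic contact structures\<close>

text \<open>Indices \<open>a = 1, 2, 3\<close> are the elements of the numeral type \<open>3\<close>.  Its arithmetic is modulo
  three, so the cyclic permutations of \<open>(1, 2, 3)\<close> are the triples \<open>(a, a + 1, a + 2)\<close>.\<close>

definition I_combination :: "(3 \<Rightarrow> 'm \<Rightarrow> 'e \<Rightarrow> 'e::real_vector) \<Rightarrow> real^3 \<Rightarrow> 'm \<Rightarrow> 'e \<Rightarrow> 'e" where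
  "I_combination Is v p x = (\<Sum>a\<in>UNIV. v $ a *\<^sub>R Is a p x)"

text \<open>A point of the fibre at \<open>p\<close> of a two-sphere bundle of complex structures of \<open>Q\<close> is a function
  restricted to \<open>Q p\<close> (and \<open>undefined\<close> outside).\<close>

definition I_sphere ::
  "('m \<Rightarrow> 'e::real_vector set) \<Rightarrow> (3 \<Rightarrow> 'm \<Rightarrow> 'e \<Rightarrow> 'e) \<Rightarrow> 'm \<Rightarrow> ('e \<Rightarrow> 'e) set" where
  "I_sphere Q Is p = (\<lambda>v. restrict (I_combination Is v p) (Q p)) ` sphere 0 1"

text \<open>A local frame of \<open>\<I>\<close>.  Injectivity says that the fibres of \<open>\<I>\<close> are two-spheres; given the
  quaternion relations it only excludes the zero bundle \<open>Q\<close>, for which all fibres are points.\<close>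

definition quaternionic_frame ::
  "('m::topological_space, 'e::euclidean_space) chart set \<Rightarrow> 'm set \<Rightarrow> ('m \<Rightarrow> 'e set) \<Rightarrow>
   ('m \<Rightarrow> ('e \<Rightarrow> 'e) set) \<Rightarrow> (3 \<Rightarrow> 'm \<Rightarrow> 'e \<Rightarrow> 'e) \<Rightarrow> bool" where
  "quaternionic_frame A V Q \<I> Is \<longleftrightarrow>
     (\<forall>a. complex_structure A V Q (Is a)) \<and>
     (\<forall>p\<in>V. (\<forall>x\<in>Q p. Is 1 p (Is 2 p x) = Is 3 p x \<and> Is 2 p (Is 1 p x) = - Is 3 p x) \<and>
             inj_on (\<lambda>v. restrict (I_combination Is v p) (Q p)) (sphere 0 1) \<and>
             \<I> p = I_sphere Q Is p)"

definition qc_structure ::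
  "('m::topological_space, 'e::euclidean_space) chart set \<Rightarrow> ('m \<Rightarrow> 'e set) \<Rightarrow>
   ('m \<Rightarrow> ('e \<Rightarrow> 'e) set) \<Rightarrow> ('m \<Rightarrow> 'e \<Rightarrow> 'e \<Rightarrow> real) set \<Rightarrow> bool" where
  "qc_structure A Q \<I> C \<longleftrightarrow>
     corank_subbundle A UNIV 3 Q \<and>
     conformal_class A Q C \<and>
     (\<forall>\<gamma>\<in>C. \<forall>p. \<forall>J\<in>\<I> p. \<forall>x\<in>Q p. \<forall>y\<in>Q p. \<gamma> p (J x) (J y) = \<gamma> p x y) \<and>
     (\<forall>p. \<exists>V Is. open V \<and> p \<in> V \<and> quaternionic_frame A V Q \<I> Is) \<and>
     (\<forall>p. \<exists>V Is \<gamma> \<eta>. open V \<and> p \<in> V \<and> quaternionic_frame A V Q \<I> Is \<and> \<gamma> \<in> C \<and>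
          (\<forall>a::3. one_form A V (\<eta> a)) \<and>
          (\<forall>q\<in>V. Q q = {x. \<forall>a. \<eta> a q x = 0} \<and>
                  (\<forall>a. \<forall>x\<in>Q q. \<forall>y\<in>Q q. \<gamma> q (Is a q x) y = ext_d A (\<eta> a) q x y)))"


section \<open>Hyper CR structures\<close>

definition almost_CR ::
  "('m::topological_space, 'e::euclidean_space) chart set \<Rightarrow> 'm set \<Rightarrow> ('m \<Rightarrow> 'e set) \<Rightarrow>
   ('m \<Rightarrow> 'e \<Rightarrow> 'e) \<Rightarrow> bool" where
  "almost_CR A U Q J \<longleftrightarrow> corank_subbundle A U 1 Q \<and> complex_structure A U Q J"

text \<open>An open set with the three pairs \<open>(Q\<^sub>a, I\<^sub>a)\<close>.\<close>

record ('m, 'e) hcr =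
  hcr_dom :: "'m set"
  hcr_Q :: "3 \<Rightarrow> 'm \<Rightarrow> 'e set"
  hcr_I :: "3 \<Rightarrow> 'm \<Rightarrow> 'e \<Rightarrow> 'e"

definition hcr_core :: "('m, 'e) hcr \<Rightarrow> 'm \<Rightarrow> 'e set" where
  "hcr_core H p = (\<Inter>a. hcr_Q H a p)"

text \<open>The data are the first two pairs.  The third one is determined by them, as \<open>I\<^sub>3\<close> is linear
  on \<open>Q\<^sub>3\<close>, which \<open>almost_CR\<close> includes.\<close>

definition almost_hyper_CR ::
  "('m::topological_space, 'e::euclidean_space) chart set \<Rightarrow> ('m, 'e) hcr \<Rightarrow> bool" where
  "almost_hyper_CR A H \<longleftrightarrow>
     open (hcr_dom H) \<and>
     (\<forall>a. almost_CR A (hcr_dom H) (hcr_Q H a) (hcr_I H a)) \<and>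
     (\<forall>p\<in>hcr_dom H.
        let D = hcr_Q H 1 p \<inter> hcr_Q H 2 p; I1 = hcr_I H 1 p; I2 = hcr_I H 2 p; I3 = hcr_I H 3 p in
        {x + y | x y. x \<in> hcr_Q H 1 p \<and> y \<in> hcr_Q H 2 p} = UNIV \<and>
        (\<forall>x \<in> I1 ` D \<inter> I2 ` D. I1 (I2 x) = - I2 (I1 x)) \<and>
        hcr_Q H 3 p = {x + y | x y. x \<in> I1 ` D \<and> y \<in> I2 ` D} \<and>
        (\<forall>x \<in> I1 ` D. I3 x = - I2 (I1 x)) \<and>
        (\<forall>x \<in> I2 ` D. I3 x = I1 (I2 x)))"

definition hyper_CR ::
  "('m::topological_space, 'e::euclidean_space) chart set \<Rightarrow> ('m, 'e) hcr \<Rightarrow> bool" where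
  "hyper_CR A H \<longleftrightarrow>
     almost_hyper_CR A H \<and>
     (\<forall>a V X Y. open V \<and> V \<subseteq> hcr_dom H \<and>
          X \<in> sections A V (hcr_core H) \<and> Y \<in> sections A V (hcr_core H) \<longrightarrow>
        (let J = hcr_I H a;
             IX = (\<lambda>p. J p (X p));
             IY = (\<lambda>p. J p (Y p));
             Z = (\<lambda>p. lie_bracket A X Y p - lie_bracket A IX IY p)
         in Z \<in> sections A V (hcr_Q H a) \<and>
            (\<lambda>p. J p (Z p) - lie_bracket A X IY p - lie_bracket A IX Y p)
              \<in> sections A V (hcr_core H)))"

definition compatible ::
  "('m::topological_space, 'e::euclidean_space) chart set \<Rightarrow> 'm set \<Rightarrow> ('m, 'e) hcr \<Rightarrow>
   (3 \<Rightarrow> 'm \<Rightarrow> 'e \<Rightarrow> real) \<Rightarrow> bool" where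
  "compatible A V H \<theta> \<longleftrightarrow>
     (\<forall>a. one_form A V (\<theta> a)) \<and>
     (\<forall>p\<in>V. \<forall>a. {x. \<theta> a p x = 0} = hcr_Q H a p \<and>
                 (\<forall>x\<in>hcr_Q H a p. \<theta> (a + 2) p (hcr_I H a p x) = \<theta> (a + 1) p x))"

text \<open>The formula for the Levi form with the index \<open>a\<close> made explicit.  For hyper CR structures and
  compatible \<open>\<theta>\<close> it gives the same form on \<open>hcr_core H\<close> for all \<open>a\<close>; wherever the Levi form occurs
  below, the condition is imposed for all \<open>a\<close>.\<close>

definition levi ::
  "('m, 'e::euclidean_space) chart set \<Rightarrow> ('m, 'e) hcr \<Rightarrow> (3 \<Rightarrow> 'm \<Rightarrow> 'e \<Rightarrow> real) \<Rightarrow> 3 \<Rightarrow>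
   'm \<Rightarrow> 'e \<Rightarrow> 'e \<Rightarrow> real" where
  "levi A H \<theta> a p x y =
     (ext_d A (\<theta> a) p x (hcr_I H a p y)
      + ext_d A (\<theta> a) p (hcr_I H (a + 1) p x) (hcr_I H (a + 2) p y)) / 2"

definition ultra_form ::
  "('m, 'e::euclidean_space) chart set \<Rightarrow> nat \<Rightarrow> ('m, 'e) hcr \<Rightarrow> (3 \<Rightarrow> 'm \<Rightarrow> 'e \<Rightarrow> real) \<Rightarrow> 3 \<Rightarrow>
   'm \<Rightarrow> 'e \<Rightarrow> 'e \<Rightarrow> real" where
  "ultra_form A n H \<theta> a p x y =
     (2 * real n + 4) * levi A H \<theta> a p x y - (\<Sum>b\<in>UNIV. ext_d A (\<theta> b) p x (hcr_I H b p y))"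

text \<open>Here \<open>4 * n + 3\<close> is the dimension of the manifold.\<close>

definition ultra_pseudoconvex ::
  "('m::topological_space, 'e::euclidean_space) chart set \<Rightarrow> nat \<Rightarrow> ('m, 'e) hcr \<Rightarrow> bool" where
  "ultra_pseudoconvex A n H \<longleftrightarrow>
     (\<exists>\<theta>. compatible A (hcr_dom H) H \<theta> \<and>
          ((\<forall>a. \<forall>p\<in>hcr_dom H. \<forall>x\<in>hcr_core H p. x \<noteq> 0 \<longrightarrow> ultra_form A n H \<theta> a p x x > 0) \<or>
           (\<forall>a. \<forall>p\<in>hcr_dom H. \<forall>x\<in>hcr_core H p. x \<noteq> 0 \<longrightarrow> ultra_form A n H \<theta> a p x x < 0)))"


section \<open>Quaternionic CR structures\<close>

definition admissible_triple ::
  "('m::topological_space, 'e::euclidean_space) chart set \<Rightarrow> 'm set \<Rightarrow> ('m, 'e) hcr \<Rightarrow>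
   (3 \<Rightarrow> 'm \<Rightarrow> 'e) \<Rightarrow> bool" where
  "admissible_triple A V H T \<longleftrightarrow>
     (\<forall>a. T a \<in> sections A V (\<lambda>p. hcr_Q H (a + 1) p \<inter> hcr_Q H (a + 2) p)) \<and>
     (\<forall>p\<in>V. span (hcr_core H p \<union> range (\<lambda>a. T a p)) = UNIV \<and>
             (\<forall>a. hcr_I H a p (T (a + 1) p) = T (a + 2) p))"

text \<open>The linear extension of \<open>I\<^sub>a\<close> to the tangent space that maps \<open>T\<^sub>a\<close> to zero: apply \<open>I\<^sub>a\<close> to
  the component in \<open>Q\<^sub>a\<close> along \<open>T\<^sub>a\<close>.\<close>

definition I_ext :: "('m, 'e::real_vector) hcr \<Rightarrow> (3 \<Rightarrow> 'm \<Rightarrow> 'e) \<Rightarrow> 3 \<Rightarrow> 'm \<Rightarrow> 'e \<Rightarrow> 'e" where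
  "I_ext H T a p x = hcr_I H a p (THE y. y \<in> hcr_Q H a p \<and> (\<exists>r. x = y + r *\<^sub>R T a p))"

definition Q_at :: "('m, 'e::real_vector) hcr \<Rightarrow> (3 \<Rightarrow> 'm \<Rightarrow> 'e) \<Rightarrow> real^3 \<Rightarrow> 'm \<Rightarrow> 'e set" where
  "Q_at H T v p =
     {x + (\<Sum>a\<in>UNIV. t $ a *\<^sub>R T a p) | x t. x \<in> hcr_core H p \<and> (\<Sum>a\<in>UNIV. t $ a * v $ a) = 0}"

text \<open>\<open>H'\<close> is obtained from \<open>H\<close> by the rotation \<open>S\<close> on the overlap.  The bundles \<open>Q\<^sub>v\<close> and the
  complex structures \<open>I\<^sub>v\<close> do not depend on the admissible triples, which exist locally.\<close>

definition rotated_by ::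
  "('m::topological_space, 'e::euclidean_space) chart set \<Rightarrow> ('m, 'e) hcr \<Rightarrow> ('m, 'e) hcr \<Rightarrow>
   ('m \<Rightarrow> real^3^3) \<Rightarrow> bool" where
  "rotated_by A H H' S \<longleftrightarrow>
     (let W = hcr_dom H \<inter> hcr_dom H' in
      (\<forall>i j. smooth_fun A W (\<lambda>p. S p $ i $ j)) \<and>
      (\<forall>p\<in>W. rotation_matrix (S p)) \<and>
      (\<forall>p\<in>W. \<exists>V T T'. open V \<and> p \<in> V \<and> V \<subseteq> W \<and>
         admissible_triple A V H T \<and> admissible_triple A V H' T' \<and>
         (\<forall>q\<in>V. \<forall>v\<in>sphere 0 1.
            Q_at H' T' v q = Q_at H T (S q *v v) q \<and>
            (\<forall>x\<in>Q_at H' T' v q.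
               I_combination (I_ext H' T') v q x = I_combination (I_ext H T) (S q *v v) q x))))"

definition quaternionic_CR ::
  "('m::topological_space, 'e::euclidean_space) chart set \<Rightarrow> ('m, 'e) hcr set \<Rightarrow> bool" where
  "quaternionic_CR A \<H> \<longleftrightarrow>
     (\<forall>H\<in>\<H>. hyper_CR A H) \<and> (\<Union>H\<in>\<H>. hcr_dom H) = UNIV \<and>
     (\<forall>H\<in>\<H>. \<forall>H'\<in>\<H>. \<exists>S. rotated_by A H H' S)"

definition underlying_structure ::
  "('m, 'e::real_vector) hcr set \<Rightarrow> ('m \<Rightarrow> 'e set) \<Rightarrow> ('m \<Rightarrow> ('e \<Rightarrow> 'e) set) \<Rightarrow> bool" where
  "underlying_structure \<H> Q \<I> \<longleftrightarrow>
     (\<forall>H\<in>\<H>. \<forall>p\<in>hcr_dom H. Q p = hcr_core H p \<and> \<I> p = I_sphere (hcr_core H) (hcr_I H) p)"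

text \<open>The global Levi forms of a quaternionic CR structure, from compatible forms that are rotated
  in the same way as the hyper CR structures.  As for conformal classes, the values outside the
  bundle are arbitrary.\<close>

definition levi_forms ::
  "('m::topological_space, 'e::euclidean_space) chart set \<Rightarrow> ('m, 'e) hcr set \<Rightarrow>
   ('m \<Rightarrow> 'e \<Rightarrow> 'e \<Rightarrow> real) set" where
  "levi_forms A \<H> =
     {g. \<exists>\<theta>. (\<forall>H\<in>\<H>. compatible A (hcr_dom H) H (\<theta> H)) \<and>
             (\<forall>H\<in>\<H>. \<forall>H'\<in>\<H>. \<exists>S. rotated_by A H H' S \<and>
                (\<forall>p \<in> hcr_dom H \<inter> hcr_dom H'. \<forall>v x.
                   (\<Sum>a\<in>UNIV. v $ a * \<theta> H' a p x) = (\<Sum>a\<in>UNIV. (S p *v v) $ a * \<theta> H a p x))) \<and>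
             (\<forall>H\<in>\<H>. \<forall>p\<in>hcr_dom H. \<forall>x\<in>hcr_core H p. \<forall>y\<in>hcr_core H p. \<forall>a.
                g p x y = levi A H (\<theta> H) a p x y)}"

end

theory Submission
  imports Defs
begin

text \<open>Let \<open>Q = ker \<eta>\<close> with \<open>d\<eta>\<^sub>b = \<gamma>(J\<^sub>b\<cdot>,\<cdot>)\<close> on \<open>Q\<close>.  A compatible form \<open>\<theta>\<close> also vanishes on \<open>Q\<close>, so at
  each point every \<open>\<theta>\<^sub>a\<close> is a combination of the \<open>\<eta>\<^sub>b\<close>, and on \<open>Q\<close> the same combination expresses
  \<open>d\<theta>\<^sub>a\<close> by the \<open>d\<eta>\<^sub>b\<close>, hence by the forms \<open>\<gamma>(I\<^sub>b\<cdot>,\<cdot>)\<close>.  Integrability leaves only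
  \<open>d\<theta>\<^sub>a = \<lambda> \<gamma>(I\<^sub>a\<cdot>,\<cdot>)\<close> with one nowhere vanishing factor \<open>\<lambda>\<close>, so that \<open>Levi\<^sub>\<theta> = \<lambda> \<gamma>\<close>.  Conversely
  \<open>\<theta> / \<lambda>\<close> is the only compatible form with Levi form \<open>\<gamma>\<close>; by uniqueness these local forms fit
  together, also under the rotations between the hyper CR structures.  The sign of \<open>\<lambda>\<close> is constant
  because \<open>M\<close> is connected.\<close>

section \<open>Calculus of smooth functions\<close>

text \<open>The contact form \<open>\<eta>\<close> and its frame \<open>Is\<close> are not adapted
  to the hyper CR structure: the two sides share only \<open>Q\<close> and the sphere bundle, and
  they are compared point by point, with coefficients not known to be even continuous. This does no
  harm to the algebra: if \<phi> vanishes on \<open>Q\<close>, then d\<phi>(X,Y) = - \<phi>([X,Y])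
  for sections of \<open>Q\<close>, so that no derivative of a coefficient ever enters. Smoothness
  of \<lambda> has to be recovered separately: integrability asserts that a certain combination of
  brackets is a smooth field, and \<theta> applied to it gives a multiple of \<lambda>
  \<gamma>(X,X). Prescribing the Levi form is what makes gluing possible, since a compatible form is
  otherwise free up to a function of either sign; for the same reason the Levi forms make up
  \<open>C\<close> together with its negatives. The existence of compatible forms is drawn from the
  admissible triples that \<open>rotated_by\<close> provides.\<close>

lemma frechet_derivative_cong_open:
  assumes "open S" "x \<in> S" "\<And>y. y \<in> S \<Longrightarrow> f y = g y"
  shows "frechet_derivative f (at x) = frechet_derivative g (at x)"
proof -
  \<comment> \<open>\<open>frechet_derivative\<close> is a choice from the set of derivatives, so it
    is enough to compare these sets.\<close>
  have "(f has_derivative D) (at x) \<longleftrightarrow> (g has_derivative D) (at x)" for D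
    using assms by (metis has_derivative_transform_within_open)
  then show ?thesis by (simp add: frechet_derivative_def)
qed

lemma differentiable_cong_open:
  assumes "open S" "x \<in> S" "\<And>y. y \<in> S \<Longrightarrow> f y = g y" "f differentiable (at x)"
  shows "g differentiable (at x)"
  using assms unfolding differentiable_def by (metis has_derivative_transform_within_open)

lemma Ck_on_mono: "Ck_on k S f \<Longrightarrow> T \<subseteq> S \<Longrightarrow> Ck_on k T f"
  by (induction k arbitrary: f) (auto intro: continuous_on_subset)

lemma Ck_on_cong:
  assumes "Ck_on k S f" "open S" "\<And>x. x \<in> S \<Longrightarrow> f x = g x"
  shows "Ck_on k S g"
  using assms
proof (induction k arbitrary: f g)
  case 0
  then show ?case by (simp cong: continuous_on_cong)
next
  case (Suc k)
  have "frechet_derivative f (at x) v = frechet_derivative g (at x) v" if "x \<in> S" for x v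
    using frechet_derivative_cong_open[of S x f g] Suc.prems that by simp
  then have "Ck_on k S (\<lambda>x. frechet_derivative g (at x) v)" for v
    using Suc.IH[of "\<lambda>x. frechet_derivative f (at x) v" "\<lambda>x. frechet_derivative g (at x) v"] Suc.prems
    by simp
  moreover have "g differentiable (at x)" if "x \<in> S" for x
    using differentiable_cong_open[of S x f g] Suc.prems that by simp
  ultimately show ?case by simp
qed

lemma Ck_on_local:
  assumes "\<And>x. x \<in> S \<Longrightarrow> \<exists>T. open T \<and> x \<in> T \<and> Ck_on k T f"
  shows "Ck_on k S f"
  using assms
proof (induction k arbitrary: f)
  case 0
  then have "isCont f x" if "x \<in> S" for x
    using that by (metis Ck_on.simps(1) continuous_on_eq_continuous_at)
  then show ?case by (simp add: continuous_at_imp_continuous_on)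
next
  case (Suc k)
  have "\<exists>T. open T \<and> x \<in> T \<and> Ck_on k T (\<lambda>x. frechet_derivative f (at x) v)" if "x \<in> S" for x v
    using Suc.prems[OF that] by auto
  moreover have "f differentiable (at x)" if "x \<in> S" for x
    using Suc.prems[OF that] by auto
  ultimately show ?case using Suc.IH by simp
qed

lemma Ck_on_SucD: "Ck_on (Suc k) S f \<Longrightarrow> Ck_on k S f"
proof (induction k arbitrary: f)
  case 0
  then show ?case
    by (auto intro!: continuous_at_imp_continuous_on differentiable_imp_continuous_within)
qed auto

text \<open>Replaces the chosen \<open>frechet_derivative\<close> by whatever derivative
  \<open>D\<close> a calculus rule delivers; the inductive closure rules below all pass through
  it.\<close>

lemma Ck_on_SucI:
  assumes "open S" "\<And>x. x \<in> S \<Longrightarrow> (f has_derivative D x) (at x)" "\<And>v. Ck_on k S (\<lambda>x. D x v)"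
  shows "Ck_on (Suc k) S f"
proof -
  have "D x = frechet_derivative f (at x)" if "x \<in> S" for x
    using assms(2)[OF that] by (rule frechet_derivative_at)
  then have "Ck_on k S (\<lambda>x. frechet_derivative f (at x) v)" for v
    using Ck_on_cong[OF assms(3)[of v] assms(1), of "\<lambda>x. frechet_derivative f (at x) v"] by simp
  then show ?thesis using assms(2) by (auto simp: differentiable_def)
qed

lemma Ck_on_has_derivative:
  "Ck_on (Suc k) S f \<Longrightarrow> x \<in> S \<Longrightarrow> (f has_derivative frechet_derivative f (at x)) (at x)"
  by (simp add: frechet_derivative_works)

lemma Ck_on_const: "open S \<Longrightarrow> Ck_on k S (\<lambda>x. c)"
proof (induction k arbitrary: c)
  case (Suc k)
  then show ?case by (intro Ck_on_SucI[where D = "\<lambda>x v. 0"]) auto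
qed auto

lemma Ck_on_add:
  assumes "open S" "Ck_on k S f" "Ck_on k S g"
  shows "Ck_on k S (\<lambda>x. f x + g x)"
  using assms(2,3)
proof (induction k arbitrary: f g)
  case (Suc k)
  have D: "((\<lambda>x. f x + g x) has_derivative
     (\<lambda>v. frechet_derivative f (at x) v + frechet_derivative g (at x) v)) (at x)"
    if "x \<in> S" for x
    using that Suc.prems by (intro has_derivative_add Ck_on_has_derivative)
  show ?case
    by (intro Ck_on_SucI[OF assms(1) D] Suc.IH) (use Suc.prems in auto)
qed (simp add: continuous_on_add)

lemma Ck_on_linear:
  assumes "bounded_linear L" "open S" "Ck_on k S f"
  shows "Ck_on k S (\<lambda>x. L (f x))"
  using assms(3)
proof (induction k arbitrary: f)
  case 0
  then show ?case using assms(1) by (auto intro: bounded_linear.continuous_on)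
next
  case (Suc k)
  have D: "((\<lambda>x. L (f x)) has_derivative (\<lambda>v. L (frechet_derivative f (at x) v))) (at x)"
    if "x \<in> S" for x
    using that Suc.prems by (intro bounded_linear.has_derivative[OF assms(1)] Ck_on_has_derivative)
  show ?case
    by (intro Ck_on_SucI[OF assms(2) D] Suc.IH) (use Suc.prems in auto)
qed

lemma Ck_on_scaleR:
  assumes "open S" "Ck_on k S f" "Ck_on k S g"
  shows "Ck_on k S (\<lambda>x. f x *\<^sub>R g x)"
  using assms(2,3)
proof (induction k arbitrary: f g)
  case (Suc k)
  have D: "((\<lambda>x. f x *\<^sub>R g x) has_derivative
     (\<lambda>v. f x *\<^sub>R frechet_derivative g (at x) v + frechet_derivative f (at x) v *\<^sub>R g x)) (at x)"
    if "x \<in> S" for x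
    using that Suc.prems by (intro has_derivative_scaleR Ck_on_has_derivative)
  \<comment> \<open>The product rule leaves undifferentiated factors, so both hypotheses are also
    used one order lower.\<close>
  show ?case
    by (intro Ck_on_SucI[OF assms(1) D] Ck_on_add Suc.IH assms(1))
      (use Ck_on_SucD[OF Suc.prems(1)] Ck_on_SucD[OF Suc.prems(2)] Suc.prems in simp_all)
qed (simp add: continuous_on_scaleR)

lemma Ck_on_sum:
  assumes "open S" "\<And>i. i \<in> I \<Longrightarrow> Ck_on k S (f i)"
  shows "Ck_on k S (\<lambda>x. \<Sum>i\<in>I. f i x)"
  using assms(2)
  by (induction I rule: infinite_finite_induct) (auto intro: Ck_on_const Ck_on_add assms(1))

lemma Ck_on_inverse:
  fixes f :: "'e::real_normed_vector \<Rightarrow> real"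
  assumes "open S" "Ck_on k S f" "\<And>x. x \<in> S \<Longrightarrow> f x \<noteq> 0"
  shows "Ck_on k S (\<lambda>x. inverse (f x))"
  using assms(2)
proof (induction k)
  case 0
  then show ?case using assms(3) by (auto intro: continuous_on_inverse)
next
  case (Suc k)
  have D: "((\<lambda>x. inverse (f x)) has_derivative
     (\<lambda>v. - (inverse (f x) *\<^sub>R frechet_derivative f (at x) v *\<^sub>R inverse (f x)))) (at x)"
    if "x \<in> S" for x
    using Deriv.has_derivative_inverse[OF assms(3)[OF that] Ck_on_has_derivative[OF Suc.prems that]]
    by (simp add: mult.assoc)
  \<comment> \<open>The derivative of 1/f contains 1/f itself, now one order lower; hence an
    induction with \<open>f\<close> fixed.\<close>
  have I: "Ck_on k S (\<lambda>x. inverse (f x))"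
    by (rule Suc.IH[OF Ck_on_SucD[OF Suc.prems]])
  show ?case
    using Suc.prems I
    by (intro Ck_on_SucI[OF assms(1) D] Ck_on_linear[OF bounded_linear_minus[OF bounded_linear_ident]]
        Ck_on_scaleR assms(1)) auto
qed

lemma Ck_on_compose:
  fixes f :: "'a::euclidean_space \<Rightarrow> 'b::real_normed_vector"
    and g :: "'c::real_normed_vector \<Rightarrow> 'a"
  assumes "open S" "open T" "Ck_on k T f" "Ck_on k S g" "g ` S \<subseteq> T"
  shows "Ck_on k S (\<lambda>x. f (g x))"
  using assms(3,4)
proof (induction k arbitrary: f)
  case 0
  then show ?case using assms(5) by (auto intro: continuous_on_compose2)
next
  case (Suc k)
  \<comment> \<open>In the chain rule the direction in which \<open>f\<close> is differentiated
    moves with \<open>x\<close>, while \<open>Ck_on\<close> controls fixed directions only.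
    Expanding the direction in the basis separates the two, which is why the domain of
    \<open>f\<close> is Euclidean.\<close>
  let ?D = "\<lambda>x v. \<Sum>b\<in>Basis. (frechet_derivative g (at x) v \<bullet> b) *\<^sub>R frechet_derivative f (at (g x)) b"
  have D: "((\<lambda>x. f (g x)) has_derivative ?D x) (at x)" if "x \<in> S" for x
  proof -
    have f: "(f has_derivative frechet_derivative f (at (g x))) (at (g x))"
      using assms(5) that by (intro Ck_on_has_derivative[OF Suc.prems(1)]) auto
    have lin: "linear (frechet_derivative f (at (g x)))"
      using f by (rule has_derivative_linear)
    have sum: "frechet_derivative f (at (g x)) w
      = (\<Sum>b\<in>Basis. (w \<bullet> b) *\<^sub>R frechet_derivative f (at (g x)) b)" for w
      by (subst (1) euclidean_representation[symmetric]) (simp add: linear_sum[OF lin] linear_scale[OF lin])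
    show ?thesis
      using has_derivative_compose[OF Ck_on_has_derivative[OF Suc.prems(2) that] f]
      by (subst (asm) sum)
  qed
  show ?case
  proof (intro Ck_on_SucI[OF assms(1) D] Ck_on_sum Ck_on_scaleR assms(1))
    fix v b
    show "Ck_on k S (\<lambda>x. frechet_derivative g (at x) v \<bullet> b)"
      by (rule Ck_on_linear[OF bounded_linear_inner_left assms(1)]) (use Suc.prems(2) in auto)
    show "Ck_on k S (\<lambda>x. frechet_derivative f (at (g x)) b)"
      by (rule Suc.IH) (use Suc.prems(1) Ck_on_SucD[OF Suc.prems(2)] in auto)
  qed
qed

section \<open>Closure rules for smoothness of all orders\<close>

lemma smooth_on_mono: "smooth_on S f \<Longrightarrow> T \<subseteq> S \<Longrightarrow> smooth_on T f"
  unfolding smooth_on_def by (blast intro: Ck_on_mono)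

lemma smooth_on_cong:
  assumes "smooth_on S f" "open S" "\<And>x. x \<in> S \<Longrightarrow> f x = g x"
  shows "smooth_on S g"
  using assms unfolding smooth_on_def by (blast intro: Ck_on_cong)

lemma smooth_on_local:
  assumes "\<And>x. x \<in> S \<Longrightarrow> \<exists>T. open T \<and> x \<in> T \<and> smooth_on T f"
  shows "smooth_on S f"
  unfolding smooth_on_def
proof
  fix k
  show "Ck_on k S f"
    by (rule Ck_on_local) (use assms in \<open>unfold smooth_on_def, blast\<close>)
qed

lemma smooth_on_add:
  "open S \<Longrightarrow> smooth_on S f \<Longrightarrow> smooth_on S g \<Longrightarrow> smooth_on S (\<lambda>x. f x + g x)"
  unfolding smooth_on_def by (blast intro: Ck_on_add)

lemma smooth_on_scaleR:
  "open S \<Longrightarrow> smooth_on S f \<Longrightarrow> smooth_on S g \<Longrightarrow> smooth_on S (\<lambda>x. f x *\<^sub>R g x)"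
  unfolding smooth_on_def by (blast intro: Ck_on_scaleR)

lemma smooth_on_const: "open S \<Longrightarrow> smooth_on S (\<lambda>x. c)"
  unfolding smooth_on_def by (blast intro: Ck_on_const)

lemma smooth_on_inverse:
  fixes f :: "'e::real_normed_vector \<Rightarrow> real"
  shows "open S \<Longrightarrow> smooth_on S f \<Longrightarrow> (\<And>x. x \<in> S \<Longrightarrow> f x \<noteq> 0) \<Longrightarrow> smooth_on S (\<lambda>x. inverse (f x))"
  unfolding smooth_on_def by (blast intro: Ck_on_inverse)

lemma smooth_on_compose:
  fixes f :: "'a::euclidean_space \<Rightarrow> 'b::real_normed_vector"
    and g :: "'c::real_normed_vector \<Rightarrow> 'a"
  assumes "open S" "open T" "smooth_on T f" "smooth_on S g" "g ` S \<subseteq> T"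
  shows "smooth_on S (\<lambda>x. f (g x))"
  using assms unfolding smooth_on_def by (blast intro: Ck_on_compose)

lemma smooth_on_frechet_derivative:
  assumes "smooth_on S f"
  shows "smooth_on S (\<lambda>x. frechet_derivative f (at x) v)"
  unfolding smooth_on_def
proof
  fix k
  have "Ck_on (Suc k) S f" using assms by (simp only: smooth_on_def)
  then show "Ck_on k S (\<lambda>x. frechet_derivative f (at x) v)" by simp
qed

lemma smooth_on_has_derivative:
  "smooth_on S f \<Longrightarrow> x \<in> S \<Longrightarrow> (f has_derivative frechet_derivative f (at x)) (at x)"
  unfolding smooth_on_def by (blast intro: Ck_on_has_derivative)

lemma smooth_on_continuous: "smooth_on S f \<Longrightarrow> continuous_on S f"
  unfolding smooth_on_def by (metis Ck_on.simps(1))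

section \<open>Charts and the exterior derivative\<close>

lemma chart_open: "smooth_atlas A \<Longrightarrow> c \<in> A \<Longrightarrow> open (fst c)"
  by (simp add: smooth_atlas_def)

lemma chart_inv_chart [simp]:
  "smooth_atlas A \<Longrightarrow> c \<in> A \<Longrightarrow> p \<in> fst c \<Longrightarrow> chart_inv c (snd c p) = p"
  unfolding smooth_atlas_def homeomorphism_def by blast

lemma open_chart_image:
  assumes "smooth_atlas A" "c \<in> A" "open V"
  shows "open (snd c ` (fst c \<inter> V))"
proof -
  have "openin (top_of_set (snd c ` fst c)) (snd c ` (fst c \<inter> V))"
    using assms unfolding smooth_atlas_def
    by (intro homeomorphism_imp_open_map[where S = "fst c" and g = "chart_inv c"]) (auto intro: openin_open_Int)
  then show ?thesis
    using assms unfolding smooth_atlas_def by (auto intro: openin_open_trans)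
qed

lemma chart_at:
  assumes "smooth_atlas A"
  shows "chart_at A p \<in> A" "p \<in> fst (chart_at A p)"
proof -
  have "\<exists>c. c \<in> A \<and> p \<in> fst c"
    using assms unfolding smooth_atlas_def by blast
  then show "chart_at A p \<in> A" "p \<in> fst (chart_at A p)"
    unfolding chart_at_def by (metis (mono_tags, lifting) someI_ex)+
qed

lemma smooth_on_transition:
  "smooth_atlas A \<Longrightarrow> c \<in> A \<Longrightarrow> d \<in> A \<Longrightarrow> smooth_on (snd c ` (fst c \<inter> fst d)) (snd d \<circ> chart_inv c)"
  unfolding smooth_atlas_def by blast

section \<open>Derivatives of transition maps\<close>

lemma has_derivative_transition:
  assumes "smooth_atlas A" "c \<in> A" "d \<in> A" "p \<in> fst c" "p \<in> fst d"
  shows "((snd d \<circ> chart_inv c) has_derivative trans_deriv c d p) (at (snd c p))"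
  unfolding trans_deriv_def
  by (rule smooth_on_has_derivative[OF smooth_on_transition]) (use assms in auto)

lemma linear_trans_deriv:
  assumes "smooth_atlas A" "c \<in> A" "d \<in> A" "p \<in> fst c" "p \<in> fst d"
  shows "linear (trans_deriv c d p)"
  using has_derivative_transition[OF assms] by (rule has_derivative_linear)

lemma trans_deriv_self:
  assumes "smooth_atlas A" "c \<in> A" "p \<in> fst c"
  shows "trans_deriv c c p w = w"
proof -
  have "((\<lambda>x. x) has_derivative trans_deriv c c p) (at (snd c p))"
    by (rule has_derivative_transform_within_open[OF has_derivative_transition[OF assms(1,2,2,3,3)]
          open_chart_image[OF assms(1,2) open_UNIV]])
      (use assms in auto)
  then have "(\<lambda>x. x) = trans_deriv c c p"
    by (rule has_derivative_unique[OF has_derivative_ident])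
  then show ?thesis by metis
qed

lemma trans_deriv_trans:
  assumes "smooth_atlas A" "c \<in> A" "d \<in> A" "e \<in> A" "p \<in> fst c" "p \<in> fst d" "p \<in> fst e"
  shows "trans_deriv d e p (trans_deriv c d p w) = trans_deriv c e p w"
proof -
  have pd: "(snd d \<circ> chart_inv c) (snd c p) = snd d p"
    using assms by simp
  have "((\<lambda>x. (snd e \<circ> chart_inv d) ((snd d \<circ> chart_inv c) x)) has_derivative
      (\<lambda>w. trans_deriv d e p (trans_deriv c d p w))) (at (snd c p))"
    using has_derivative_compose[OF has_derivative_transition[OF assms(1-3,5,6)],
      of "snd e \<circ> chart_inv d", unfolded pd, OF has_derivative_transition[OF assms(1,3,4,6,7)]] .
  then have "((snd e \<circ> chart_inv c) has_derivative
      (\<lambda>w. trans_deriv d e p (trans_deriv c d p w))) (at (snd c p))"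
    by (rule has_derivative_transform_within_open[OF _ open_chart_image[OF assms(1,2), of "fst d"]])
      (use assms chart_open[OF assms(1,3)] in auto)
  then have "(\<lambda>w. trans_deriv d e p (trans_deriv c d p w)) = trans_deriv c e p"
    by (rule has_derivative_unique[OF _ has_derivative_transition[OF assms(1,2,4,5,7)]])
  then show ?thesis by metis
qed

lemma vf_in_chart_chart:
  "smooth_atlas A \<Longrightarrow> c \<in> A \<Longrightarrow> p \<in> fst c \<Longrightarrow>
    vf_in_chart A c X (snd c p) = trans_deriv (chart_at A p) c p (X p)"
  by (simp add: vf_in_chart_def)

section \<open>Smooth functions on the manifold\<close>

lemma smooth_fun_mono: "smooth_fun A V f \<Longrightarrow> W \<subseteq> V \<Longrightarrow> smooth_fun A W f"
  unfolding smooth_fun_def by (blast intro: smooth_on_mono)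

lemma smooth_fun_cong:
  assumes "smooth_atlas A" "open V" "smooth_fun A V f" "\<And>p. p \<in> V \<Longrightarrow> f p = g p"
  shows "smooth_fun A V g"
  unfolding smooth_fun_def
proof
  fix c assume c: "c \<in> A"
  show "smooth_on (snd c ` (fst c \<inter> V)) (g \<circ> chart_inv c)"
    by (rule smooth_on_cong[of _ "f \<circ> chart_inv c", OF _ open_chart_image[OF assms(1) c assms(2)]])
      (use assms(1,3,4) c in \<open>auto simp: smooth_fun_def comp_def\<close>)
qed

lemma smooth_fun_local:
  assumes "smooth_atlas A" "\<And>p. p \<in> V \<Longrightarrow> \<exists>W. open W \<and> p \<in> W \<and> smooth_fun A W f"
  shows "smooth_fun A V f"
  unfolding smooth_fun_def
proof (intro ballI smooth_on_local)
  fix c x assume c: "c \<in> A" and "x \<in> snd c ` (fst c \<inter> V)"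
  then obtain p where p: "p \<in> fst c" "p \<in> V" "x = snd c p" by blast
  then obtain W where "open W" "p \<in> W" "smooth_fun A W f" using assms(2) by blast
  then show "\<exists>T. open T \<and> x \<in> T \<and> smooth_on T (f \<circ> chart_inv c)"
    using open_chart_image[OF assms(1) c] c p
    by (intro exI[of _ "snd c ` (fst c \<inter> W)"]) (auto simp: smooth_fun_def)
qed

lemma smooth_fun_const: "smooth_atlas A \<Longrightarrow> open V \<Longrightarrow> smooth_fun A V (\<lambda>p. r)"
  unfolding smooth_fun_def comp_def by (blast intro: smooth_on_const open_chart_image)

lemma smooth_fun_add:
  "smooth_atlas A \<Longrightarrow> open V \<Longrightarrow> smooth_fun A V f \<Longrightarrow> smooth_fun A V g \<Longrightarrow>
    smooth_fun A V (\<lambda>p. f p + g p)"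
  unfolding smooth_fun_def comp_def by (intro ballI smooth_on_add open_chart_image) auto

lemma smooth_fun_mult:
  "smooth_atlas A \<Longrightarrow> open V \<Longrightarrow> smooth_fun A V f \<Longrightarrow> smooth_fun A V g \<Longrightarrow>
    smooth_fun A V (\<lambda>p. f p * g p)"
  unfolding smooth_fun_def comp_def real_scaleR_def[symmetric]
  by (intro ballI smooth_on_scaleR open_chart_image) auto

lemma smooth_fun_sum:
  assumes "smooth_atlas A" "open V" "\<And>i. i \<in> I \<Longrightarrow> smooth_fun A V (f i)"
  shows "smooth_fun A V (\<lambda>p. \<Sum>i\<in>I. f i p)"
  using assms(3)
  by (induction I rule: infinite_finite_induct)
    (simp_all add: smooth_fun_const[OF assms(1,2)] smooth_fun_add[OF assms(1,2)])

lemma smooth_fun_inverse: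
  assumes "smooth_atlas A" "open V" "smooth_fun A V f" "\<And>p. p \<in> V \<Longrightarrow> f p \<noteq> 0"
  shows "smooth_fun A V (\<lambda>p. inverse (f p))"
  unfolding smooth_fun_def comp_def
proof
  fix c assume c: "c \<in> A"
  show "smooth_on (snd c ` (fst c \<inter> V)) (\<lambda>x. inverse (f (chart_inv c x)))"
    by (rule smooth_on_inverse[OF open_chart_image[OF assms(1) c assms(2)]])
      (use assms(1,3,4) c in \<open>auto simp: smooth_fun_def comp_def\<close>)
qed

lemma smooth_fun_continuous:
  fixes A :: "('m::t2_space, 'e::euclidean_space) chart set"
  assumes A: "smooth_atlas A" and V: "open V" and f: "smooth_fun A V f"
  shows "continuous_on V f"
proof -
  have "isCont f p" if "p \<in> V" for p
  proof -
    let ?c = "chart_at A p"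
    note c = chart_at[OF A, of p]
    have h: "homeomorphism (fst ?c) (snd ?c ` fst ?c) (snd ?c) (chart_inv ?c)"
      using A c unfolding smooth_atlas_def by blast
    have "continuous_on (snd ?c ` (fst ?c \<inter> V)) (f \<circ> chart_inv ?c)"
      using f c unfolding smooth_fun_def by (intro smooth_on_continuous) auto
    then have "continuous_on (fst ?c \<inter> V) (\<lambda>q. (f \<circ> chart_inv ?c) (snd ?c q))"
      by (rule continuous_on_compose2)
        (use h in \<open>auto simp: homeomorphism_def intro: continuous_on_subset\<close>)
    then have "continuous_on (fst ?c \<inter> V) f"
      by (rule continuous_on_eq) (use A c in auto)
    then show ?thesis
      using chart_open[OF A c(1)] V c(2) that by (simp add: continuous_on_eq_continuous_at open_Int)
  qed
  then show ?thesis by (simp add: continuous_at_imp_continuous_on)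
qed

section \<open>Smooth vector fields\<close>

lemma smooth_vf_mono: "smooth_vf A V X \<Longrightarrow> W \<subseteq> V \<Longrightarrow> smooth_vf A W X"
  unfolding smooth_vf_def by (blast intro: smooth_on_mono)

lemma smooth_vf_add:
  assumes "smooth_atlas A" "open V" "smooth_vf A V X" "smooth_vf A V Y"
  shows "smooth_vf A V (\<lambda>p. X p + Y p)"
  unfolding smooth_vf_def
proof
  fix c assume c: "c \<in> A"
  note o = open_chart_image[OF assms(1) c assms(2)]
  show "smooth_on (snd c ` (fst c \<inter> V)) (vf_in_chart A c (\<lambda>p. X p + Y p))"
    by (rule smooth_on_cong[OF smooth_on_add[OF o, of "vf_in_chart A c X" "vf_in_chart A c Y"] o])
      (use assms c chart_at[OF assms(1)] in
        \<open>auto simp: smooth_vf_def vf_in_chart_chart linear_add[OF linear_trans_deriv[OF assms(1)]]\<close>)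
qed

lemma smooth_vf_scaleR:
  assumes "smooth_atlas A" "open V" "smooth_vf A V X"
  shows "smooth_vf A V (\<lambda>p. r *\<^sub>R X p)"
  unfolding smooth_vf_def
proof
  fix c assume c: "c \<in> A"
  note o = open_chart_image[OF assms(1) c assms(2)]
  show "smooth_on (snd c ` (fst c \<inter> V)) (vf_in_chart A c (\<lambda>p. r *\<^sub>R X p))"
    by (rule smooth_on_cong[OF smooth_on_scaleR[OF o smooth_on_const[OF o], of "vf_in_chart A c X" r] o])
      (use assms c chart_at[OF assms(1)] in
        \<open>auto simp: smooth_vf_def vf_in_chart_chart linear_scale[OF linear_trans_deriv[OF assms(1)]]\<close>)
qed

lemma smooth_vf_sum:
  assumes "smooth_atlas A" "open V" "finite I" "I \<noteq> {}" "\<And>i. i \<in> I \<Longrightarrow> smooth_vf A V (X i)"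
  shows "smooth_vf A V (\<lambda>p. \<Sum>i\<in>I. r i *\<^sub>R X i p)"
  using assms(3-5)
proof (induction I rule: finite_ne_induct)
  case (singleton i)
  then show ?case by (simp add: smooth_vf_scaleR[OF assms(1,2)])
next
  case (insert i I)
  then have "smooth_vf A V (\<lambda>p. r i *\<^sub>R X i p + (\<Sum>j\<in>I. r j *\<^sub>R X j p))"
    by (intro smooth_vf_add[OF assms(1,2)] smooth_vf_scaleR[OF assms(1,2)]) auto
  then show ?case using insert.hyps by simp
qed

text \<open>Seen in a chart \<open>d\<close>, the field is the derivative of the transition from
  \<open>c\<close> to \<open>d\<close>, evaluated at a point that moves by the transition from
  \<open>d\<close> to \<open>c\<close>; both are smooth.\<close>

lemma smooth_vf_coord_field:
  assumes A: "smooth_atlas A" and c: "c \<in> A"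
  shows "smooth_vf A (fst c) (coord_field A c w)"
  unfolding smooth_vf_def
proof
  fix d assume d: "d \<in> A"
  note o = open_chart_image[OF A d chart_open[OF A c]]
  have "smooth_on (snd d ` (fst d \<inter> fst c))
      (\<lambda>x. frechet_derivative (snd d \<circ> chart_inv c) (at ((snd c \<circ> chart_inv d) x)) w)"
    by (rule smooth_on_compose[OF o open_chart_image[OF A c chart_open[OF A d]]
          smooth_on_frechet_derivative[OF smooth_on_transition[OF A c d]] smooth_on_transition[OF A d c]])
      (use A c d in auto)
  then show "smooth_on (snd d ` (fst d \<inter> fst c)) (vf_in_chart A d (coord_field A c w))"
    by (rule smooth_on_cong[OF _ o])
      (use A c d chart_at[OF A] in
        \<open>auto simp: vf_in_chart_chart coord_field_def trans_deriv_trans trans_deriv_def[symmetric]\<close>)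
qed

lemma smooth_vf_has_derivative:
  assumes "smooth_vf A V X" "c \<in> A" "p \<in> fst c" "p \<in> V"
  shows "(vf_in_chart A c X has_derivative frechet_derivative (vf_in_chart A c X) (at (snd c p))) (at (snd c p))"
  by (rule smooth_on_has_derivative[of "snd c ` (fst c \<inter> V)"]) (use assms in \<open>auto simp: smooth_vf_def\<close>)

section \<open>The exterior derivative of a one-form as a tensor\<close>

lemma linear_euclidean_sum:
  fixes f :: "'e::euclidean_space \<Rightarrow> real"
  assumes "linear f"
  shows "(\<Sum>b\<in>Basis. (w \<bullet> b) * f b) = f w"
proof -
  have "f w = f (\<Sum>b\<in>Basis. (w \<bullet> b) *\<^sub>R b)" by (simp only: euclidean_representation)
  also have "\<dots> = (\<Sum>b\<in>Basis. (w \<bullet> b) * f b)"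
    unfolding linear_sum[OF assms] linear_scale[OF assms] by simp
  finally show ?thesis by simp
qed

lemma one_form_smooth:
  "one_form A V \<theta> \<Longrightarrow> open W \<Longrightarrow> W \<subseteq> V \<Longrightarrow> smooth_vf A W X \<Longrightarrow> smooth_fun A W (\<lambda>p. \<theta> p (X p))"
  unfolding one_form_def by blast

text \<open>Leibniz rule for \<theta>(Y), written as the sum of the components of \<open>Y\<close>
  times \<theta> of the coordinate fields. The term with the derivative of \<open>Y\<close> is what
  the Lie bracket cancels in \<open>d_fields\<close>; the other one sees only the value of
  \<open>Y\<close> at \<open>p\<close>.\<close>

lemma dir_deriv_one_form:
  fixes A :: "('m::topological_space, 'e::euclidean_space) chart set"
  assumes A: "smooth_atlas A" and V: "open V" "p \<in> V" and \<theta>: "one_form A V \<theta>" and Y: "smooth_vf A V Y"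
  defines "c \<equiv> chart_at A p"
  shows "dir_deriv A u (\<lambda>q. \<theta> q (Y q)) p =
    \<theta> p (frechet_derivative (vf_in_chart A c Y) (at (snd c p)) u) +
    (\<Sum>b\<in>Basis. (Y p \<bullet> b) * dir_deriv A u (\<lambda>q. \<theta> q (coord_field A c b q)) p)"
proof -
  have c: "c \<in> A" "p \<in> fst c" using chart_at[OF A] by (auto simp: c_def)
  define S where "S = snd c ` (fst c \<inter> V)"
  define a where "a b = (\<lambda>q. \<theta> q (coord_field A c b q)) \<circ> chart_inv c" for b
  have S: "open S" "snd c p \<in> S"
    using open_chart_image[OF A c(1) V(1)] c V by (auto simp: S_def)
  have lin: "linear (\<theta> q)" if "q \<in> V" for q
    using \<theta> that by (simp add: one_form_def)
  have "smooth_fun A (fst c \<inter> V) (\<lambda>q. \<theta> q (coord_field A c b q))" for b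
    using V(1) chart_open[OF A c(1)]
    by (intro one_form_smooth[OF \<theta>] smooth_vf_mono[OF smooth_vf_coord_field[OF A c(1)]]) auto
  then have "smooth_on S (a b)" for b
    using c(1) Int_left_absorb[of "fst c" V] unfolding smooth_fun_def S_def a_def by metis
  then have a: "(a b has_derivative frechet_derivative (a b) (at (snd c p))) (at (snd c p))" for b
    using S(2) by (rule smooth_on_has_derivative)
  note Y' = smooth_vf_has_derivative[OF Y c V(2)]
  have eq: "(\<Sum>b\<in>Basis. (vf_in_chart A c Y x \<bullet> b) * a b x) = \<theta> (chart_inv c x) (Y (chart_inv c x))"
    if "x \<in> S" for x
  proof -
    obtain q where q: "q \<in> fst c" "q \<in> V" "x = snd c q" using \<open>x \<in> S\<close> by (auto simp: S_def)
    have l: "linear (\<lambda>w. \<theta> q (trans_deriv c (chart_at A q) q w))"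
      using linear_compose[OF linear_trans_deriv[OF A c(1) chart_at(1)[OF A] q(1) chart_at(2)[OF A]] lin[OF q(2)]]
      by (simp add: comp_def)
    show ?thesis
      using linear_euclidean_sum[OF l, of "vf_in_chart A c Y x"] q A c chart_at[OF A]
      by (simp add: a_def coord_field_def vf_in_chart_chart trans_deriv_trans trans_deriv_self)
  qed
  have D: "((\<lambda>x. \<Sum>b\<in>Basis. (vf_in_chart A c Y x \<bullet> b) * a b x) has_derivative
     (\<lambda>u. \<Sum>b\<in>Basis. (vf_in_chart A c Y (snd c p) \<bullet> b) * frechet_derivative (a b) (at (snd c p)) u +
        (frechet_derivative (vf_in_chart A c Y) (at (snd c p)) u \<bullet> b) * a b (snd c p))) (at (snd c p))"
    by (intro has_derivative_sum has_derivative_mult has_derivative_inner_left Y' a)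
  have "((\<lambda>q. \<theta> q (Y q)) \<circ> chart_inv c has_derivative
     (\<lambda>u. \<Sum>b\<in>Basis. (vf_in_chart A c Y (snd c p) \<bullet> b) * frechet_derivative (a b) (at (snd c p)) u +
        (frechet_derivative (vf_in_chart A c Y) (at (snd c p)) u \<bullet> b) * a b (snd c p))) (at (snd c p))"
    by (rule has_derivative_transform_within_open[OF D S]) (simp add: eq)
  then have "frechet_derivative ((\<lambda>q. \<theta> q (Y q)) \<circ> chart_inv c) (at (snd c p)) =
     (\<lambda>u. \<Sum>b\<in>Basis. (vf_in_chart A c Y (snd c p) \<bullet> b) * frechet_derivative (a b) (at (snd c p)) u +
        (frechet_derivative (vf_in_chart A c Y) (at (snd c p)) u \<bullet> b) * a b (snd c p))"
    by (rule frechet_derivative_at[symmetric])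
  moreover have "vf_in_chart A c Y (snd c p) = Y p"
    using A c by (simp add: vf_in_chart_chart c_def[symmetric] trans_deriv_self)
  moreover have "a b (snd c p) = \<theta> p b" for b
    using A c by (simp add: a_def coord_field_def c_def[symmetric] trans_deriv_self)
  ultimately show ?thesis
    by (simp add: dir_deriv_def c_def[symmetric] Let_def sum.distrib a_def[symmetric]
        linear_euclidean_sum[OF lin[OF V(2)]])
qed

text \<open>The derivatives of \<open>X\<close> and \<open>Y\<close> cancel against the bracket.
  What is left depends only on \<open>X p\<close> and \<open>Y p\<close>, and this is the
  tensoriality on which the definition of \<open>ext_d\<close> relies.\<close>

lemma d_fields_eq:
  assumes A: "smooth_atlas A" and V: "open V" "p \<in> V" and \<theta>: "one_form A V \<theta>"
    and X: "smooth_vf A V X" and Y: "smooth_vf A V Y"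
  defines "c \<equiv> chart_at A p"
  shows "d_fields A \<theta> X Y p =
    (\<Sum>b\<in>Basis. (Y p \<bullet> b) * dir_deriv A (X p) (\<lambda>q. \<theta> q (coord_field A c b q)) p) -
    (\<Sum>b\<in>Basis. (X p \<bullet> b) * dir_deriv A (Y p) (\<lambda>q. \<theta> q (coord_field A c b q)) p)"
proof -
  have "linear (\<theta> p)" using \<theta> V by (simp add: one_form_def)
  then have lin: "\<theta> p (x - y) = \<theta> p x - \<theta> p y" for x y by (rule linear_diff)
  show ?thesis
    unfolding d_fields_def lie_bracket_def Let_def lin c_def
    using dir_deriv_one_form[OF A V \<theta> X, of "Y p"] dir_deriv_one_form[OF A V \<theta> Y, of "X p"]
    by linarith
qed

lemma one_form_mono:
  assumes "one_form A V \<theta>" "W \<subseteq> V"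
  shows "one_form A W \<theta>"
  unfolding one_form_def
proof (intro conjI ballI allI impI)
  show "linear (\<theta> p)" if "p \<in> W" for p
    using assms that by (auto simp: one_form_def)
  show "smooth_fun A U (\<lambda>p. \<theta> p (X p))" if "open U \<and> U \<subseteq> W \<and> smooth_vf A U X" for U X
    using that assms(2) by (intro one_form_smooth[OF assms(1)]) auto
qed

lemma ext_d_eq_d_fields:
  assumes A: "smooth_atlas A" and V: "open V" "p \<in> V" and \<theta>: "one_form A V \<theta>"
    and X: "smooth_vf A V X" and Y: "smooth_vf A V Y"
  shows "ext_d A \<theta> p (X p) (Y p) = d_fields A \<theta> X Y p"
proof -
  let ?c = "chart_at A p"
  note c = chart_at[OF A, of p]
  have W: "open (fst ?c \<inter> V)" "p \<in> fst ?c \<inter> V"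
    using V c chart_open[OF A c(1)] by auto
  have s: "smooth_vf A (fst ?c \<inter> V) (coord_field A ?c w)" for w
    by (rule smooth_vf_mono[OF smooth_vf_coord_field[OF A c(1)]]) auto
  have co: "coord_field A ?c w p = w" for w
    using c A by (simp add: coord_field_def trans_deriv_self)
  have "one_form A (fst ?c \<inter> V) \<theta>"
    by (rule one_form_mono[OF \<theta>]) auto
  from d_fields_eq[OF A W this s s] d_fields_eq[OF A V \<theta> X Y]
  show ?thesis unfolding ext_d_def by (simp add: co)
qed

text \<open>The two derivative terms in the formula for d\<theta> differentiate functions that
  vanish near \<open>p\<close>, so only the bracket term survives.\<close>

lemma ext_d_sections:
  assumes A: "smooth_atlas A" and V: "open V" "p \<in> V" and \<theta>: "one_form A V \<theta>"
    and X: "smooth_vf A V X" and Y: "smooth_vf A V Y"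
    and "\<And>q. q \<in> V \<Longrightarrow> \<theta> q (X q) = 0" "\<And>q. q \<in> V \<Longrightarrow> \<theta> q (Y q) = 0"
  shows "ext_d A \<theta> p (X p) (Y p) = - \<theta> p (lie_bracket A X Y p)"
proof -
  have "dir_deriv A u f p = 0" if f: "\<And>q. q \<in> V \<Longrightarrow> f q = 0" for u f
  proof -
    let ?c = "chart_at A p"
    note c = chart_at[OF A, of p]
    have "frechet_derivative (f \<circ> chart_inv ?c) (at (snd ?c p)) = frechet_derivative (\<lambda>x. 0) (at (snd ?c p))"
      by (rule frechet_derivative_cong_open[OF open_chart_image[OF A c(1) V(1)]]) (use c V f A in auto)
    then show ?thesis by (simp add: dir_deriv_def Let_def)
  qed
  then show ?thesis
    unfolding ext_d_eq_d_fields[OF A V \<theta> X Y] d_fields_def using assms(7,8) by simp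
qed

section \<open>Indices, linear functionals and local sections\<close>

lemma index_add_3 [simp]: "a + 1 + 1 = a + (2::3)" "a + 1 + 2 = (a::3)" "a + 2 + 1 = (a::3)" "a + 2 + 2 = a + (1::3)"
  using exhaust_3[of a] by auto

lemma index_neq_3 [simp]: "a + 1 \<noteq> (a::3)" "a + 2 \<noteq> (a::3)" "a + 1 \<noteq> a + (2::3)" 
  using exhaust_3[of a] by auto

lemma index_cases_3: "b = a \<or> b = a + 1 \<or> b = a + (2::3)"
  using exhaust_3[of a] exhaust_3[of b] by auto

lemma sum_UNIV_3: "(\<Sum>b\<in>UNIV. f b) = f a + f (a + 1) + f (a + (2::3))"
proof -
  have "UNIV = {a, a + 1, a + 2}" using index_cases_3[of _ a] by auto
  then have "sum f UNIV = sum f {a, a + 1, a + 2}" by (rule arg_cong)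
  moreover have "a \<noteq> a + 1" "a \<noteq> a + 2" by (metis index_neq_3)+
  ultimately show ?thesis by (simp add: add.assoc)
qed

lemma span_image_finite:
  fixes v :: "'i \<Rightarrow> 'e::real_vector"
  assumes "finite I" "x \<in> span (v ` I)"
  shows "\<exists>u. x = (\<Sum>i\<in>I. u i *\<^sub>R v i)"
  using assms
proof (induction I arbitrary: x)
  case empty
  then show ?case by simp
next
  case (insert i I x)
  then obtain k where "x - k *\<^sub>R v i \<in> span (v ` I)"
    by (auto simp: span_breakdown_eq)
  then obtain u where u: "x - k *\<^sub>R v i = (\<Sum>j\<in>I. u j *\<^sub>R v j)"
    using insert.IH by blast
  have "(\<Sum>j\<in>I. (u(i := k)) j *\<^sub>R v j) = (\<Sum>j\<in>I. u j *\<^sub>R v j)"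
    by (rule sum.cong) (use insert.hyps in auto)
  then have "x = (\<Sum>j\<in>insert i I. (u(i := k)) j *\<^sub>R v j)"
    using insert.hyps u by (simp add: algebra_simps)
  then show ?case by (intro exI[of _ "u(i := k)"])
qed

text \<open>Duality through the inner product. The common kernel of the \<open>f i\<close> is the
  orthogonal complement of their representatives \<open>w (f i)\<close>, and \<open>g\<close> kills
  it; so \<open>w g\<close> lies in the double complement, which is their span.\<close>

lemma functional_combination:
  fixes f :: "'i::finite \<Rightarrow> 'e::euclidean_space \<Rightarrow> real"
  assumes f: "\<And>i. linear (f i)" and g: "linear g" and ker: "\<And>x. (\<And>i. f i x = 0) \<Longrightarrow> g x = 0"
  shows "\<exists>c. \<forall>x. g x = (\<Sum>i\<in>UNIV. c i * f i x)"
proof -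
  define w where "w h = (\<Sum>b\<in>Basis. h b *\<^sub>R b)" for h :: "'e \<Rightarrow> real"
  have w: "w h \<bullet> x = h x" if "linear h" for h x
    unfolding w_def inner_sum_left inner_scaleR_left linear_euclidean_sum[OF that, of x, symmetric]
    by (rule sum.cong) (simp_all add: inner_commute mult.commute)
  have "w g \<in> orthogonal_comp (orthogonal_comp (span (range (\<lambda>i. w (f i)))))"
  proof -
    have "w g \<bullet> x = 0" if "x \<in> orthogonal_comp (span (range (\<lambda>i. w (f i))))" for x
    proof -
      have "f i x = 0" for i
        using that w[OF f, of i x] span_base[of "w (f i)" "range (\<lambda>i. w (f i))"]
        by (simp add: orthogonal_comp_def orthogonal_def)
      then show ?thesis using ker w[OF g] by simp
    qed
    then show ?thesis by (auto simp: orthogonal_comp_def orthogonal_def inner_commute)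
  qed
  then have "w g \<in> span (range (\<lambda>i. w (f i)))"
    by (simp add: orthogonal_comp_self)
  then have "\<exists>c. w g = (\<Sum>i\<in>UNIV. c i *\<^sub>R w (f i))"
    by (rule span_image_finite[OF finite])
  then obtain c where "w g = (\<Sum>i\<in>UNIV. c i *\<^sub>R w (f i))" ..
  then have "g x = (\<Sum>i\<in>UNIV. c i * f i x)" for x
    using w[OF g, of x] by (simp add: inner_sum_left w[OF f])
  then show ?thesis by blast
qed

lemma functional_multiple:
  fixes f g :: "'e::euclidean_space \<Rightarrow> real"
  assumes "linear f" "linear g" "\<And>x. f x = 0 \<Longrightarrow> g x = 0"
  shows "\<exists>k. \<forall>x. g x = k * f x"
proof -
  have "\<exists>c. \<forall>x. g x = (\<Sum>i\<in>(UNIV::unit set). c i * f x)"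
    by (rule functional_combination) (use assms in auto)
  then show ?thesis by (auto simp: UNIV_unit)
qed

lemma sectionsI: "smooth_vf A V X \<Longrightarrow> (\<And>p. p \<in> V \<Longrightarrow> X p \<in> Q p) \<Longrightarrow> X \<in> sections A V Q"
  by (simp add: sections_def)

text \<open>Extend with constant coefficients in a local frame around \<open>p\<close>.\<close>

lemma subbundle_section_extension:
  assumes A: "smooth_atlas A" and Q: "subbundle A U k Q" and "k \<noteq> 0" "open V" "p \<in> V" "V \<subseteq> U" "x \<in> Q p"
  obtains W X where "open W" "p \<in> W" "W \<subseteq> V" "X \<in> sections A W Q" "X p = x"
proof -
  obtain W E where W: "open W" "p \<in> W" "\<And>i. i < k \<Longrightarrow> smooth_vf A W (E i)"
      "\<And>q. q \<in> W \<Longrightarrow> Q q = span ((\<lambda>i. E i q) ` {..<k})"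
  proof -
    have "p \<in> U" using assms(5,6) by auto
    with Q have "\<exists>V E. open V \<and> p \<in> V \<and> V \<subseteq> U \<and> (\<forall>i<k. smooth_vf A V (E i)) \<and>
        (\<forall>q\<in>V. Q q = span ((\<lambda>i. E i q) ` {..<k}))"
      by (simp add: subbundle_def)
    then obtain W E where "open W" "p \<in> W" "\<forall>i<k. smooth_vf A W (E i)"
      "\<forall>q\<in>W. Q q = span ((\<lambda>i. E i q) ` {..<k})" by (elim exE conjE)
    then show thesis by (intro that[of W E]) simp_all
  qed
  have "x \<in> span ((\<lambda>i. E i p) ` {..<k})" using W(2,4) assms(7) by simp
  then have "\<exists>r. x = (\<Sum>i<k. r i *\<^sub>R E i p)"
    by (rule span_image_finite[OF finite_lessThan])
  then obtain r where r: "x = (\<Sum>i<k. r i *\<^sub>R E i p)" ..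
  have o: "open (W \<inter> V)" using W(1) assms(4) by auto
  have "smooth_vf A (W \<inter> V) (\<lambda>q. \<Sum>i<k. r i *\<^sub>R E i q)"
    using \<open>k \<noteq> 0\<close> by (intro smooth_vf_sum[OF A o] smooth_vf_mono[OF W(3)]) auto
  moreover have "(\<Sum>i<k. r i *\<^sub>R E i q) \<in> Q q" if "q \<in> W \<inter> V" for q
  proof -
    have "(\<Sum>i<k. r i *\<^sub>R E i q) \<in> span ((\<lambda>i. E i q) ` {..<k})"
      by (intro span_sum span_scale span_base) auto
    then show ?thesis using that W(4) by simp
  qed
  ultimately show ?thesis
    using that[OF o, of "\<lambda>q. \<Sum>i<k. r i *\<^sub>R E i q"] W(2) assms(5) r by (auto intro: sectionsI)
qed

section \<open>Quaternionic algebra on the core bundle\<close>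

text \<open>Simplifying indices such as 3 + 1 and 3 + 2 produces these numerals.\<close>

lemma numeral_mod_3: "(4::3) = 1" "(5::3) = 2"
  by simp_all

lemma I_combination_axis [simp]: "I_combination J (axis a 1) p x = J a p x"
  by (simp add: I_combination_def axis_def if_distrib[of "\<lambda>t. t *\<^sub>R _"] cong: if_cong)

text \<open>For \<open>\<gamma>\<close> in the conformal class this amounts to \<open>Levi\<^sub>\<theta> = \<gamma>\<close>.\<close>

definition normalized where
  "normalized A Q H \<gamma> V \<theta> \<longleftrightarrow> compatible A V H \<theta> \<and>
     (\<forall>p\<in>V. \<forall>a. \<forall>x\<in>Q p. \<forall>y\<in>Q p. ext_d A (\<theta> a) p x y = \<gamma> p (hcr_I H a p x) y)"

lemma normalized_ext_d:
  "normalized A Q H \<gamma> V \<theta> \<Longrightarrow> p \<in> V \<Longrightarrow> x \<in> Q p \<Longrightarrow> y \<in> Q p \<Longrightarrow>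
    ext_d A (\<theta> a) p x y = \<gamma> p (hcr_I H a p x) y"
  by (simp add: normalized_def)

text \<open>Collects what concerns a single member \<open>H\<close> of the quaternionic CR
  structure. Two members are compared in \<open>normalized_rotated\<close>, by interpreting the
  locale a second time.\<close>

locale qc_hyper_CR =
  fixes A :: "('m::t2_space, 'e::euclidean_space) chart set"
    and Q :: "'m \<Rightarrow> 'e set" and \<I> :: "'m \<Rightarrow> ('e \<Rightarrow> 'e) set" and C :: "('m \<Rightarrow> 'e \<Rightarrow> 'e \<Rightarrow> real) set"
    and H :: "('m, 'e) hcr"
  assumes atlas: "smooth_atlas A"
    and qc: "qc_structure A Q \<I> C"
    and hyper_CR: "hyper_CR A H"
    and underlying: "\<And>p. p \<in> hcr_dom H \<Longrightarrow> Q p = hcr_core H p \<and> \<I> p = I_sphere (hcr_core H) (hcr_I H) p"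
begin

lemma open_dom: "open (hcr_dom H)"
  using hyper_CR by (simp add: hyper_CR_def almost_hyper_CR_def)

lemma almost_CR: "almost_CR A (hcr_dom H) (hcr_Q H a) (hcr_I H a)"
  using hyper_CR unfolding hyper_CR_def almost_hyper_CR_def by blast

lemma complex_structure: "complex_structure A (hcr_dom H) (hcr_Q H a) (hcr_I H a)"
  using almost_CR unfolding almost_CR_def by blast

lemma hcr_Q:
  assumes "p \<in> hcr_dom H"
  shows "subspace (hcr_Q H a p)" "dim (hcr_Q H a p) + 1 = DIM('e)"
  using almost_CR[of a] assms unfolding almost_CR_def corank_subbundle_def subbundle_def by auto

lemma core:
  obtains k where "k + 3 = DIM('e)" "subbundle A UNIV k Q"
  using qc[unfolded qc_structure_def, THEN conjunct1] unfolding corank_subbundle_def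
  by (elim exE conjE)

lemma subspace_core: "subspace (Q p)"
  by (rule core) (simp add: subbundle_def)

lemma dim_core: "dim (Q p) + 3 = DIM('e)"
  by (rule core) (simp add: subbundle_def)

lemma frame:
  fixes p
  obtains V Is \<gamma> \<eta> where "open V" "p \<in> V" "quaternionic_frame A V Q \<I> Is" "\<gamma> \<in> C"
    "\<forall>a::3. one_form A V (\<eta> a)"
    "\<forall>q\<in>V. Q q = {x. \<forall>a. \<eta> a q x = 0} \<and>
       (\<forall>a. \<forall>x\<in>Q q. \<forall>y\<in>Q q. \<gamma> q (Is a q x) y = ext_d A (\<eta> a) q x y)"
  using qc[unfolded qc_structure_def, THEN conjunct2, THEN conjunct2, THEN conjunct2, THEN conjunct2,
      THEN spec, of p] by (elim exE conjE)

lemma core_sub: "p \<in> hcr_dom H \<Longrightarrow> x \<in> Q p \<Longrightarrow> x \<in> hcr_Q H a p"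
  using underlying by (simp add: hcr_core_def)

lemma hcr_I_hcr_Q: "p \<in> hcr_dom H \<Longrightarrow> x \<in> hcr_Q H a p \<Longrightarrow> hcr_I H a p x \<in> hcr_Q H a p"
  using complex_structure[of a] unfolding complex_structure_def by blast

lemma hcr_I_square: "p \<in> hcr_dom H \<Longrightarrow> x \<in> hcr_Q H a p \<Longrightarrow> hcr_I H a p (hcr_I H a p x) = - x"
  using complex_structure[of a] unfolding complex_structure_def by blast

lemma hcr_I_add:
  "p \<in> hcr_dom H \<Longrightarrow> x \<in> hcr_Q H a p \<Longrightarrow> y \<in> hcr_Q H a p \<Longrightarrow>
    hcr_I H a p (x + y) = hcr_I H a p x + hcr_I H a p y"
  using complex_structure[of a] unfolding complex_structure_def linear_within_def by blast

lemma hcr_I_scale: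
  "p \<in> hcr_dom H \<Longrightarrow> x \<in> hcr_Q H a p \<Longrightarrow> hcr_I H a p (r *\<^sub>R x) = r *\<^sub>R hcr_I H a p x"
  using complex_structure[of a] unfolding complex_structure_def linear_within_def by blast

lemma hcr_I_minus: "p \<in> hcr_dom H \<Longrightarrow> x \<in> hcr_Q H a p \<Longrightarrow> hcr_I H a p (- x) = - hcr_I H a p x"
  using hcr_I_scale[of p x a "-1"] by simp

text \<open>Both frames parametrize the same sphere of complex structures. A coordinate unit vector
  picks one structure of the first frame, which is therefore the point \<open>w\<close> of the other
  parametrization, with the same \<open>w\<close> for all \<open>x\<close>.\<close>

lemma I_sphere_exchange:
  assumes p: "p \<in> hcr_dom H" "p \<in> V" and fr: "quaternionic_frame A V Q \<I> Is"
  shows "\<exists>w. \<forall>x\<in>Q p. hcr_I H a p x = (\<Sum>b\<in>UNIV. w $ b *\<^sub>R Is b p x)"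
    "\<exists>w. \<forall>x\<in>Q p. Is a p x = (\<Sum>b\<in>UNIV. w $ b *\<^sub>R hcr_I H b p x)"
proof -
  have eq: "I_sphere Q (hcr_I H) p = I_sphere Q Is p"
  proof -
    have "I_sphere Q (hcr_I H) p = \<I> p"
      using underlying[OF p(1)] by (simp add: I_sphere_def)
    also have "\<dots> = I_sphere Q Is p"
      using p(2) fr by (simp add: quaternionic_frame_def)
    finally show ?thesis .
  qed
  have *: "\<exists>w. \<forall>x\<in>Q p. J a p x = (\<Sum>b\<in>UNIV. w $ b *\<^sub>R J' b p x)"
    if "I_sphere Q J p = I_sphere Q J' p" for J J' :: "3 \<Rightarrow> 'm \<Rightarrow> 'e \<Rightarrow> 'e"
  proof -
    have "restrict (I_combination J (axis a 1) p) (Q p) \<in> I_sphere Q J' p"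
      unfolding that[symmetric] by (simp add: I_sphere_def norm_axis_1)
    then obtain w where w: "restrict (I_combination J (axis a 1) p) (Q p) = restrict (I_combination J' w p) (Q p)"
      unfolding I_sphere_def by blast
    have "J a p x = (\<Sum>b\<in>UNIV. w $ b *\<^sub>R J' b p x)" if "x \<in> Q p" for x
      using fun_cong[OF w, of x] that by (simp add: I_combination_def[of J'])
    then show ?thesis by blast
  qed
  show "\<exists>w. \<forall>x\<in>Q p. hcr_I H a p x = (\<Sum>b\<in>UNIV. w $ b *\<^sub>R Is b p x)"
    by (rule *[OF eq])
  show "\<exists>w. \<forall>x\<in>Q p. Is a p x = (\<Sum>b\<in>UNIV. w $ b *\<^sub>R hcr_I H b p x)"
    by (rule *[OF eq[symmetric]])
qed

lemma frame_core:
  "quaternionic_frame A V Q \<I> Is \<Longrightarrow> p \<in> V \<Longrightarrow> x \<in> Q p \<Longrightarrow> Is a p x \<in> Q p \<and> Is a p (Is a p x) = - x"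
  unfolding quaternionic_frame_def complex_structure_def by blast

text \<open>\<open>almost_CR\<close> only says that I_a preserves Q_a. That it preserves the smaller
  bundle comes from the contact side: I_a is a combination of the \<open>Is b\<close>, which are
  complex structures of \<open>Q\<close>.\<close>

lemma hcr_I_core:
  assumes "p \<in> hcr_dom H" "x \<in> Q p"
  shows "hcr_I H a p x \<in> Q p"
proof -
  obtain V Is \<gamma> \<eta> where V: "p \<in> V" "quaternionic_frame A V Q \<I> Is"
    using frame[of p] by metis
  obtain w where "hcr_I H a p x = (\<Sum>b\<in>UNIV. w $ b *\<^sub>R Is b p x)"
    using I_sphere_exchange(1)[OF assms(1) V] assms(2) by blast
  then show ?thesis
    using frame_core[OF V(2,1) assms(2)] subspace_core
    by (auto intro!: subspace_sum subspace_scale)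
qed

lemma core_square: "p \<in> hcr_dom H \<Longrightarrow> x \<in> Q p \<Longrightarrow> hcr_I H a p (hcr_I H a p x) = - x"
  by (simp add: hcr_I_square core_sub)

lemma core_minus: "p \<in> hcr_dom H \<Longrightarrow> x \<in> Q p \<Longrightarrow> hcr_I H a p (- x) = - hcr_I H a p x"
  by (simp add: hcr_I_minus core_sub)

text \<open>The definition gives two relations, on the images of Q_1 \<inter> Q_2 under I_1 and I_2.
  A vector y of \<open>Q\<close> lies in both images, being I_b(- I_b y), and the other four
  products follow because the I_b square to -1.\<close>

lemma quaternion:
  assumes p: "p \<in> hcr_dom H" and x: "x \<in> Q p"
  shows "hcr_I H a p (hcr_I H (a + 1) p x) = hcr_I H (a + 2) p x"
    "hcr_I H (a + 1) p (hcr_I H a p x) = - hcr_I H (a + 2) p x"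
proof -
  define D where "D = hcr_Q H 1 p \<inter> hcr_Q H 2 p"
  have alm: "(\<forall>x \<in> hcr_I H 1 p ` D. hcr_I H 3 p x = - hcr_I H 2 p (hcr_I H 1 p x)) \<and>
        (\<forall>x \<in> hcr_I H 2 p ` D. hcr_I H 3 p x = hcr_I H 1 p (hcr_I H 2 p x))"
    using hyper_CR p unfolding hyper_CR_def almost_hyper_CR_def Let_def D_def by blast
  have im: "y \<in> hcr_I H b p ` D" if "y \<in> Q p" for y b
  proof (rule image_eqI)
    show "y = hcr_I H b p (- hcr_I H b p y)"
      using that p by (simp add: core_minus core_square hcr_I_core)
    show "- hcr_I H b p y \<in> D"
      using core_sub[OF p subspace_neg[OF subspace_core hcr_I_core[OF p that]]] by (simp add: D_def)
  qed
  have 12: "hcr_I H 1 p (hcr_I H 2 p y) = hcr_I H 3 p y"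
    and 21: "hcr_I H 2 p (hcr_I H 1 p y) = - hcr_I H 3 p y" if "y \<in> Q p" for y
    using bspec[OF conjunct1[OF alm] im[OF that]] bspec[OF conjunct2[OF alm] im[OF that]] by simp_all
  note J = hcr_I_core[OF p] core_square[OF p] core_minus[OF p]
  have 23: "hcr_I H 2 p (hcr_I H 3 p x) = hcr_I H 1 p x"
    using 21[OF x] J x by (metis minus_minus)
  have 32: "hcr_I H 3 p (hcr_I H 2 p x) = - hcr_I H 1 p x"
    using 12[OF J(1)[OF x, of 2]] J x by metis
  have 31: "hcr_I H 3 p (hcr_I H 1 p x) = hcr_I H 2 p x"
    using 21[OF J(1)[OF x, of 1]] J x by (metis minus_minus)
  have 13: "hcr_I H 1 p (hcr_I H 3 p x) = - hcr_I H 2 p x"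
    using 12[OF x] J x by metis
  show "hcr_I H a p (hcr_I H (a + 1) p x) = hcr_I H (a + 2) p x"
    "hcr_I H (a + 1) p (hcr_I H a p x) = - hcr_I H (a + 2) p x"
    using exhaust_3[of a] 12[OF x] 21[OF x] 23 32 31 13
    by (auto simp: numeral_mod_3)
qed

lemma anticommute:
  assumes p: "p \<in> hcr_dom H" and x: "x \<in> Q p" and "a \<noteq> b"
  shows "hcr_I H a p (hcr_I H b p x) = - hcr_I H b p (hcr_I H a p x)"
proof -
  consider "b = a + 1" | "a = b + 1"
    using index_cases_3[of b a] assms(3) by force
  then show ?thesis by cases (simp_all add: quaternion[OF p x])
qed

lemma conformal:
  assumes "\<gamma> \<in> C" "\<gamma>' \<in> C"
  obtains r where "smooth_fun A UNIV r" "\<And>p. r p > 0"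
    "\<And>p x y. x \<in> Q p \<Longrightarrow> y \<in> Q p \<Longrightarrow> \<gamma>' p x y = r p * \<gamma> p x y"
proof -
  obtain g where C: "C = {g'. bundle_metric A Q g' \<and>
                   (\<exists>f. smooth_fun A UNIV f \<and> (\<forall>p. f p > 0) \<and>
                        (\<forall>p. \<forall>x\<in>Q p. \<forall>y\<in>Q p. g' p x y = f p * g p x y))}"
    using qc unfolding qc_structure_def conformal_class_def by blast
  obtain f where f: "smooth_fun A UNIV f" "\<And>p. f p > 0"
      "\<And>p x y. x \<in> Q p \<Longrightarrow> y \<in> Q p \<Longrightarrow> \<gamma> p x y = f p * g p x y"
    using assms(1) C by blast
  obtain f' where f': "smooth_fun A UNIV f'" "\<And>p. f' p > 0"
      "\<And>p x y. x \<in> Q p \<Longrightarrow> y \<in> Q p \<Longrightarrow> \<gamma>' p x y = f' p * g p x y"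
    using assms(2) C by blast
  have nz: "f p \<noteq> 0" for p using f(2)[of p] by simp
  show ?thesis
  proof (rule that[of "\<lambda>p. f' p * inverse (f p)"])
    show "smooth_fun A UNIV (\<lambda>p. f' p * inverse (f p))"
      using nz by (intro smooth_fun_mult smooth_fun_inverse atlas f'(1) f(1)) auto
  qed (use f f' nz in auto)
qed

section \<open>Compatibility of the contact metric with the complex structures of
  \<open>H\<close>\<close>

context
  fixes \<gamma> assumes \<gamma>: "\<gamma> \<in> C"
begin

lemma metric: "bundle_metric A Q \<gamma>"
  using qc \<gamma> unfolding qc_structure_def conformal_class_def by blast

lemma metric_add: "x \<in> Q p \<Longrightarrow> y \<in> Q p \<Longrightarrow> z \<in> Q p \<Longrightarrow> \<gamma> p z (x + y) = \<gamma> p z x + \<gamma> p z y"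
  using metric unfolding bundle_metric_def linear_within_def by blast

lemma metric_scale: "x \<in> Q p \<Longrightarrow> z \<in> Q p \<Longrightarrow> \<gamma> p z (r *\<^sub>R x) = r * \<gamma> p z x"
  using metric unfolding bundle_metric_def linear_within_def by auto

lemma metric_sym: "x \<in> Q p \<Longrightarrow> y \<in> Q p \<Longrightarrow> \<gamma> p x y = \<gamma> p y x"
  using metric unfolding bundle_metric_def by blast

lemma metric_pos: "x \<in> Q p \<Longrightarrow> x \<noteq> 0 \<Longrightarrow> \<gamma> p x x > 0"
  using metric unfolding bundle_metric_def by blast

lemma metric_sum_left:
  assumes "\<And>i. i \<in> I \<Longrightarrow> x i \<in> Q p" "z \<in> Q p"
  shows "\<gamma> p (\<Sum>i\<in>I. r i *\<^sub>R x i) z = (\<Sum>i\<in>I. r i * \<gamma> p (x i) z)"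
proof -
  note sub = subspace_core[of p]
  have z: "\<gamma> p z 0 = 0" using metric_scale[OF assms(2,2), of 0] by simp
  have "\<gamma> p z (\<Sum>i\<in>I. r i *\<^sub>R x i) = (\<Sum>i\<in>I. r i * \<gamma> p z (x i))"
    using assms(1)
  proof (induction I rule: infinite_finite_induct)
    case (insert i I)
    then have "(\<Sum>i\<in>I. r i *\<^sub>R x i) \<in> Q p" "r i *\<^sub>R x i \<in> Q p"
      using sub by (auto intro!: subspace_sum subspace_scale)
    then show ?case using insert assms(2) by (simp add: metric_add metric_scale)
  qed (simp_all add: z)
  moreover have "(\<Sum>i\<in>I. r i *\<^sub>R x i) \<in> Q p"
    using sub assms(1) by (auto intro!: subspace_sum subspace_scale)
  ultimately show ?thesis using assms by (simp add: metric_sym[of _ p z] cong: sum.cong)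
qed

lemma metric_minus: "x \<in> Q p \<Longrightarrow> z \<in> Q p \<Longrightarrow> \<gamma> p z (- x) = - \<gamma> p z x"
  using metric_scale[of x p z "-1"] by simp

lemma metric_minus_left: "x \<in> Q p \<Longrightarrow> z \<in> Q p \<Longrightarrow> \<gamma> p (- x) z = - \<gamma> p x z"
  using metric_minus[of x p z] subspace_neg[OF subspace_core] by (simp add: metric_sym[of _ p z])

lemma metric_isometry:
  assumes p: "p \<in> hcr_dom H" and x: "x \<in> Q p" "y \<in> Q p"
  shows "\<gamma> p (hcr_I H a p x) (hcr_I H a p y) = \<gamma> p x y"
proof -
  have "restrict (I_combination (hcr_I H) (axis a 1) p) (Q p) \<in> \<I> p"
    using underlying[OF p] by (auto simp: I_sphere_def norm_axis_1)
  then have "\<gamma> p (restrict (I_combination (hcr_I H) (axis a 1) p) (Q p) x)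
      (restrict (I_combination (hcr_I H) (axis a 1) p) (Q p) y) = \<gamma> p x y"
    using qc \<gamma> x unfolding qc_structure_def by blast
  then show ?thesis
    using x by simp
qed

lemma metric_skew:
  assumes p: "p \<in> hcr_dom H" and x: "x \<in> Q p" "y \<in> Q p"
  shows "\<gamma> p (hcr_I H a p x) y = - \<gamma> p x (hcr_I H a p y)"
  using metric_isometry[OF p hcr_I_core[OF p x(1)] x(2), of a a] x p
  by (simp add: core_square metric_minus_left hcr_I_core)

text \<open>Skewness moves I_a to the other side and, after anticommuting, moves I_b back. The value
  thus equals the negative of the one with exchanged arguments, and \<gamma> is symmetric.\<close>

lemma metric_orthogonal:
  assumes p: "p \<in> hcr_dom H" and x: "x \<in> Q p" and "a \<noteq> b"
  shows "\<gamma> p (hcr_I H a p x) (hcr_I H b p x) = 0"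
proof -
  have J: "hcr_I H c p x \<in> Q p" for c using hcr_I_core[OF p x] .
  have "\<gamma> p (hcr_I H a p x) (hcr_I H b p x) = - \<gamma> p x (hcr_I H a p (hcr_I H b p x))"
    using metric_skew[OF p x J] .
  also have "\<dots> = \<gamma> p x (hcr_I H b p (hcr_I H a p x))"
    using metric_minus[OF hcr_I_core[OF p J] x] by (simp add: anticommute[OF p x assms(3)])
  also have "\<dots> = - \<gamma> p (hcr_I H b p x) (hcr_I H a p x)"
    using metric_skew[OF p x J] by simp
  finally show ?thesis using metric_sym[OF J J, of a b] by simp
qed

end

section \<open>Compatible forms are proportional to the contact metric\<close>

text \<open>On a zero bundle all combinations of a frame would restrict to the same map, against the
  injectivity in \<open>quaternionic_frame\<close>. Nonzero vectors of \<open>Q\<close> serve below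
  to test factors.\<close>

lemma core_nontrivial: "\<exists>x\<in>Q p. x \<noteq> 0"
proof (rule ccontr)
  assume "\<not> ?thesis"
  then have 0: "x = 0" if "x \<in> Q p" for x using that by blast
  obtain V and Is :: "3 \<Rightarrow> 'm \<Rightarrow> 'e \<Rightarrow> 'e" and \<gamma> :: "'m \<Rightarrow> 'e \<Rightarrow> 'e \<Rightarrow> real" and \<eta> :: "3 \<Rightarrow> 'm \<Rightarrow> 'e \<Rightarrow> real"
    where V: "p \<in> V" "quaternionic_frame A V Q \<I> Is"
    by (rule frame[of p])
  have inj: "inj_on (\<lambda>v. restrict (I_combination Is v p) (Q p)) (sphere 0 1)"
    using V unfolding quaternionic_frame_def by blast
  have "Is a p x = 0" if "x \<in> Q p" for a x
    using frame_core[OF V(2,1) that, of a] 0 by blast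
  then have "restrict (I_combination Is (axis 1 1) p) (Q p) = restrict (I_combination Is (axis 2 1) p) (Q p)"
    by (intro restrict_ext) simp
  then have "axis 1 1 = (axis 2 1 :: real^3)"
    by (rule inj_onD[OF inj]) (simp_all add: norm_axis_1)
  then show False by (simp add: axis_eq_axis)
qed

lemma core_sections:
  assumes "open V" "p \<in> V" "x \<in> Q p" "y \<in> Q p"
  obtains W X Y where "open W" "p \<in> W" "W \<subseteq> V" "X \<in> sections A W Q" "Y \<in> sections A W Q" "X p = x" "Y p = y"
proof -
  obtain k where k: "k + 3 = DIM('e)" "subbundle A UNIV k Q" by (rule core)
  \<comment> \<open>The section in \<open>subbundle_section_extension\<close> is a sum over a
    nonempty frame.\<close>
  have "k \<noteq> 0"
  proof
    assume "k = 0"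
    then have "dim (Q p) = 0" using k by (simp add: subbundle_def)
    then have "Q p \<subseteq> {0}" by simp
    then show False using core_nontrivial by blast
  qed
  note ext = subbundle_section_extension[OF atlas k(2) this assms(1,2) subset_UNIV]
  obtain W1 X where 1: "open W1" "p \<in> W1" "W1 \<subseteq> V" "X \<in> sections A W1 Q" "X p = x"
    by (rule ext[OF assms(3)])
  obtain W2 Y where 2: "open W2" "p \<in> W2" "W2 \<subseteq> V" "Y \<in> sections A W2 Q" "Y p = y"
    by (rule ext[OF assms(4)])
  have "X \<in> sections A (W1 \<inter> W2) Q" "Y \<in> sections A (W1 \<inter> W2) Q"
    using 1(4) 2(4) by (auto simp: sections_def intro: smooth_vf_mono)
  then show thesis
    using 1 2 by (intro that[of "W1 \<inter> W2" X Y]) auto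
qed

lemma ext_d_core:
  assumes \<phi>: "one_form A V \<phi>" "\<And>q x. q \<in> V \<Longrightarrow> x \<in> Q q \<Longrightarrow> \<phi> q x = 0"
    and W: "open W" "p \<in> W" "W \<subseteq> V" and X: "X \<in> sections A W Q" and Y: "Y \<in> sections A W Q"
  shows "ext_d A \<phi> p (X p) (Y p) = - \<phi> p (lie_bracket A X Y p)"
  by (rule ext_d_sections[OF atlas W(1,2) one_form_mono[OF \<phi>(1) W(3)]])
    (use X Y W(3) \<phi>(2) in \<open>auto simp: sections_def\<close>)

text \<open>On \<open>Q\<close> the exterior derivative of a form that vanishes on \<open>Q\<close> only depends on the value of
  the form at the point.\<close>

lemma ext_d_combination:
  fixes \<phi> :: "'i::finite \<Rightarrow> 'm \<Rightarrow> 'e \<Rightarrow> real"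
  assumes V: "open V" "p \<in> V" "open V'" "p \<in> V'"
    and \<phi>: "\<And>i. one_form A V (\<phi> i)" "\<And>i q x. q \<in> V \<Longrightarrow> x \<in> Q q \<Longrightarrow> \<phi> i q x = 0"
    and \<psi>: "one_form A V' \<psi>" "\<And>q x. q \<in> V' \<Longrightarrow> x \<in> Q q \<Longrightarrow> \<psi> q x = 0"
    and eq: "\<And>z. \<psi> p z = (\<Sum>i\<in>UNIV. c i * \<phi> i p z)" and x: "x \<in> Q p" "y \<in> Q p"
  shows "ext_d A \<psi> p x y = (\<Sum>i\<in>UNIV. c i * ext_d A (\<phi> i) p x y)"
proof -
  have "open (V \<inter> V')" "p \<in> V \<inter> V'" using V by auto
  then obtain W X Y where W: "open W" "p \<in> W" "W \<subseteq> V \<inter> V'" "X \<in> sections A W Q" "Y \<in> sections A W Q"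
      "X p = x" "Y p = y"
    using core_sections[OF _ _ x] by blast
  \<comment> \<open>All the forms are evaluated on one and the same bracket, to which the pointwise
    identity \<open>eq\<close> applies.\<close>
  have "ext_d A (\<phi> i) p x y = - \<phi> i p (lie_bracket A X Y p)" for i
    using ext_d_core[OF \<phi>(1)[of i] \<phi>(2) W(1,2) _ W(4,5)] W(3,6,7) by auto
  moreover have "ext_d A \<psi> p x y = - \<psi> p (lie_bracket A X Y p)"
    using ext_d_core[OF \<psi> W(1,2) _ W(4,5)] W(3,6,7) by auto
  ultimately show ?thesis by (simp add: eq sum_negf)
qed

lemma sections_hcr_I:
  assumes "open W" "W \<subseteq> hcr_dom H" "X \<in> sections A W Q"
  shows "(\<lambda>p. hcr_I H a p (X p)) \<in> sections A W Q"
proof -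
  have "X \<in> sections A W (hcr_Q H a)"
    using assms core_sub by (auto simp: sections_def)
  then have "(\<lambda>p. hcr_I H a p (X p)) \<in> sections A W (hcr_Q H a)"
    using complex_structure[of a] assms(1,2) unfolding complex_structure_def by simp
  then show ?thesis
    using assms hcr_I_core by (auto simp: sections_def)
qed

lemma integrable:
  fixes a
  assumes W: "open W" "W \<subseteq> hcr_dom H" and X: "X \<in> sections A W Q" and Y: "Y \<in> sections A W Q"
  defines "Z \<equiv> \<lambda>p. lie_bracket A X Y p - lie_bracket A (\<lambda>p. hcr_I H a p (X p)) (\<lambda>p. hcr_I H a p (Y p)) p"
  shows "Z \<in> sections A W (hcr_Q H a)"
    "(\<lambda>p. hcr_I H a p (Z p) - lie_bracket A X (\<lambda>p. hcr_I H a p (Y p)) p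
        - lie_bracket A (\<lambda>p. hcr_I H a p (X p)) Y p) \<in> sections A W Q"
proof -
  have eq: "sections A W (hcr_core H) = sections A W Q"
  proof -
    have "Q p = hcr_core H p" if "p \<in> W" for p using that W(2) underlying by blast
    then show ?thesis by (simp add: sections_def)
  qed
  have "open W \<and> W \<subseteq> hcr_dom H \<and> X \<in> sections A W (hcr_core H) \<and> Y \<in> sections A W (hcr_core H)"
    using assms eq by simp
  note * = hyper_CR[unfolded hyper_CR_def, THEN conjunct2, THEN spec, THEN spec, THEN spec, THEN spec,
    THEN mp, OF this, of a, unfolded Let_def]
  show "Z \<in> sections A W (hcr_Q H a)"
    unfolding Z_def by (rule conjunct1[OF *])
  show "(\<lambda>p. hcr_I H a p (Z p) - lie_bracket A X (\<lambda>p. hcr_I H a p (Y p)) p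
        - lie_bracket A (\<lambda>p. hcr_I H a p (X p)) Y p) \<in> sections A W Q"
    unfolding Z_def eq[symmetric] by (rule conjunct2[OF *])
qed

section \<open>Compatible forms and their differentials on \<open>Q\<close>\<close>

lemma compatible_iff:
  assumes "V \<subseteq> hcr_dom H" "compatible A V H \<theta>" "p \<in> V"
  shows "\<theta> a p x = 0 \<longleftrightarrow> x \<in> hcr_Q H a p"
  using assms unfolding compatible_def by blast

lemma compatible_core_iff:
  assumes "V \<subseteq> hcr_dom H" "compatible A V H \<theta>" "p \<in> V"
  shows "x \<in> Q p \<longleftrightarrow> (\<forall>a. \<theta> a p x = 0)"
proof -
  have "Q p = hcr_core H p" using underlying assms by blast
  then show ?thesis by (simp add: compatible_iff[OF assms] hcr_core_def)
qed

lemma compatible_core: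
  "V \<subseteq> hcr_dom H \<Longrightarrow> compatible A V H \<theta> \<Longrightarrow> p \<in> V \<Longrightarrow> x \<in> Q p \<Longrightarrow> \<theta> a p x = 0"
  by (simp add: compatible_core_iff)

lemma compatible_one_form: "compatible A V H \<theta> \<Longrightarrow> one_form A V (\<theta> a)"
  by (simp add: compatible_def)

lemma compatible_linear: "compatible A V H \<theta> \<Longrightarrow> p \<in> V \<Longrightarrow> linear (\<theta> a p)"
  by (simp add: compatible_def one_form_def)

lemma compatible_rotate:
  "compatible A V H \<theta> \<Longrightarrow> p \<in> V \<Longrightarrow> x \<in> hcr_Q H a p \<Longrightarrow> \<theta> (a + 2) p (hcr_I H a p x) = \<theta> (a + 1) p x"
  by (simp add: compatible_def)

context
  fixes V \<theta>
  assumes V: "open V" "V \<subseteq> hcr_dom H" and \<theta>: "compatible A V H \<theta>"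
begin

lemma ext_d_compatible:
  assumes "open W" "p \<in> W" "W \<subseteq> V" "X \<in> sections A W Q" "Y \<in> sections A W Q"
  shows "ext_d A (\<theta> a) p (X p) (Y p) = - \<theta> a p (lie_bracket A X Y p)"
  by (rule ext_d_core[OF compatible_one_form[OF \<theta>] compatible_core[OF V(2) \<theta>] assms])

text \<open>The two integrability conditions read through \<theta>: the first with
  \<open>\<theta> a\<close>, whose kernel is Q_a, the second with \<open>\<theta> (a + 2)\<close>,
  which takes I_a z to \<open>\<theta> (a + 1)\<close> of z for z in Q_a.\<close>

lemma ext_d_integrable:
  assumes p: "p \<in> V" and x: "x \<in> Q p" "y \<in> Q p"
  shows "ext_d A (\<theta> a) p (hcr_I H a p x) (hcr_I H a p y) = ext_d A (\<theta> a) p x y" (is ?one)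
    "ext_d A (\<theta> (a + 1)) p x y - ext_d A (\<theta> (a + 1)) p (hcr_I H a p x) (hcr_I H a p y) =
     ext_d A (\<theta> (a + 2)) p x (hcr_I H a p y) + ext_d A (\<theta> (a + 2)) p (hcr_I H a p x) y" (is ?two)
proof -
  obtain W X Y where W: "open W" "p \<in> W" "W \<subseteq> V" and X: "X \<in> sections A W Q" and Y: "Y \<in> sections A W Q"
      and xy: "X p = x" "Y p = y"
    by (rule core_sections[OF V(1) p x])
  have Wd: "W \<subseteq> hcr_dom H" using W V by blast
  define JX where "JX = (\<lambda>p. hcr_I H a p (X p))"
  define JY where "JY = (\<lambda>p. hcr_I H a p (Y p))"
  have JX: "JX \<in> sections A W Q" and JY: "JY \<in> sections A W Q"
    unfolding JX_def JY_def by (intro sections_hcr_I W(1) Wd X Y)+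
  have Jp: "hcr_I H a p (X p) = JX p" "hcr_I H a p (Y p) = JY p" by (simp_all add: JX_def JY_def)
  define z where "z = lie_bracket A X Y p - lie_bracket A JX JY p"
  have z: "z \<in> hcr_Q H a p"
    and Jz: "hcr_I H a p z - lie_bracket A X JY p - lie_bracket A JX Y p \<in> Q p"
    using integrable[OF W(1) Wd X Y, of a] W(2) by (simp_all add: sections_def JX_def JY_def z_def)
  note d = ext_d_compatible[OF W]
  note lin = linear_diff[OF compatible_linear[OF \<theta> p]]
  have "\<theta> a p z = 0" using z compatible_iff[OF V(2) \<theta> p] by simp
  then show ?one
    unfolding xy[symmetric] Jp d[OF X Y] d[OF JX JY] z_def lin by simp
  have "\<theta> (a + 2) p (hcr_I H a p z) - \<theta> (a + 2) p (lie_bracket A X JY p) - \<theta> (a + 2) p (lie_bracket A JX Y p) = 0"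
    using compatible_core[OF V(2) \<theta> p Jz, of "a + 2"] by (simp add: lin)
  moreover have "\<theta> (a + 2) p (hcr_I H a p z) = \<theta> (a + 1) p z"
    by (rule compatible_rotate[OF \<theta> p z])
  ultimately show ?two
    unfolding xy[symmetric] Jp d[OF X Y] d[OF JX JY] d[OF X JY] d[OF JX Y] z_def lin by simp
qed

text \<open>The first part passes from \<theta> to \<eta> and then from \<open>Is\<close> to the
  structures of \<open>H\<close>. The second part goes back: if all d\<theta>_a vanished on
  \<open>Q\<close> at \<open>p\<close>, so would d\<eta>_1, which has a positive value on
  \<open>x\<close> and \<open>Is 1 p x\<close>. It makes the common factor in
  \<open>ext_d_proportional\<close> nonzero.\<close>

lemma ext_d_quaternionic_combination:
  assumes p: "p \<in> V" and \<gamma>: "\<gamma> \<in> C"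
  shows "\<exists>N. \<forall>x\<in>Q p. \<forall>y\<in>Q p. ext_d A (\<theta> a) p x y = (\<Sum>b\<in>UNIV. N b * \<gamma> p (hcr_I H b p x) y)"
    and "(\<And>a x y. x \<in> Q p \<Longrightarrow> y \<in> Q p \<Longrightarrow> ext_d A (\<theta> a) p x y = 0) \<Longrightarrow> False"
proof -
  obtain V' and Is :: "3 \<Rightarrow> 'm \<Rightarrow> 'e \<Rightarrow> 'e" and \<gamma>0 and \<eta> :: "3 \<Rightarrow> 'm \<Rightarrow> 'e \<Rightarrow> real"
    where V': "open V'" "p \<in> V'" and fr: "quaternionic_frame A V' Q \<I> Is" and \<gamma>0: "\<gamma>0 \<in> C"
      and \<eta>': "\<forall>a. one_form A V' (\<eta> a)"
      and \<eta>'': "\<forall>q\<in>V'. Q q = {x. \<forall>a. \<eta> a q x = 0} \<and>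
       (\<forall>a. \<forall>x\<in>Q q. \<forall>y\<in>Q q. \<gamma>0 q (Is a q x) y = ext_d A (\<eta> a) q x y)"
    by (rule frame[of p])
  have \<eta>: "one_form A V' (\<eta> a)" for a using \<eta>' by simp
  have ker: "Q q = {x. \<forall>a. \<eta> a q x = 0}" if "q \<in> V'" for q
    by (rule conjunct1[OF bspec[OF \<eta>'' that]])
  have d\<eta>: "\<gamma>0 q (Is a q x) y = ext_d A (\<eta> a) q x y" if "q \<in> V'" "x \<in> Q q" "y \<in> Q q" for q a x y
    using bspec[OF \<eta>'' that(1), THEN conjunct2] that(2,3) by blast
  have pd: "p \<in> hcr_dom H" using p V by blast
  have \<eta>0: "\<eta> a q x = 0" if "q \<in> V'" "x \<in> Q q" for a q x
    using that ker by blast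
  have lin\<eta>: "linear (\<eta> b p)" for b using \<eta>[of b] V'(2) by (simp add: one_form_def)
  obtain r where r: "\<And>x y. x \<in> Q p \<Longrightarrow> y \<in> Q p \<Longrightarrow> \<gamma>0 p x y = r p * \<gamma> p x y"
    using conformal[OF \<gamma> \<gamma>0] by metis
  have "\<exists>c. \<forall>z. \<theta> a p z = (\<Sum>b\<in>UNIV. c b * \<eta> b p z)"
    using ker[OF V'(2)] compatible_core[OF V(2) \<theta> p]
    by (intro functional_combination lin\<eta> compatible_linear[OF \<theta> p]) auto
  then obtain M where M: "\<And>z. \<theta> a p z = (\<Sum>b\<in>UNIV. M b * \<eta> b p z)" by blast
  have "\<forall>b. \<exists>w. \<forall>x\<in>Q p. Is b p x = (\<Sum>c\<in>UNIV. w $ c *\<^sub>R hcr_I H c p x)"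
    using I_sphere_exchange(2)[OF pd V'(2) fr] by blast
  then obtain w where w: "\<And>b x. x \<in> Q p \<Longrightarrow> Is b p x = (\<Sum>c\<in>UNIV. w b $ c *\<^sub>R hcr_I H c p x)"
    by metis
  have "ext_d A (\<theta> a) p x y = (\<Sum>c\<in>UNIV. (\<Sum>b\<in>UNIV. M b * r p * w b $ c) * \<gamma> p (hcr_I H c p x) y)"
    if x: "x \<in> Q p" "y \<in> Q p" for x y
  proof -
    have "ext_d A (\<theta> a) p x y = (\<Sum>b\<in>UNIV. M b * ext_d A (\<eta> b) p x y)"
      by (rule ext_d_combination[OF V' V(1) p \<eta> \<eta>0 compatible_one_form[OF \<theta>] compatible_core[OF V(2) \<theta>] M x])
    also have "\<dots> = (\<Sum>b\<in>UNIV. M b * (r p * (\<Sum>c\<in>UNIV. w b $ c * \<gamma> p (hcr_I H c p x) y)))"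
      using frame_core[OF fr V'(2) x(1)] hcr_I_core[OF pd x(1)] x
      by (simp add: d\<eta>[OF V'(2) x, symmetric] r) (simp add: w[OF x(1)] metric_sum_left[OF \<gamma>])
    also have "\<dots> = (\<Sum>b\<in>UNIV. \<Sum>c\<in>UNIV. M b * r p * w b $ c * \<gamma> p (hcr_I H c p x) y)"
      by (simp add: sum_distrib_left mult.assoc)
    also have "\<dots> = (\<Sum>c\<in>UNIV. \<Sum>b\<in>UNIV. M b * r p * w b $ c * \<gamma> p (hcr_I H c p x) y)"
      by (rule sum.swap)
    finally show ?thesis by (simp add: sum_distrib_right)
  qed
  then show "\<exists>N. \<forall>x\<in>Q p. \<forall>y\<in>Q p. ext_d A (\<theta> a) p x y = (\<Sum>b\<in>UNIV. N b * \<gamma> p (hcr_I H b p x) y)"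
    by (intro exI[of _ "\<lambda>c. \<Sum>b\<in>UNIV. M b * r p * w b $ c"]) blast
  assume zero: "\<And>a x y. x \<in> Q p \<Longrightarrow> y \<in> Q p \<Longrightarrow> ext_d A (\<theta> a) p x y = 0"
  have "\<exists>c. \<forall>z. \<eta> 1 p z = (\<Sum>b\<in>UNIV. c b * \<theta> b p z)"
    using \<eta>0[OF V'(2)] compatible_core_iff[OF V(2) \<theta> p]
    by (intro functional_combination lin\<eta> compatible_linear[OF \<theta> p]) auto
  then obtain L where L: "\<And>z. \<eta> 1 p z = (\<Sum>b\<in>UNIV. L b * \<theta> b p z)" by blast
  obtain x where x: "x \<in> Q p" "x \<noteq> 0" using core_nontrivial by blast
  \<comment> \<open>Linearity gives \<open>Is 1 p 0 = 0\<close>, so \<open>Is 1 p x = 0\<close>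
    would force \<open>- x = 0\<close>.\<close>
  have "linear_within (Q p) (Is 1 p)"
    using fr V'(2) unfolding quaternionic_frame_def complex_structure_def by blast
  then have "Is 1 p (0 *\<^sub>R x) = 0 *\<^sub>R Is 1 p x"
    using x(1) unfolding linear_within_def by blast
  then have Ix: "Is 1 p x \<in> Q p" "Is 1 p x \<noteq> 0"
    using frame_core[OF fr V'(2) x(1), of 1] x(2) by auto
  have "ext_d A (\<eta> 1) p x (Is 1 p x) = (\<Sum>b\<in>UNIV. L b * ext_d A (\<theta> b) p x (Is 1 p x))"
    by (rule ext_d_combination[OF V(1) p V' compatible_one_form[OF \<theta>] compatible_core[OF V(2) \<theta>] \<eta> \<eta>0 L x(1) Ix(1)])
  then have "\<gamma>0 p (Is 1 p x) (Is 1 p x) = 0"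
    using x Ix by (simp add: d\<eta>[OF V'(2), symmetric] zero)
  then show False
    using metric_pos[OF \<gamma>0 Ix] by simp
qed

text \<open>Each \<open>d\<theta>\<^sub>a\<close> is a combination of the forms \<open>\<gamma>(I\<^sub>b x, y)\<close>.  The first integrability condition makes it
  invariant under \<open>I\<^sub>a\<close>, which kills the terms with \<open>b \<noteq> a\<close>, and the second one makes the remaining
  coefficient independent of \<open>a\<close>.\<close>

lemma ext_d_proportional:
  assumes p: "p \<in> V" and \<gamma>: "\<gamma> \<in> C"
  shows "\<exists>l. l \<noteq> 0 \<and> (\<forall>a. \<forall>x\<in>Q p. \<forall>y\<in>Q p. ext_d A (\<theta> a) p x y = l * \<gamma> p (hcr_I H a p x) y)"
proof -
  have pd: "p \<in> hcr_dom H" using p V by blast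
  note J = hcr_I_core[OF pd]
  note minus = metric_minus_left[OF \<gamma>]
  note iso = metric_isometry[OF \<gamma> pd]
  obtain N where N: "\<And>a x y. x \<in> Q p \<Longrightarrow> y \<in> Q p \<Longrightarrow>
      ext_d A (\<theta> a) p x y = (\<Sum>b\<in>UNIV. N a b * \<gamma> p (hcr_I H b p x) y)"
    using ext_d_quaternionic_combination(1)[OF p \<gamma>] by metis
  obtain x where x: "x \<in> Q p" "x \<noteq> 0" using core_nontrivial by blast
  have pos: "\<gamma> p x x > 0" by (rule metric_pos[OF \<gamma> x])
  have diag: "N a b = 0" if "a \<noteq> b" for a b
  proof -
    \<comment> \<open>Testing on x and I_b x isolates \<open>N a b\<close>, because the vectors I_c
      x are pairwise orthogonal. Applying I_a to both arguments multiplies the term with index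
      \<open>c\<close> by the sign \<open>s c\<close>, since I_a commutes with itself and
      anticommutes with the other two.\<close>
    let ?y = "hcr_I H b p x"
    define s where "s c = (if c = a then 1 else - 1 :: real)" for c
    define F where "F c = N a c * \<gamma> p (hcr_I H c p x) ?y" for c
    have flip: "\<gamma> p (hcr_I H c p (hcr_I H a p x)) (hcr_I H a p ?y) = s c * \<gamma> p (hcr_I H c p x) ?y" for c
    proof (cases "c = a")
      case True
      then show ?thesis by (simp add: s_def iso J x)
    next
      case False
      then show ?thesis by (simp add: s_def anticommute[OF pd x(1) False] minus iso J x)
    qed
    have "(\<Sum>c\<in>UNIV. N a c * \<gamma> p (hcr_I H c p (hcr_I H a p x)) (hcr_I H a p ?y)) = (\<Sum>c\<in>UNIV. N a c * \<gamma> p (hcr_I H c p x) ?y)"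
      using ext_d_integrable(1)[OF p x(1) J[OF x(1)], of a b] by (simp only: N J x(1))
    then have "(\<Sum>c\<in>UNIV. F c * s c) = (\<Sum>c\<in>UNIV. F c)"
      by (simp add: flip F_def s_def mult_ac)
    then have "0 = (\<Sum>c\<in>UNIV. F c * (1 - s c))"
      by (simp add: right_diff_distrib sum_subtractf)
    \<comment> \<open>For c = a the factor 1 - s c is zero, and the third index drops out by
      orthogonality.\<close>
    also have "\<dots> = (\<Sum>c\<in>UNIV. if c = b then 2 * N a b * \<gamma> p x x else 0)"
    proof (rule sum.cong)
      show "F c * (1 - s c) = (if c = b then 2 * N a b * \<gamma> p x x else 0)" for c
        using that metric_orthogonal[OF \<gamma> pd x(1), of c b] by (auto simp: F_def s_def iso x)
    qed simp
    finally show ?thesis using pos by simp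
  qed
  have D: "ext_d A (\<theta> a) p u v = N a a * \<gamma> p (hcr_I H a p u) v" if "u \<in> Q p" "v \<in> Q p" for a u v
    unfolding N[OF that] sum_UNIV_3[of _ a] by (simp add: diag)
  have step: "N (a + 1) (a + 1) = N (a + 2) (a + 2)" for a
  proof -
    \<comment> \<open>With this choice every term of the second integrability condition is a
      coefficient times plus or minus \<gamma>(x,x), and the terms on each side add up instead of
      cancelling.\<close>
    let ?y = "hcr_I H (a + 1) p x"
    have 1: "\<gamma> p (hcr_I H (a + 1) p (hcr_I H a p x)) (hcr_I H a p ?y) = - \<gamma> p x x"
      by (simp add: quaternion[OF pd x(1)] minus iso J x)
    have 2: "\<gamma> p (hcr_I H (a + 2) p x) (hcr_I H a p ?y) = \<gamma> p x x"
      by (simp add: quaternion[OF pd x(1)] iso x)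
    have 3: "\<gamma> p (hcr_I H (a + 2) p (hcr_I H a p x)) ?y = \<gamma> p x x"
      using quaternion(1)[OF pd x(1), of "a + 2"] by (simp add: iso x)
    have "N (a + 1) (a + 1) * (2 * \<gamma> p x x) = N (a + 2) (a + 2) * (2 * \<gamma> p x x)"
      using ext_d_integrable(2)[OF p x(1) J[OF x(1)], of a "a + 1"]
      by (simp add: D J x 1 2 3) (simp add: iso x algebra_simps)
    then show ?thesis using pos by simp
  qed
  have "N a a = N 1 1" for a
    using step[of 1] step[of 2] step[of 3] exhaust_3[of a] by (auto simp: numeral_mod_3)
  then have D': "ext_d A (\<theta> a) p u v = N 1 1 * \<gamma> p (hcr_I H a p u) v" if "u \<in> Q p" "v \<in> Q p" for a u v
    using D[OF that, of a] by simp
  moreover have "N 1 1 \<noteq> 0"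
    using ext_d_quaternionic_combination(2)[OF p \<gamma>] D' by fastforce
  ultimately show ?thesis by (intro exI[of _ "N 1 1"]) simp
qed

text \<open>Each of the two terms averaged in \<open>levi\<close> is already l \<gamma>(x,y), the
  second one because I_a I_{a+1} = I_{a+2}.\<close>

lemma levi_proportional:
  assumes p: "p \<in> V" and \<gamma>: "\<gamma> \<in> C" and x: "x \<in> Q p" "y \<in> Q p"
    and l: "\<And>a x y. x \<in> Q p \<Longrightarrow> y \<in> Q p \<Longrightarrow> ext_d A (\<theta> a) p x y = l * \<gamma> p (hcr_I H a p x) y"
  shows "ext_d A (\<theta> a) p x (hcr_I H a p y) = l * \<gamma> p x y" "levi A H \<theta> a p x y = l * \<gamma> p x y"
proof -
  have pd: "p \<in> hcr_dom H" using p V by blast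
  note J = hcr_I_core[OF pd]
  show 1: "ext_d A (\<theta> a) p x (hcr_I H a p y) = l * \<gamma> p x y" for a
    by (simp add: l J x metric_isometry[OF \<gamma> pd])
  have "ext_d A (\<theta> a) p (hcr_I H (a + 1) p x) (hcr_I H (a + 2) p y) = l * \<gamma> p x y"
    by (simp add: l J x metric_isometry[OF \<gamma> pd] quaternion[OF pd x(1)])
  then show "levi A H \<theta> a p x y = l * \<gamma> p x y"
    by (simp add: levi_def 1)
qed

text \<open>The factor \<open>l\<close> is only given pointwise. Integrability asserts that the
  bracket combination \<open>Z\<close> is a smooth field, so \<theta>_1(Z) is a smooth function. The
  index 3 is used because with index 1 the field would lie in the kernel of \<theta>_1.\<close>

lemma smooth_fun_factor:
  assumes \<gamma>: "\<gamma> \<in> C" and W: "open W" "W \<subseteq> V" and X: "X \<in> sections A W Q"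
    and l: "\<And>p a x y. p \<in> W \<Longrightarrow> x \<in> Q p \<Longrightarrow> y \<in> Q p \<Longrightarrow> ext_d A (\<theta> a) p x y = l p * \<gamma> p (hcr_I H a p x) y"
  shows "smooth_fun A W (\<lambda>p. l p * \<gamma> p (X p) (X p))"
proof -
  have Wd: "W \<subseteq> hcr_dom H" using W V by blast
  define Y where "Y = (\<lambda>p. hcr_I H 1 p (X p))"
  define X' where "X' = (\<lambda>p. hcr_I H 3 p (X p))"
  define Y' where "Y' = (\<lambda>p. hcr_I H 3 p (Y p))"
  have sec: "Y \<in> sections A W Q" "X' \<in> sections A W Q" "Y' \<in> sections A W Q"
    unfolding Y'_def X'_def Y_def by (intro sections_hcr_I W(1) Wd X)+
  define Z where "Z = (\<lambda>p. lie_bracket A X Y p - lie_bracket A X' Y' p)"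
  have "Z \<in> sections A W (hcr_Q H 3)"
    using integrable(1)[OF W(1) Wd X sec(1), of 3] by (simp add: Z_def X'_def Y'_def)
  then have "smooth_fun A W (\<lambda>p. \<theta> 1 p (Z p))"
    by (intro one_form_smooth[OF compatible_one_form[OF \<theta>] W]) (simp add: sections_def)
  \<comment> \<open>Both brackets contribute - l \<gamma>(X,X) to \<theta>_1(Z), as I_1 I_3 X = -
    I_2 X and I_3 I_1 X = I_2 X; hence the constant -1/2.\<close>
  then have "smooth_fun A W (\<lambda>p. (- 1 / 2) * \<theta> 1 p (Z p))"
    by (intro smooth_fun_mult smooth_fun_const atlas W(1))
  moreover have "(- 1 / 2) * \<theta> 1 p (Z p) = l p * \<gamma> p (X p) (X p)" if p: "p \<in> W" for p
  proof -
    have pV: "p \<in> V" and pd: "p \<in> hcr_dom H" using p W V by blast+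
    have x: "X p \<in> Q p" using X p by (simp add: sections_def)
    note J = hcr_I_core[OF pd]
    note q = quaternion[OF pd x]
    have "- \<theta> 1 p (Z p) = ext_d A (\<theta> 1) p (X p) (Y p) - ext_d A (\<theta> 1) p (X' p) (Y' p)"
      using linear_diff[OF compatible_linear[OF \<theta> pV]]
      by (simp add: Z_def ext_d_compatible[OF W(1) p W(2) X sec(1)] ext_d_compatible[OF W(1) p W(2) sec(2,3)])
    also have "\<dots> = l p * (\<gamma> p (hcr_I H 1 p (X p)) (hcr_I H 1 p (X p)) -
        \<gamma> p (hcr_I H 1 p (hcr_I H 3 p (X p))) (hcr_I H 3 p (hcr_I H 1 p (X p))))"
      by (simp add: l[OF p] J x Y_def X'_def Y'_def right_diff_distrib)
    also have "hcr_I H 1 p (hcr_I H 3 p (X p)) = - hcr_I H 2 p (X p)"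
      using q(2)[of 3] by (simp add: numeral_mod_3)
    also have "hcr_I H 3 p (hcr_I H 1 p (X p)) = hcr_I H 2 p (X p)"
      using q(1)[of 3] by (simp add: numeral_mod_3)
    finally show ?thesis
      by (simp add: metric_minus_left[OF \<gamma>] metric_isometry[OF \<gamma> pd] J x)
  qed
  ultimately show ?thesis
    by (rule smooth_fun_cong[OF atlas W(1)])
qed

end

section \<open>Compatible forms from admissible triples\<close>

context
  fixes V T
  assumes V: "V \<subseteq> hcr_dom H" and T: "admissible_triple A V H T"
begin

lemma triple_mem:
  assumes "p \<in> V" "a \<noteq> b"
  shows "T a p \<in> hcr_Q H b p"
proof -
  have "T a p \<in> hcr_Q H (a + 1) p \<inter> hcr_Q H (a + 2) p"
    using T assms(1) unfolding admissible_triple_def by (simp add: sections_def)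
  then show ?thesis using index_cases_3[of b a] assms(2) by auto
qed

lemma triple_span:
  assumes "p \<in> V"
  obtains q t where "q \<in> Q p" "x = q + (\<Sum>a\<in>UNIV. t a *\<^sub>R T a p)"
proof -
  have "Q p = hcr_core H p" using assms V underlying by blast
  then have "x \<in> span (Q p \<union> range (\<lambda>a. T a p))"
    using T assms unfolding admissible_triple_def by simp
  then obtain q y where "x = q + y" "q \<in> span (Q p)" "y \<in> span (range (\<lambda>a. T a p))"
    unfolding span_Un by auto
  moreover from this obtain t where "y = (\<Sum>a\<in>UNIV. t a *\<^sub>R T a p)"
    using span_image_finite[of UNIV y "\<lambda>a. T a p"] by auto
  moreover have "span (Q p) = Q p" using subspace_core by (simp add: span_eq_iff)
  ultimately show thesis using that by simp
qed

text \<open>Otherwise Q_a would contain \<open>Q\<close> and all three fields, hence every tangent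
  vector, although it has corank one.\<close>

lemma triple_not_mem:
  assumes p: "p \<in> V"
  shows "T a p \<notin> hcr_Q H a p"
proof
  assume Ta: "T a p \<in> hcr_Q H a p"
  have pd: "p \<in> hcr_dom H" using p V by blast
  have "x \<in> hcr_Q H a p" for x
  proof -
    obtain q t where x: "q \<in> Q p" "x = q + (\<Sum>b\<in>UNIV. t b *\<^sub>R T b p)"
      by (rule triple_span[OF p])
    have "T b p \<in> hcr_Q H a p" for b using Ta triple_mem[OF p, of b a] by blast
    then show ?thesis
      unfolding x(2) using core_sub[OF pd x(1)] hcr_Q(1)[OF pd]
      by (intro subspace_add subspace_sum subspace_scale)
  qed
  then have "hcr_Q H a p = UNIV" by blast
  then show False using hcr_Q(2)[OF pd, of a] by (simp add: dim_UNIV)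
qed

text \<open>Modulo \<open>Q\<close> the triple provides coordinates \<open>t\<close>. Two of its
  fields lie in Q_a and T_a does not, so Q_a is a coordinate plane.\<close>

lemma triple_mem_iff:
  assumes p: "p \<in> V" and q: "q \<in> Q p"
  shows "q + (\<Sum>b\<in>UNIV. t b *\<^sub>R T b p) \<in> hcr_Q H a p \<longleftrightarrow> t a = 0"
proof -
  have pd: "p \<in> hcr_dom H" using p V by blast
  note sub = hcr_Q(1)[OF pd, of a]
  have r: "q + (t (a + 1) *\<^sub>R T (a + 1) p + t (a + 2) *\<^sub>R T (a + 2) p) \<in> hcr_Q H a p" (is "?r \<in> _")
    using core_sub[OF pd q] sub triple_mem[OF p]
    by (intro subspace_add subspace_scale) auto
  have eq: "q + (\<Sum>b\<in>UNIV. t b *\<^sub>R T b p) = ?r + t a *\<^sub>R T a p"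
    by (simp add: sum_UNIV_3[of _ a])
  show ?thesis
  proof
    assume "q + (\<Sum>b\<in>UNIV. t b *\<^sub>R T b p) \<in> hcr_Q H a p"
    then have "(?r + t a *\<^sub>R T a p) - ?r \<in> hcr_Q H a p"
      unfolding eq by (rule subspace_diff[OF sub _ r])
    then have m: "t a *\<^sub>R T a p \<in> hcr_Q H a p" by simp
    show "t a = 0"
    proof (rule ccontr)
      assume "t a \<noteq> 0"
      then show False
        using subspace_scale[OF sub m, of "inverse (t a)"] triple_not_mem[OF p] by simp
    qed
  next
    assume "t a = 0"
    then show "q + (\<Sum>b\<in>UNIV. t b *\<^sub>R T b p) \<in> hcr_Q H a p"
      using r unfolding eq by simp
  qed
qed

lemma triple_rotate:
  assumes p: "p \<in> V"
  shows "hcr_I H a p (T (a + 1) p) = T (a + 2) p" "hcr_I H a p (T (a + 2) p) = - T (a + 1) p"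
proof -
  have pd: "p \<in> hcr_dom H" using p V by blast
  show 1: "hcr_I H a p (T (a + 1) p) = T (a + 2) p"
    using T p unfolding admissible_triple_def by blast
  show "hcr_I H a p (T (a + 2) p) = - T (a + 1) p"
    using hcr_I_square[OF pd triple_mem[OF p, of "a + 1" a]] by (simp add: 1)
qed

text \<open>With \<open>n\<^sub>c = \<eta>(T\<^sub>c)\<close> the cross product formula \<open>\<theta>\<^sub>a = \<eta> \<cdot> (n\<^sub>b \<times> n\<^sub>c)\<close> is smooth without inverting a matrix,
  and \<open>\<theta>\<^sub>a(T\<^sub>b) = det(n\<^sub>1, n\<^sub>2, n\<^sub>3) \<delta>\<^sub>a\<^sub>b\<close>.\<close>

lemma compatible_from_triple:
  assumes p: "p \<in> V" and oV: "open V"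
  obtains W \<theta> where "open W" "p \<in> W" "W \<subseteq> V" "compatible A W H \<theta>"
proof -
  obtain V' and Is :: "3 \<Rightarrow> 'm \<Rightarrow> 'e \<Rightarrow> 'e" and \<gamma>0 and \<eta> :: "3 \<Rightarrow> 'm \<Rightarrow> 'e \<Rightarrow> real"
    where V': "open V'" "p \<in> V'" and fr: "quaternionic_frame A V' Q \<I> Is" and \<gamma>0: "\<gamma>0 \<in> C"
      and \<eta>': "\<forall>a. one_form A V' (\<eta> a)"
      and \<eta>'': "\<forall>q\<in>V'. Q q = {x. \<forall>a. \<eta> a q x = 0} \<and>
       (\<forall>a. \<forall>x\<in>Q q. \<forall>y\<in>Q q. \<gamma>0 q (Is a q x) y = ext_d A (\<eta> a) q x y)"
    by (rule frame[of p])
  define W where "W = V \<inter> V'"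
  have W: "open W" "p \<in> W" "W \<subseteq> V" using oV V' p by (auto simp: W_def)
  have \<eta>: "one_form A W (\<eta> a)" for a
    by (rule one_form_mono[of _ V']) (use \<eta>' in \<open>auto simp: W_def\<close>)
  have ker: "x \<in> Q q \<longleftrightarrow> (\<forall>a. \<eta> a q x = 0)" if "q \<in> W" for q x
    using conjunct1[OF bspec[OF \<eta>'', of q]] that by (auto simp: W_def)
  define n where "n c i q = \<eta> i q (T c q)" for c i q
  \<comment> \<open>Component \<open>i\<close> of the cross product of \<open>n (a + 1)\<close> and
    \<open>n (a + 2)\<close>; with indices modulo three one cyclic formula serves for all
    components.\<close>
  define w where "w a i q = n (a + 1) (i + 1) q * n (a + 2) (i + 2) q
    + (-1) * (n (a + 1) (i + 2) q * n (a + 2) (i + 1) q)" for a i q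
  define \<theta> where "\<theta> a q x = (\<Sum>i\<in>UNIV. \<eta> i q x * w a i q)" for a q x
  define \<Delta> where "\<Delta> q = \<theta> 1 q (T 1 q)" for q
  have "smooth_vf A W (T c)" for c
    using T unfolding admissible_triple_def sections_def by (auto intro: smooth_vf_mono[OF _ W(3)])
  then have n: "smooth_fun A W (n c i)" for c i
    unfolding n_def by (intro one_form_smooth[OF \<eta> W(1)]) auto
  have w: "smooth_fun A W (w a i)" for a i
    unfolding w_def by (intro smooth_fun_add smooth_fun_mult smooth_fun_const atlas W(1) n)
  have lin: "linear (\<theta> a q)" if "q \<in> W" for a q
  proof (rule linearI)
    have l: "linear (\<eta> i q)" for i using \<eta> that by (simp add: one_form_def)
    show "\<theta> a q (x + y) = \<theta> a q x + \<theta> a q y" for x y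
      by (simp add: \<theta>_def linear_add[OF l] distrib_right sum.distrib)
    show "\<theta> a q (r *\<^sub>R x) = r *\<^sub>R \<theta> a q x" for x r
      by (simp add: \<theta>_def linear_scale[OF l] sum_distrib_left mult.assoc)
  qed
  have one: "one_form A W (\<theta> a)" for a
    unfolding one_form_def
  proof (intro conjI ballI allI impI)
    fix U X assume U: "open U \<and> U \<subseteq> W \<and> smooth_vf A U X"
    then show "smooth_fun A U (\<lambda>q. \<theta> a q (X q))"
      unfolding \<theta>_def
      by (intro smooth_fun_sum smooth_fun_mult one_form_smooth[OF \<eta>] smooth_fun_mono[OF w] atlas) auto
  qed (rule lin)
  have \<theta>T: "\<theta> a q (T b q) = (if b = a then \<Delta> q else 0)" for a b q
  proof -
    have "\<theta> a q (T a q) = \<Delta> q" for a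
      using exhaust_3[of a] by (auto simp: \<theta>_def \<Delta>_def w_def n_def sum_3 numeral_mod_3 algebra_simps)
    moreover have "\<theta> a q (T (a + 1) q) = 0" "\<theta> a q (T (a + 2) q) = 0"
      by (simp_all add: \<theta>_def w_def n_def sum_UNIV_3[of _ 1] numeral_mod_3 algebra_simps)
    ultimately show ?thesis using index_cases_3[of b a] by auto
  qed
  have \<Delta>: "\<Delta> q \<noteq> 0" if q: "q \<in> W" for q
  proof -
    \<comment> \<open>The columns are the vectors \<open>n j\<close>, so the determinant is
      \<open>\<Delta> q\<close>. A kernel vector gives a combination of the T_b annihilated by every
      \<eta>_i; it lies in \<open>Q\<close>, and \<open>triple_mem_iff\<close> makes its
      coefficients zero.\<close>
    define N where "N = (\<chi> i j. n j i q)"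
    have qV: "q \<in> V" using q W(3) by blast
    have l: "linear (\<eta> i q)" for i using \<eta> q by (simp add: one_form_def)
    have "c = 0" if c: "N *v c = 0" for c
    proof -
      have "\<eta> i q (\<Sum>b\<in>UNIV. c $ b *\<^sub>R T b q) = (N *v c) $ i" for i
        by (simp add: linear_sum[OF l] linear_scale[OF l] N_def n_def matrix_vector_mult_def mult.commute)
      then have "(\<Sum>b\<in>UNIV. c $ b *\<^sub>R T b q) \<in> Q q"
        using ker[OF q] c by simp
      then have "0 + (\<Sum>b\<in>UNIV. c $ b *\<^sub>R T b q) \<in> hcr_Q H a q" for a
        using core_sub qV V by auto
      then have "c $ a = 0" for a
        using triple_mem_iff[OF qV subspace_0[OF subspace_core], of "\<lambda>b. c $ b"] by blast
      then show ?thesis by (simp add: vec_eq_iff)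
    qed
    then have "inj ((*v) N)"
      by (simp add: linear_injective_0)
    then have "det N \<noteq> 0"
      using det_nz_iff_inj[OF matrix_vector_mul_linear[of N]] by simp
    moreover have "det N = \<Delta> q"
      by (simp add: det_3 N_def \<Delta>_def \<theta>_def w_def n_def sum_3 numeral_mod_3 algebra_simps)
    ultimately show ?thesis by simp
  qed
  have \<theta>: "\<theta> a q (z + (\<Sum>b\<in>UNIV. t b *\<^sub>R T b q)) = t a * \<Delta> q" if q: "q \<in> W" "z \<in> Q q" for a q z t
  proof -
    have "\<theta> a q z = 0" using ker[OF q(1)] q(2) by (simp add: \<theta>_def)
    then show ?thesis
      by (simp add: linear_add[OF lin[OF q(1)]] linear_sum[OF lin[OF q(1)]] linear_scale[OF lin[OF q(1)]] \<theta>T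
          if_distrib[of "\<lambda>t. _ * t"] cong: if_cong)
  qed
  have "compatible A W H \<theta>"
    unfolding compatible_def
  proof (intro conjI allI ballI)
    fix q a assume q: "q \<in> W"
    then have qV: "q \<in> V" and qd: "q \<in> hcr_dom H" using W(3) V by blast+
    show "{x. \<theta> a q x = 0} = hcr_Q H a q"
    proof (intro set_eqI)
      fix x
      obtain z t where x: "z \<in> Q q" "x = z + (\<Sum>b\<in>UNIV. t b *\<^sub>R T b q)"
        by (rule triple_span[OF qV])
      show "x \<in> {x. \<theta> a q x = 0} \<longleftrightarrow> x \<in> hcr_Q H a q"
        unfolding x(2) by (simp add: \<theta>[OF q x(1)] triple_mem_iff[OF qV x(1)] \<Delta>[OF q])
    qed
    fix x assume xa: "x \<in> hcr_Q H a q"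
    obtain z t where x: "z \<in> Q q" "x = z + (\<Sum>b\<in>UNIV. t b *\<^sub>R T b q)"
      by (rule triple_span[OF qV])
    have ta: "t a = 0" using xa unfolding x(2) triple_mem_iff[OF qV x(1)] .
    define y where "y = hcr_I H a q z"
    have y: "y \<in> Q q" unfolding y_def by (rule hcr_I_core[OF qd x(1)])
    have xe: "x = z + (t (a + 1) *\<^sub>R T (a + 1) q + t (a + 2) *\<^sub>R T (a + 2) q)"
      unfolding x(2) sum_UNIV_3[of _ a] by (simp add: ta)
    have mem: "T (a + 1) q \<in> hcr_Q H a q" "T (a + 2) q \<in> hcr_Q H a q"
      by (intro triple_mem[OF qV]; simp)+
    have sc: "r *\<^sub>R T (a + 1) q \<in> hcr_Q H a q" "r *\<^sub>R T (a + 2) q \<in> hcr_Q H a q" for r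
      using mem hcr_Q(1)[OF qd] by (simp_all add: subspace_scale)
    \<comment> \<open>I_a takes T_{a+1} to T_{a+2} and T_{a+2} to - T_{a+1}. So
      \<open>\<theta> (a + 2)\<close> reads off from the image the coefficient
      \<open>t (a + 1)\<close>, which \<open>\<theta> (a + 1)\<close> reads off from
      \<open>x\<close>.\<close>
    have "hcr_I H a q x = y + (t (a + 1) *\<^sub>R T (a + 2) q - t (a + 2) *\<^sub>R T (a + 1) q)"
      unfolding xe y_def
      by (simp add: hcr_I_add[OF qd] hcr_I_scale[OF qd] core_sub[OF qd x(1)] mem sc
          subspace_add[OF hcr_Q(1)[OF qd]] triple_rotate[OF qV])
    moreover have "\<theta> (a + 2) q y = 0" using ker[OF q] y by (simp add: \<theta>_def)
    ultimately have "\<theta> (a + 2) q (hcr_I H a q x) = t (a + 1) * \<Delta> q"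
      by (simp add: linear_add[OF lin[OF q]] linear_diff[OF lin[OF q]] linear_scale[OF lin[OF q]] \<theta>T)
    also have "\<dots> = \<theta> (a + 1) q x"
      unfolding x(2) by (simp add: \<theta>[OF q x(1)])
    finally show "\<theta> (a + 2) q (hcr_I H a q x) = \<theta> (a + 1) q x" .
  qed (rule one)
  then show thesis using that W by blast
qed

text \<open>The matrix of the values \<theta>_b(T_a) is a nonzero multiple of the identity, so the
  linear condition on \<open>t\<close> in \<open>Q_at\<close> becomes one on the values of \<theta>.
  This translates \<open>rotated_by\<close> into a statement about compatible forms.\<close>

lemma compatible_triple:
  assumes U: "U \<subseteq> hcr_dom H" "compatible A U H \<theta>" and p: "p \<in> U" "p \<in> V"
  shows "Q_at H T v p = {x. (\<Sum>a\<in>UNIV. v $ a * \<theta> a p x) = 0}"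
proof -
  note lin = compatible_linear[OF U(2) p(1)]
  define \<mu> where "\<mu> = \<theta> 1 p (T 1 p)"
  have off: "\<theta> b p (T a p) = 0" if "a \<noteq> b" for a b
    using triple_mem[OF p(2) that] compatible_iff[OF U p(1)] by simp
  have step: "\<theta> (a + 2) p (T (a + 2) p) = \<theta> (a + 1) p (T (a + 1) p)" for a
    using compatible_rotate[OF U(2) p(1) triple_mem[OF p(2), of "a + 1" a]]
    by (simp add: triple_rotate[OF p(2)])
  have diag: "\<theta> a p (T a p) = \<mu>" for a
    using step[of 1] step[of 2] step[of 3] exhaust_3[of a] by (auto simp: \<mu>_def numeral_mod_3)
  have \<mu>: "\<mu> \<noteq> 0"
    using triple_not_mem[OF p(2), of 1] compatible_iff[OF U p(1)] by (simp add: \<mu>_def)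
  have "\<theta> b p (T a p) = (if a = b then \<mu> else 0)" for a b
    using off diag by simp
  then have val: "(\<Sum>a\<in>UNIV. v $ a * \<theta> a p (z + (\<Sum>b\<in>UNIV. t b *\<^sub>R T b p))) = \<mu> * (\<Sum>a\<in>UNIV. t a * v $ a)"
    if "z \<in> Q p" for z t
    using compatible_core[OF U p(1) that]
    by (simp add: linear_add[OF lin] linear_sum[OF lin] linear_scale[OF lin] sum_distrib_left
        if_distrib[of "\<lambda>t. _ * t"] mult_ac cong: if_cong)
  have core: "hcr_core H p = Q p" using underlying U(1) p(1) by blast
  show ?thesis
  proof (intro set_eqI iffI)
    fix x assume "x \<in> Q_at H T v p"
    then obtain z and t :: "real^3" where "x = z + (\<Sum>a\<in>UNIV. t $ a *\<^sub>R T a p)" "z \<in> Q p" "(\<Sum>a\<in>UNIV. t $ a * v $ a) = 0"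
      unfolding Q_at_def core by blast
    then show "x \<in> {x. (\<Sum>a\<in>UNIV. v $ a * \<theta> a p x) = 0}"
      using val[of z "\<lambda>a. t $ a"] by simp
  next
    fix x assume x: "x \<in> {x. (\<Sum>a\<in>UNIV. v $ a * \<theta> a p x) = 0}"
    obtain z t where z: "z \<in> Q p" "x = z + (\<Sum>b\<in>UNIV. t b *\<^sub>R T b p)"
      by (rule triple_span[OF p(2)])
    then have "(\<Sum>a\<in>UNIV. t a * v $ a) = 0"
      using x val[OF z(1), of t] \<mu> by simp
    then show "x \<in> Q_at H T v p"
      unfolding Q_at_def core using z by (auto intro!: exI[of _ z] exI[of _ "\<chi> a. t a"])
  qed
qed

text \<open>A vector of \<open>Q\<close> has no component along T_a, so the description in
  \<open>I_ext\<close> returns the vector itself.\<close>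

lemma I_ext_core:
  assumes p: "p \<in> V" and x: "x \<in> Q p"
  shows "I_ext H T a p x = hcr_I H a p x"
proof -
  have pd: "p \<in> hcr_dom H" using p V by blast
  note sub = hcr_Q(1)[OF pd, of a]
  have "(THE y. y \<in> hcr_Q H a p \<and> (\<exists>r. x = y + r *\<^sub>R T a p)) = x"
  proof (rule the_equality)
    show "x \<in> hcr_Q H a p \<and> (\<exists>r. x = x + r *\<^sub>R T a p)"
      using core_sub[OF pd x] by (auto intro: exI[of _ 0])
    fix y assume "y \<in> hcr_Q H a p \<and> (\<exists>r. x = y + r *\<^sub>R T a p)"
    then obtain r where y: "y \<in> hcr_Q H a p" "x = y + r *\<^sub>R T a p" by blast
    then have "r *\<^sub>R T a p \<in> hcr_Q H a p"
      using subspace_diff[OF sub core_sub[OF pd x] y(1)] by simp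
    then have "r = 0"
      using subspace_scale[OF sub, of "r *\<^sub>R T a p" "inverse r"] triple_not_mem[OF p, of a]
      by (cases "r = 0") auto
    then show "y = x" using y(2) by simp
  qed
  then show ?thesis by (simp add: I_ext_def)
qed

end

section \<open>Normalized compatible forms\<close>

lemma scaled_metric_mem:
  assumes \<gamma>: "\<gamma> \<in> C" and r: "smooth_fun A UNIV r" "\<And>p. r p > 0"
    and g: "\<And>p x y. x \<in> Q p \<Longrightarrow> y \<in> Q p \<Longrightarrow> g p x y = r p * \<gamma> p x y"
  shows "g \<in> C"
proof -
  have "bundle_metric A Q g"
    unfolding bundle_metric_def
  proof (intro conjI allI ballI impI)
    fix p x assume x: "x \<in> Q p"
    show "linear_within (Q p) (g p x)"
      unfolding linear_within_def using subspace_core[of p] x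
      by (auto simp: g subspace_add subspace_scale metric_add[OF \<gamma>] metric_scale[OF \<gamma>] distrib_left)
    show "g p x y = g p y x" if "y \<in> Q p" for y
      using x that by (simp add: g metric_sym[OF \<gamma> x that])
    show "g p x x > 0" if "x \<noteq> 0"
      using x r(2)[of p] metric_pos[OF \<gamma> x that] by (simp add: g)
  next
    fix V X Y assume *: "open V \<and> X \<in> sections A V Q \<and> Y \<in> sections A V Q"
    then have "smooth_fun A V (\<lambda>p. \<gamma> p (X p) (Y p))"
      using metric[OF \<gamma>] unfolding bundle_metric_def by blast
    then have "smooth_fun A V (\<lambda>p. r p * \<gamma> p (X p) (Y p))"
      using * by (intro smooth_fun_mult smooth_fun_mono[OF r(1)] atlas) auto
    then show "smooth_fun A V (\<lambda>p. g p (X p) (Y p))"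
      by (rule smooth_fun_cong[OF atlas conjunct1[OF *]]) (use * in \<open>auto simp: sections_def g\<close>)
  qed
  note metric_g = this
  obtain g0 where C: "C = {g'. bundle_metric A Q g' \<and>
                   (\<exists>f. smooth_fun A UNIV f \<and> (\<forall>p. f p > 0) \<and>
                        (\<forall>p. \<forall>x\<in>Q p. \<forall>y\<in>Q p. g' p x y = f p * g0 p x y))}"
    using qc unfolding qc_structure_def conformal_class_def by blast
  obtain f where f: "smooth_fun A UNIV f" "\<And>p. f p > 0"
      "\<And>p x y. x \<in> Q p \<Longrightarrow> y \<in> Q p \<Longrightarrow> \<gamma> p x y = f p * g0 p x y"
    using \<gamma> C by blast
  have "smooth_fun A UNIV (\<lambda>p. r p * f p)"
    by (intro smooth_fun_mult atlas r f) auto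
  moreover have "\<forall>p. r p * f p > 0" using r(2) f(2) by simp
  moreover have "\<forall>p. \<forall>x\<in>Q p. \<forall>y\<in>Q p. g p x y = r p * f p * g0 p x y" by (simp add: g f(3))
  ultimately show ?thesis
    unfolding C using metric_g by (intro CollectI conjI exI[of _ "\<lambda>p. r p * f p"])
qed

lemma smooth_factor:
  assumes \<gamma>: "\<gamma> \<in> C" and V: "open V" "V \<subseteq> hcr_dom H" and \<theta>: "compatible A V H \<theta>"
    and l: "\<And>p a x y. p \<in> V \<Longrightarrow> x \<in> Q p \<Longrightarrow> y \<in> Q p \<Longrightarrow> ext_d A (\<theta> a) p x y = l p * \<gamma> p (hcr_I H a p x) y"
  shows "smooth_fun A V l"
proof (rule smooth_fun_local[OF atlas])
  fix p assume p: "p \<in> V"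
  obtain x where x: "x \<in> Q p" "x \<noteq> 0" using core_nontrivial by blast
  obtain W0 X Y where W0: "open W0" "p \<in> W0" "W0 \<subseteq> V" "X \<in> sections A W0 Q" "Y \<in> sections A W0 Q" "X p = x" "Y p = x"
    by (rule core_sections[OF V(1) p x(1) x(1)])
  define h where "h q = \<gamma> q (X q) (X q)" for q
  have h: "smooth_fun A W0 h"
    unfolding h_def using metric[OF \<gamma>] W0(1,4) unfolding bundle_metric_def by blast
  have lh: "smooth_fun A W0 (\<lambda>q. l q * h q)"
    unfolding h_def by (rule smooth_fun_factor[OF V \<theta> \<gamma> W0(1,3,4)]) (use l W0(3) in blast)
  \<comment> \<open>By \<open>smooth_fun_factor\<close> the product l h is smooth; on the open set
    where \<open>h\<close> does not vanish, which contains \<open>p\<close>, it can be divided by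
    \<open>h\<close>.\<close>
  define W where "W = W0 \<inter> h -` (- {0})"
  have W: "open W" "W \<subseteq> W0"
    using continuous_open_preimage[OF smooth_fun_continuous[OF atlas W0(1) h] W0(1), of "- {0}"]
    by (auto simp: W_def open_Compl)
  have nz: "h q \<noteq> 0" if "q \<in> W" for q using that by (simp add: W_def)
  have "smooth_fun A W (\<lambda>q. (l q * h q) * inverse (h q))"
    by (intro smooth_fun_mult smooth_fun_inverse atlas W(1) nz smooth_fun_mono[OF h W(2)] smooth_fun_mono[OF lh W(2)])
  then have "smooth_fun A W l"
    by (rule smooth_fun_cong[OF atlas W(1)]) (simp add: nz)
  moreover have "p \<in> W"
    using W0(2,6) metric_pos[OF \<gamma> x] by (simp add: W_def h_def)
  ultimately show "\<exists>W. open W \<and> p \<in> W \<and> smooth_fun A W l" using W(1) by blast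
qed

section \<open>Rescaling and uniqueness of compatible forms\<close>

lemma compatible_scale:
  assumes "open V" "V \<subseteq> hcr_dom H" "compatible A V H \<theta>" "smooth_fun A V f" "\<And>p. p \<in> V \<Longrightarrow> f p \<noteq> 0"
  shows "compatible A V H (\<lambda>a p x. f p * \<theta> a p x)"
  unfolding compatible_def
proof (intro conjI allI ballI)
  show "one_form A V (\<lambda>p x. f p * \<theta> a p x)" for a
    unfolding one_form_def
  proof (intro conjI ballI allI impI)
    show "linear (\<lambda>x. f p * \<theta> a p x)" if "p \<in> V" for p
      using linear_compose_scale_right[OF compatible_linear[OF assms(3) that], of "f p" a] by simp
    show "smooth_fun A U (\<lambda>p. f p * \<theta> a p (X p))" if "open U \<and> U \<subseteq> V \<and> smooth_vf A U X" for U X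
      using that by (intro smooth_fun_mult one_form_smooth[OF compatible_one_form[OF assms(3)]]
          smooth_fun_mono[OF assms(4)] atlas) auto
  qed
  show "{x. f p * \<theta> a p x = 0} = hcr_Q H a p" if "p \<in> V" for p a
    using compatible_iff[OF assms(2,3) that] assms(5)[OF that] by simp
  show "f p * \<theta> (a + 2) p (hcr_I H a p x) = f p * \<theta> (a + 1) p x" if "p \<in> V" "x \<in> hcr_Q H a p" for p a x
    using compatible_rotate[OF assms(3) that] by simp
qed

text \<open>Here \<open>r\<close> is only the ratio at \<open>p\<close>: a derivative of a varying
  factor would be multiplied by a form that vanishes on \<open>Q\<close>. Accordingly this is
  \<open>ext_d_combination\<close> for a single form.\<close>

lemma ext_d_multiple:
  assumes "open V" "V \<subseteq> hcr_dom H" "compatible A V H \<theta>" "p \<in> V"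
    and "open V'" "V' \<subseteq> hcr_dom H" "compatible A V' H \<theta>'" "p \<in> V'"
    and "\<And>z. \<theta>' a p z = r * \<theta> a p z" and x: "x \<in> Q p" "y \<in> Q p"
  shows "ext_d A (\<theta>' a) p x y = r * ext_d A (\<theta> a) p x y"
  using ext_d_combination[OF assms(1,4,5,8), where \<phi> = "\<lambda>_::unit. \<theta> a" and \<psi> = "\<theta>' a" and c = "\<lambda>_. r",
      OF compatible_one_form[OF assms(3)] compatible_core[OF assms(2,3)]
        compatible_one_form[OF assms(7)] compatible_core[OF assms(6,7)] _ x] assms(9)
  by simp

text \<open>Equal kernels give one factor for each component, and the relation between the
  components in \<open>compatible\<close> makes the three factors equal.\<close>

lemma compatible_unique:
  assumes "V \<subseteq> hcr_dom H" "compatible A V H \<theta>" "p \<in> V"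
    and "V' \<subseteq> hcr_dom H" "compatible A V' H \<theta>'" "p \<in> V'"
  shows "\<exists>k. \<forall>a x. \<theta>' a p x = k * \<theta> a p x"
proof -
  have pd: "p \<in> hcr_dom H" using assms by blast
  have "\<exists>k. \<forall>x. \<theta>' a p x = k * \<theta> a p x" for a
    by (rule functional_multiple)
      (use compatible_linear[OF assms(2,3)] compatible_linear[OF assms(5,6)]
          compatible_iff[OF assms(1-3)] compatible_iff[OF assms(4-6)] in auto)
  then obtain k where k: "\<And>a x. \<theta>' a p x = k a * \<theta> a p x" by metis
  have step: "k (a + 2) = k (a + 1)" for a
  proof -
    \<comment> \<open>Otherwise \<open>\<theta> (a + 1)\<close>, and through I_a also
      \<open>\<theta> (a + 2)\<close>, would vanish on Q_a. Then Q_a would lie in \<open>Q\<close>: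
      corank one against corank three.\<close>
    have "\<exists>x\<in>hcr_Q H a p. \<theta> (a + 1) p x \<noteq> 0"
    proof (rule ccontr)
      assume "\<not> ?thesis"
      then have 1: "\<theta> (a + 1) p x = 0" if "x \<in> hcr_Q H a p" for x using that by blast
      have 2: "\<theta> (a + 2) p x = 0" if x: "x \<in> hcr_Q H a p" for x
      proof -
        have "- hcr_I H a p x \<in> hcr_Q H a p"
          using hcr_I_hcr_Q[OF pd x] hcr_Q(1)[OF pd] by (simp add: subspace_neg)
        from compatible_rotate[OF assms(2,3) this] 1[OF this] show ?thesis
          by (simp add: hcr_I_minus[OF pd] hcr_I_hcr_Q[OF pd x] hcr_I_square[OF pd x])
      qed
      have "hcr_Q H a p \<subseteq> Q p"
      proof
        fix x assume x: "x \<in> hcr_Q H a p"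
        have "\<theta> b p x = 0" for b
          using index_cases_3[of b a] 1[OF x] 2[OF x] x compatible_iff[OF assms(1-3)] by auto
        then show "x \<in> Q p" using compatible_core_iff[OF assms(1-3)] by blast
      qed
      then have "dim (hcr_Q H a p) \<le> dim (Q p)" by (rule dim_subset)
      then show False using hcr_Q(2)[OF pd, of a] dim_core[of p] by simp
    qed
    then obtain x where x: "x \<in> hcr_Q H a p" "\<theta> (a + 1) p x \<noteq> 0" by blast
    have "k (a + 2) * \<theta> (a + 1) p x = k (a + 1) * \<theta> (a + 1) p x"
      using compatible_rotate[OF assms(5,6) x(1)] compatible_rotate[OF assms(2,3) x(1)] by (simp add: k)
    then show ?thesis using x(2) by simp
  qed
  have "k a = k 1" for a
    using step[of 1] step[of 2] step[of 3] exhaust_3[of a] by (auto simp: numeral_mod_3)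
  then show ?thesis using k by metis
qed

text \<open>The forms differ by a single factor, and comparing their differentials on x and I_1 x,
  where both give \<gamma>(x,x) > 0, fixes its size and its sign.\<close>

lemma normalized_unique:
  assumes \<gamma>: "\<gamma> \<in> C" and V: "open V" "V \<subseteq> hcr_dom H" "p \<in> V" "normalized A Q H \<gamma> V \<theta>"
    and V': "open V'" "V' \<subseteq> hcr_dom H" "p \<in> V'" "normalized A Q H \<gamma> V' \<theta>'"
  shows "\<theta>' a p = \<theta> a p"
proof -
  have c: "compatible A V H \<theta>" "compatible A V' H \<theta>'" using V(4) V'(4) by (simp_all add: normalized_def)
  have pd: "p \<in> hcr_dom H" using V by blast
  obtain k where k: "\<And>a x. \<theta>' a p x = k * \<theta> a p x"
    using compatible_unique[OF V(2) c(1) V(3) V'(2) c(2) V'(3)] by blast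
  obtain x where x: "x \<in> Q p" "x \<noteq> 0" using core_nontrivial by blast
  note J = hcr_I_core[OF pd x(1), of 1]
  have "ext_d A (\<theta>' 1) p x (hcr_I H 1 p x) = k * ext_d A (\<theta> 1) p x (hcr_I H 1 p x)"
    by (rule ext_d_multiple[OF V(1,2) c(1) V(3) V'(1,2) c(2) V'(3) k x(1) J])
  then have "k = 1"
    using metric_pos[OF \<gamma> x]
    by (simp add: normalized_ext_d[OF V(4,3) x(1) J] normalized_ext_d[OF V'(4,3) x(1) J]
        metric_isometry[OF \<gamma> pd x(1) x(1)])
  then show ?thesis by (simp add: k fun_eq_iff)
qed

lemma normalized_local:
  assumes \<gamma>: "\<gamma> \<in> C" and V: "open V" "V \<subseteq> hcr_dom H" "p \<in> V" and T: "admissible_triple A V H T"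
  obtains W \<theta> where "open W" "p \<in> W" "W \<subseteq> hcr_dom H" "normalized A Q H \<gamma> W \<theta>"
proof -
  obtain U \<theta> where U: "open U" "p \<in> U" "U \<subseteq> V" and \<theta>: "compatible A U H \<theta>"
    by (rule compatible_from_triple[OF V(2) T V(3,1)])
  have Ud: "U \<subseteq> hcr_dom H" using U V by blast
  have "\<forall>q\<in>U. \<exists>l. l \<noteq> 0 \<and> (\<forall>a. \<forall>x\<in>Q q. \<forall>y\<in>Q q. ext_d A (\<theta> a) q x y = l * \<gamma> q (hcr_I H a q x) y)"
    using ext_d_proportional[OF U(1) Ud \<theta> _ \<gamma>] by blast
  then obtain l where l0: "\<And>q. q \<in> U \<Longrightarrow> l q \<noteq> 0"
    and l: "\<And>q a x y. q \<in> U \<Longrightarrow> x \<in> Q q \<Longrightarrow> y \<in> Q q \<Longrightarrow> ext_d A (\<theta> a) q x y = l q * \<gamma> q (hcr_I H a q x) y"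
    by metis
  define f where "f q = inverse (l q)" for q
  have f: "smooth_fun A U f"
    unfolding f_def
    by (rule smooth_fun_inverse[OF atlas U(1) smooth_factor[OF \<gamma> U(1) Ud \<theta> l] l0])
  have fl: "f q * l q = 1" if "q \<in> U" for q
    using l0[OF that] by (simp add: f_def)
  define \<theta>' where "\<theta>' = (\<lambda>a q x. f q * \<theta> a q x)"
  have c: "compatible A U H \<theta>'"
    unfolding \<theta>'_def by (rule compatible_scale[OF U(1) Ud \<theta> f]) (use l0 in \<open>simp add: f_def\<close>)
  have "ext_d A (\<theta>' a) q y z = \<gamma> q (hcr_I H a q y) z" if q: "q \<in> U" "y \<in> Q q" "z \<in> Q q" for q a y z
  proof -
    have "ext_d A (\<theta>' a) q y z = f q * ext_d A (\<theta> a) q y z"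
      by (rule ext_d_multiple[OF U(1) Ud \<theta> q(1) U(1) Ud c q(1) _ q(2,3)]) (simp add: \<theta>'_def)
    also have "\<dots> = (f q * l q) * \<gamma> q (hcr_I H a q y) z"
      by (simp add: l[OF q])
    finally show ?thesis by (simp add: fl[OF q(1)])
  qed
  then show thesis
    using c by (intro that[OF U(1,2) Ud, of \<theta>']) (simp add: normalized_def)
qed

lemma normalized_global:
  assumes \<gamma>: "\<gamma> \<in> C"
    and triples: "\<And>p. p \<in> hcr_dom H \<Longrightarrow> \<exists>V T. open V \<and> p \<in> V \<and> V \<subseteq> hcr_dom H \<and> admissible_triple A V H T"
  obtains \<theta> where "normalized A Q H \<gamma> (hcr_dom H) \<theta>"
proof -
  define P where "P p V \<theta> \<longleftrightarrow> open V \<and> p \<in> V \<and> V \<subseteq> hcr_dom H \<and> normalized A Q H \<gamma> V \<theta>" for p V \<theta>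
  have ex: "\<exists>\<theta> V. P p V \<theta>" if "p \<in> hcr_dom H" for p
    using triples[OF that] normalized_local[OF \<gamma>] unfolding P_def by metis
  \<comment> \<open>An arbitrary local normalized form is chosen at each point separately. By
    uniqueness the choice does not matter, so near \<open>p\<close> the result coincides with a
    single local form and inherits its smoothness.\<close>
  define \<Theta> where "\<Theta> a p = (SOME \<theta>. \<exists>V. P p V \<theta>) a p" for a p
  have eq: "\<Theta> a p = \<theta> a p" if "P p V \<theta>" for a p V \<theta>
  proof -
    define s where "s = (SOME \<theta>. \<exists>V. P p V \<theta>)"
    have "\<exists>V. P p V s"
      unfolding s_def using someI_ex[of "\<lambda>\<theta>. \<exists>V. P p V \<theta>"] that by blast
    then obtain V' where V': "P p V' s" ..
    have "s a p = \<theta> a p"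
      by (rule normalized_unique[OF \<gamma>, of V p \<theta> V']) (use that V' in \<open>auto simp: P_def\<close>)
    then show ?thesis by (simp add: \<Theta>_def s_def)
  qed
  \<comment> \<open>\<open>P\<close> depends on the point only through membership, so a form that
    serves at \<open>p\<close> serves on all of \<open>V\<close>.\<close>
  have eq': "\<Theta> a q = \<theta> a q" if "P p V \<theta>" "q \<in> V" for a p q V \<theta>
    by (rule eq[of q V]) (use that in \<open>simp add: P_def\<close>)
  have one: "one_form A (hcr_dom H) (\<Theta> a)" for a
    unfolding one_form_def
  proof (intro conjI ballI allI impI)
    fix p assume "p \<in> hcr_dom H"
    then obtain V \<theta> where "P p V \<theta>" using ex by blast
    then show "linear (\<Theta> a p)"
      using eq[of p V \<theta> a] compatible_linear[of V \<theta> p a] by (simp add: P_def normalized_def)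
  next
    fix U X assume U: "open U \<and> U \<subseteq> hcr_dom H \<and> smooth_vf A U X"
    show "smooth_fun A U (\<lambda>p. \<Theta> a p (X p))"
    proof (rule smooth_fun_local[OF atlas])
      fix p assume p: "p \<in> U"
      then obtain V \<theta> where V: "P p V \<theta>" using ex U by blast
      have o: "open (U \<inter> V)" using U V by (auto simp: P_def)
      have "smooth_fun A (U \<inter> V) (\<lambda>p. \<theta> a p (X p))"
      proof (rule one_form_smooth[OF _ o])
        show "one_form A V (\<theta> a)"
          using V by (simp add: P_def normalized_def compatible_def)
        show "smooth_vf A (U \<inter> V) X"
          by (rule smooth_vf_mono[of A U]) (use U in auto)
      qed simp
      then have "smooth_fun A (U \<inter> V) (\<lambda>p. \<Theta> a p (X p))"
        by (rule smooth_fun_cong[OF atlas o]) (simp add: eq'[OF V])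
      then show "\<exists>W. open W \<and> p \<in> W \<and> smooth_fun A W (\<lambda>p. \<Theta> a p (X p))"
        using o p V by (intro exI[of _ "U \<inter> V"]) (simp add: P_def)
    qed
  qed
  have c: "compatible A (hcr_dom H) H \<Theta>"
    unfolding compatible_def
  proof (intro conjI allI ballI)
    fix p a assume p: "p \<in> hcr_dom H"
    then obtain V \<theta> where V: "P p V \<theta>" using ex by blast
    then have \<theta>: "V \<subseteq> hcr_dom H" "compatible A V H \<theta>" "p \<in> V" by (auto simp: P_def normalized_def)
    show "{x. \<Theta> a p x = 0} = hcr_Q H a p"
      using compatible_iff[OF \<theta>] by (simp add: eq[OF V])
    show "\<Theta> (a + 2) p (hcr_I H a p x) = \<Theta> (a + 1) p x" if "x \<in> hcr_Q H a p" for x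
      using compatible_rotate[OF \<theta>(2,3) that] by (simp add: eq[OF V])
  qed (rule one)
  have "ext_d A (\<Theta> a) p x y = \<gamma> p (hcr_I H a p x) y" if x: "p \<in> hcr_dom H" "x \<in> Q p" "y \<in> Q p" for a p x y
  proof -
    obtain V \<theta> where V: "P p V \<theta>" using ex x(1) by blast
    then have \<theta>: "open V" "V \<subseteq> hcr_dom H" "compatible A V H \<theta>" "p \<in> V" "normalized A Q H \<gamma> V \<theta>"
      by (auto simp: P_def normalized_def)
    have "ext_d A (\<Theta> a) p x y = 1 * ext_d A (\<theta> a) p x y"
      by (rule ext_d_multiple[OF \<theta>(1-4) open_dom subset_refl c x(1) _ x(2,3)]) (simp add: eq[OF V])
    then show ?thesis by (simp add: normalized_ext_d[OF \<theta>(5,4) x(2,3)])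
  qed
  then show thesis
    using c by (intro that[of \<Theta>]) (simp add: normalized_def)
qed

lemma normalized_ultra_pseudoconvex:
  assumes \<gamma>: "\<gamma> \<in> C" and \<theta>: "normalized A Q H \<gamma> (hcr_dom H) \<theta>"
  shows "ultra_pseudoconvex A n H"
proof -
  have c: "compatible A (hcr_dom H) H \<theta>" using \<theta> by (simp add: normalized_def)
  have "ultra_form A n H \<theta> a p x x > 0" if p: "p \<in> hcr_dom H" and "x \<in> hcr_core H p" "x \<noteq> 0" for a p x
  proof -
    have x: "x \<in> Q p" using that underlying by blast
    note l = levi_proportional[OF open_dom subset_refl c p \<gamma> x x, where l = 1]
    have "ext_d A (\<theta> b) p x (hcr_I H b p x) = \<gamma> p x x" "levi A H \<theta> b p x x = \<gamma> p x x" for b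
      using l[of b] normalized_ext_d[OF \<theta> p] by simp_all
    \<comment> \<open>The Levi form contributes 2n + 4, and each of the three subtracted terms
      one.\<close>
    then have "ultra_form A n H \<theta> a p x x = (2 * real n + 1) * \<gamma> p x x"
      by (simp add: ultra_form_def algebra_simps)
    then show ?thesis using metric_pos[OF \<gamma> x that(3)] by simp
  qed
  then show ?thesis unfolding ultra_pseudoconvex_def using c by blast
qed

text \<open>For v = e_a the rotation identifies the kernel of \<theta>'_a with that of the form
  built from \<theta> with column a of \<open>S p\<close>, so the two differ by a factor
  \<open>k\<close>. It also expresses I'_a by the same column, and comparing differentials on
  \<open>Q\<close> gives k = 1. General v follow by linearity.\<close>

lemma normalized_rotated:
  assumes \<gamma>: "\<gamma> \<in> C" and \<theta>: "normalized A Q H \<gamma> (hcr_dom H) \<theta>"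
    and H': "qc_hyper_CR A Q \<I> C H'" and \<theta>': "normalized A Q H' \<gamma> (hcr_dom H') \<theta>'"
    and S: "rotated_by A H H' S" and p: "p \<in> hcr_dom H" "p \<in> hcr_dom H'"
  shows "(\<Sum>a\<in>UNIV. v $ a * \<theta>' a p x) = (\<Sum>a\<in>UNIV. (S p *v v) $ a * \<theta> a p x)"
proof -
  interpret H': qc_hyper_CR A Q \<I> C H' by (rule H')
  have c: "compatible A (hcr_dom H) H \<theta>" using \<theta> by (simp add: normalized_def)
  have c': "compatible A (hcr_dom H') H' \<theta>'" using \<theta>' by (simp add: normalized_def)
  have "p \<in> hcr_dom H \<inter> hcr_dom H'" using p by blast
  then obtain V T T' where V: "p \<in> V" "V \<subseteq> hcr_dom H \<inter> hcr_dom H'"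
    and T: "admissible_triple A V H T" and T': "admissible_triple A V H' T'"
    and rot: "\<forall>q\<in>V. \<forall>v\<in>sphere 0 1.
            Q_at H' T' v q = Q_at H T (S q *v v) q \<and>
            (\<forall>x\<in>Q_at H' T' v q.
               I_combination (I_ext H' T') v q x = I_combination (I_ext H T) (S q *v v) q x)"
    using S unfolding rotated_by_def Let_def by meson
  have Vd: "V \<subseteq> hcr_dom H" "V \<subseteq> hcr_dom H'" using V by blast+
  have axis: "\<theta>' a p z = (\<Sum>b\<in>UNIV. S p $ b $ a * \<theta> b p z)" for a z
  proof -
    let ?e = "axis a 1 :: real^3"
    have Se: "(S p *v ?e) $ b = S p $ b $ a" for b
      by (simp add: matrix_vector_mult_basis column_def)
    have e: "?e \<in> sphere 0 1" by (simp add: norm_axis_1)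
    have \<theta>e: "(\<Sum>b\<in>UNIV. ?e $ b * \<theta>' b p x) = \<theta>' a p x" for x
      by (simp add: axis_def if_distrib[of "\<lambda>t. t * _"] cong: if_cong)
    have Qe: "Q_at H' T' ?e p = {x. \<theta>' a p x = 0}"
      using H'.compatible_triple[OF Vd(2) T' subset_refl c' p(2) V(1), of ?e] by (simp only: \<theta>e)
    have QS: "Q_at H T (S p *v ?e) p = {x. (\<Sum>b\<in>UNIV. S p $ b $ a * \<theta> b p x) = 0}"
      using compatible_triple[OF Vd(1) T subset_refl c p(1) V(1), of "S p *v ?e"] by (simp only: Se)
    have QQ: "Q_at H' T' ?e p = Q_at H T (S p *v ?e) p"
      using rot V(1) e by blast
    have ker: "\<theta>' a p x = 0 \<longleftrightarrow> (\<Sum>b\<in>UNIV. S p $ b $ a * \<theta> b p x) = 0" for x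
      using QQ unfolding Qe QS by blast
    have "\<exists>k. \<forall>x. \<theta>' a p x = k * (\<Sum>b\<in>UNIV. S p $ b $ a * \<theta> b p x)"
    proof (rule functional_multiple)
      show "linear (\<lambda>x. \<Sum>b\<in>UNIV. S p $ b $ a * \<theta> b p x)"
        using compatible_linear[OF c p(1)]
        by (intro linear_compose_sum ballI linear_compose_scale_right[where f = "\<theta> _ p", unfolded real_scaleR_def])
      show "linear (\<theta>' a p)" by (rule H'.compatible_linear[OF c' p(2)])
    qed (use ker in blast)
    then obtain k where k: "\<And>x. \<theta>' a p x = k * (\<Sum>b\<in>UNIV. S p $ b $ a * \<theta> b p x)" by blast
    then have k': "\<theta>' a p x = (\<Sum>b\<in>UNIV. (k * S p $ b $ a) * \<theta> b p x)" for x
      by (simp add: sum_distrib_left mult.assoc)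
    have J: "hcr_I H' a p x = (\<Sum>b\<in>UNIV. S p $ b $ a *\<^sub>R hcr_I H b p x)" if x: "x \<in> Q p" for x
    proof -
      have "x \<in> Q_at H' T' ?e p" unfolding Qe using H'.compatible_core[OF subset_refl c' p(2) x] by simp
      then have "I_combination (I_ext H' T') ?e p x = I_combination (I_ext H T) (S p *v ?e) p x"
        using rot V(1) e by blast
      then show ?thesis
        by (simp add: H'.I_ext_core[OF Vd(2) T' V(1) x])
          (simp add: I_combination_def Se I_ext_core[OF Vd(1) T V(1) x])
    qed
    obtain x where x: "x \<in> Q p" "x \<noteq> 0" using core_nontrivial by blast
    note J' = H'.hcr_I_core[OF p(2) x(1), of a]
    have "ext_d A (\<theta>' a) p x (hcr_I H' a p x) = (\<Sum>b\<in>UNIV. (k * S p $ b $ a) * ext_d A (\<theta> b) p x (hcr_I H' a p x))"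
      by (rule ext_d_combination[OF open_dom p(1) H'.open_dom p(2) compatible_one_form[OF c]
            compatible_core[OF subset_refl c] H'.compatible_one_form[OF c'] H'.compatible_core[OF subset_refl c'] k' x(1) J'])
    also have "\<dots> = k * \<gamma> p (\<Sum>b\<in>UNIV. S p $ b $ a *\<^sub>R hcr_I H b p x) (hcr_I H' a p x)"
      using hcr_I_core[OF p(1) x(1)] J'
      by (simp add: normalized_ext_d[OF \<theta> p(1) x(1)] metric_sum_left[OF \<gamma>] sum_distrib_left mult.assoc)
    finally have "\<gamma> p x x = k * \<gamma> p x x"
      unfolding J[OF x(1), symmetric]
      by (simp add: normalized_ext_d[OF \<theta>' p(2) x(1) J'] H'.metric_isometry[OF \<gamma> p(2) x(1) x(1)])
    then have "k = 1" using metric_pos[OF \<gamma> x] by simp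
    then show ?thesis by (simp add: k)
  qed
  have "(\<Sum>a\<in>UNIV. v $ a * \<theta>' a p x) = (\<Sum>a\<in>UNIV. \<Sum>b\<in>UNIV. v $ a * (S p $ b $ a * \<theta> b p x))"
    by (simp add: axis sum_distrib_left)
  also have "\<dots> = (\<Sum>b\<in>UNIV. \<Sum>a\<in>UNIV. v $ a * (S p $ b $ a * \<theta> b p x))"
    by (rule sum.swap)
  also have "\<dots> = (\<Sum>b\<in>UNIV. (S p *v v) $ b * \<theta> b p x)"
    by (simp add: matrix_vector_mult_def sum_distrib_left mult_ac)
  finally show ?thesis .
qed

end

theorem proposition5p3:
  fixes A :: "('m::{second_countable_topology, t2_space}, real^'n) chart set"
    and n :: nat
    and Q :: "'m \<Rightarrow> (real^'n) set"
    and \<I> :: "'m \<Rightarrow> (real^'n \<Rightarrow> real^'n) set"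
    and C :: "('m \<Rightarrow> real^'n \<Rightarrow> real^'n \<Rightarrow> real) set"
    and \<H> :: "('m, real^'n) hcr set"
  assumes "smooth_atlas A"
    and "connected (UNIV :: 'm set)"
    and "orientable A"
    and "CARD('n) = 4 * n + 3"
    and "qc_structure A Q \<I> C"
    and "quaternionic_CR A \<H>"
    and "underlying_structure \<H> Q \<I>"
  shows "levi_forms A \<H> = C \<union> {g. (\<lambda>p x y. - g p x y) \<in> C} \<and>
    (\<forall>H\<in>\<H>. \<forall>V \<theta>. open V \<and> V \<subseteq> hcr_dom H \<and> compatible A V H \<theta> \<longrightarrow>
       (\<forall>p\<in>V. \<forall>x\<in>Q p. \<forall>y\<in>Q p. \<forall>a b.
          levi A H \<theta> b p x y = ext_d A (\<theta> a) p x (hcr_I H a p y))) \<and>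
    (\<forall>H\<in>\<H>. ultra_pseudoconvex A n H)"
proof -
  note atlas = assms(1) and qc = assms(5) and qCR = assms(6)
  have loc: "qc_hyper_CR A Q \<I> C H" if "H \<in> \<H>" for H
  proof
    show "smooth_atlas A" "qc_structure A Q \<I> C" by (fact atlas, fact qc)
    show "hyper_CR A H" using qCR that by (simp add: quaternionic_CR_def)
    show "Q p = hcr_core H p \<and> \<I> p = I_sphere (hcr_core H) (hcr_I H) p" if "p \<in> hcr_dom H" for p
      using assms(7) \<open>H \<in> \<H>\<close> that by (simp add: underlying_structure_def)
  qed
  have cover: "\<exists>H\<in>\<H>. p \<in> hcr_dom H" for p
    using qCR unfolding quaternionic_CR_def by blast
  have rotated: "\<exists>S. rotated_by A H H' S" if "H \<in> \<H>" "H' \<in> \<H>" for H H'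
    using qCR that unfolding quaternionic_CR_def by blast
  \<comment> \<open>The triples are obtained from \<open>rotated_by\<close> applied to
    \<open>H\<close> and itself.\<close>
  have triples: "\<exists>V T. open V \<and> p \<in> V \<and> V \<subseteq> hcr_dom H \<and> admissible_triple A V H T"
    if H: "H \<in> \<H>" "p \<in> hcr_dom H" for H p
  proof -
    obtain S where "rotated_by A H H S" using rotated[OF H(1,1)] by blast
    then show ?thesis using H(2) unfolding rotated_by_def Let_def by (metis Int_absorb)
  qed
  have normalized: "\<exists>\<theta>. normalized A Q H \<gamma> (hcr_dom H) \<theta>" if "\<gamma> \<in> C" "H \<in> \<H>" for \<gamma> H
    using qc_hyper_CR.normalized_global[OF loc[OF that(2)] that(1) triples[OF that(2)]] by blast
  obtain \<gamma>0 where \<gamma>0: "\<gamma>0 \<in> C"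
    using qc unfolding qc_structure_def by blast

  have ultra: "ultra_pseudoconvex A n H" if "H \<in> \<H>" for H
    using normalized[OF \<gamma>0 that] qc_hyper_CR.normalized_ultra_pseudoconvex[OF loc[OF that] \<gamma>0] by blast

  have proportional: "\<exists>l. l \<noteq> 0 \<and> (\<forall>a. \<forall>x\<in>Q p. \<forall>y\<in>Q p. ext_d A (\<theta> a) p x y = l * \<gamma>0 p (hcr_I H a p x) y)"
    if "H \<in> \<H>" "open V" "V \<subseteq> hcr_dom H" "compatible A V H \<theta>" "p \<in> V" for H V \<theta> p
    by (rule qc_hyper_CR.ext_d_proportional[OF loc[OF that(1)] that(2-5) \<gamma>0])

  have levi: "levi A H \<theta> b p x y = ext_d A (\<theta> a) p x (hcr_I H a p y)"
    if H: "H \<in> \<H>" "open V" "V \<subseteq> hcr_dom H" "compatible A V H \<theta>" "p \<in> V" and x: "x \<in> Q p" "y \<in> Q p"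
    for H V \<theta> p x y a b
  proof -
    obtain l where l: "ext_d A (\<theta> a) p x y = l * \<gamma>0 p (hcr_I H a p x) y" if "x \<in> Q p" "y \<in> Q p" for a x y
      using proportional[OF H] by blast
    from qc_hyper_CR.levi_proportional[OF loc[OF H(1)] H(2-5) \<gamma>0 x l] show ?thesis by simp
  qed

  \<comment> \<open>The normalized forms of all members have Levi form \<gamma>, and their
    negatives, which rotate in the same way, have Levi form - \<gamma>.\<close>
  have signed: "(\<lambda>p x y. s * \<gamma> p x y) \<in> levi_forms A \<H>" if \<gamma>: "\<gamma> \<in> C" and s: "s = 1 \<or> s = -1" for \<gamma> s
  proof -
    obtain \<theta> where \<theta>: "\<And>H. H \<in> \<H> \<Longrightarrow> normalized A Q H \<gamma> (hcr_dom H) (\<theta> H)"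
      using normalized[OF \<gamma>] by metis
    define \<theta>' where "\<theta>' H = (\<lambda>a p x. s * \<theta> H a p x)" for H
    have c: "compatible A (hcr_dom H) H (\<theta> H)" if "H \<in> \<H>" for H
      using \<theta>[OF that] by (simp add: normalized_def)
    have c': "compatible A (hcr_dom H) H (\<theta>' H)" if "H \<in> \<H>" for H
    proof -
      interpret qc_hyper_CR A Q \<I> C H by (rule loc[OF that])
      show ?thesis unfolding \<theta>'_def
        by (rule compatible_scale[OF open_dom subset_refl c[OF that] smooth_fun_const[OF atlas open_dom]])
          (use s in auto)
    qed
    have rot: "\<exists>S. rotated_by A H H' S \<and>
                (\<forall>p \<in> hcr_dom H \<inter> hcr_dom H'. \<forall>v x.
                   (\<Sum>a\<in>UNIV. v $ a * \<theta>' H' a p x) = (\<Sum>a\<in>UNIV. (S p *v v) $ a * \<theta>' H a p x))"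
      if H: "H \<in> \<H>" "H' \<in> \<H>" for H H'
    proof -
      obtain S where S: "rotated_by A H H' S" using rotated[OF H] by blast
      have "(\<Sum>a\<in>UNIV. v $ a * \<theta>' H' a p x) = (\<Sum>a\<in>UNIV. (S p *v v) $ a * \<theta>' H a p x)"
        if "p \<in> hcr_dom H" "p \<in> hcr_dom H'" for p v x
        using qc_hyper_CR.normalized_rotated[OF loc[OF H(1)] \<gamma> \<theta>[OF H(1)] loc[OF H(2)] \<theta>[OF H(2)] S that, of v x]
        by (simp add: \<theta>'_def mult.left_commute[of _ s] flip: sum_distrib_left)
      then show ?thesis using S by blast
    qed
    have "s * \<gamma> p x y = levi A H (\<theta>' H) a p x y"
      if H: "H \<in> \<H>" and p: "p \<in> hcr_dom H" and x: "x \<in> hcr_core H p" "y \<in> hcr_core H p" for H p x y a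
    proof -
      interpret qc_hyper_CR A Q \<I> C H by (rule loc[OF H])
      have xQ: "x \<in> Q p" "y \<in> Q p" using x underlying[OF p] by auto
      have "ext_d A (\<theta>' H a) p u v = s * \<gamma> p (hcr_I H a p u) v" if "u \<in> Q p" "v \<in> Q p" for a u v
        using ext_d_multiple[OF open_dom subset_refl c[OF H] p open_dom subset_refl c'[OF H] p _ that, of a s]
          normalized_ext_d[OF \<theta>[OF H] p that]
        by (simp add: \<theta>'_def)
      from levi_proportional(2)[OF open_dom subset_refl c'[OF H] p \<gamma> xQ this] show ?thesis by simp
    qed
    then show ?thesis
      unfolding levi_forms_def using c' rot by (intro CollectI exI[of _ \<theta>'] conjI ballI allI) blast+
  qed

  have mem: "g \<in> C \<or> (\<lambda>p x y. - g p x y) \<in> C" if g: "g \<in> levi_forms A \<H>" for g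
  proof -
    obtain \<theta> where c: "\<And>H. H \<in> \<H> \<Longrightarrow> compatible A (hcr_dom H) H (\<theta> H)"
      and lev: "\<And>H p x y a. H \<in> \<H> \<Longrightarrow> p \<in> hcr_dom H \<Longrightarrow> x \<in> hcr_core H p \<Longrightarrow> y \<in> hcr_core H p \<Longrightarrow>
                g p x y = levi A H (\<theta> H) a p x y"
    proof -
      obtain \<theta> where "\<forall>H\<in>\<H>. compatible A (hcr_dom H) H (\<theta> H)"
        "\<forall>H\<in>\<H>. \<forall>p\<in>hcr_dom H. \<forall>x\<in>hcr_core H p. \<forall>y\<in>hcr_core H p. \<forall>a. g p x y = levi A H (\<theta> H) a p x y"
        using g unfolding levi_forms_def by (elim CollectE exE conjE)
      then show thesis by (intro that[of \<theta>]) simp_all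
    qed
    \<comment> \<open>Every member around \<open>p\<close> yields a factor, but all of them can be
      read off from the same form \<open>g\<close>. So there is one function \<open>l\<close> on the
      whole manifold and not one for each \<open>H\<close>.\<close>
    have ex: "\<exists>l. l \<noteq> 0 \<and> (\<forall>H\<in>\<H>. p \<in> hcr_dom H \<longrightarrow>
        (\<forall>a. \<forall>x\<in>Q p. \<forall>y\<in>Q p. ext_d A (\<theta> H a) p x y = l * \<gamma>0 p (hcr_I H a p x) y)) \<and>
        (\<forall>x\<in>Q p. \<forall>y\<in>Q p. g p x y = l * \<gamma>0 p x y)" for p
    proof -
      have one: "\<exists>l. l \<noteq> 0 \<and> (\<forall>a. \<forall>x\<in>Q p. \<forall>y\<in>Q p. ext_d A (\<theta> H a) p x y = l * \<gamma>0 p (hcr_I H a p x) y) \<and>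
          (\<forall>x\<in>Q p. \<forall>y\<in>Q p. g p x y = l * \<gamma>0 p x y)" if H: "H \<in> \<H>" "p \<in> hcr_dom H" for H
      proof -
        interpret qc_hyper_CR A Q \<I> C H by (rule loc[OF H(1)])
        obtain l where l0: "l \<noteq> 0" and l: "\<And>a x y. x \<in> Q p \<Longrightarrow> y \<in> Q p \<Longrightarrow> ext_d A (\<theta> H a) p x y = l * \<gamma>0 p (hcr_I H a p x) y"
          using proportional[OF H(1) open_dom subset_refl c[OF H(1)] H(2)] by blast
        have "g p x y = l * \<gamma>0 p x y" if "x \<in> Q p" "y \<in> Q p" for x y
          using levi_proportional(2)[OF open_dom subset_refl c[OF H(1)] H(2) \<gamma>0 that l, of 1]
            lev[OF H, of x y 1] that underlying[OF H(2)] by simp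
        then show ?thesis using l0 l by blast
      qed
      obtain H where H: "H \<in> \<H>" "p \<in> hcr_dom H" using cover by blast
      interpret qc_hyper_CR A Q \<I> C H by (rule loc[OF H(1)])
      obtain x where x: "x \<in> Q p" "x \<noteq> 0" using core_nontrivial by blast
      have pos: "\<gamma>0 p x x > 0" by (rule metric_pos[OF \<gamma>0 x])
      obtain l where l: "l \<noteq> 0" "\<forall>x\<in>Q p. \<forall>y\<in>Q p. g p x y = l * \<gamma>0 p x y" using one[OF H] by blast
      have "\<forall>a. \<forall>x\<in>Q p. \<forall>y\<in>Q p. ext_d A (\<theta> H' a) p x y = l * \<gamma>0 p (hcr_I H' a p x) y"
        if H': "H' \<in> \<H>" "p \<in> hcr_dom H'" for H'
      proof -
        obtain l' where l': "\<forall>a. \<forall>x\<in>Q p. \<forall>y\<in>Q p. ext_d A (\<theta> H' a) p x y = l' * \<gamma>0 p (hcr_I H' a p x) y"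
            "\<forall>x\<in>Q p. \<forall>y\<in>Q p. g p x y = l' * \<gamma>0 p x y"
          using one[OF H'] by blast
        have "l' * \<gamma>0 p x x = l * \<gamma>0 p x x" using l(2) l'(2) x(1) by metis
        then have "l' = l" using pos by simp
        then show ?thesis using l'(1) by simp
      qed
      then show ?thesis using l by blast
    qed
    obtain l where l0: "\<And>p. l p \<noteq> 0"
      and l: "\<And>p H a x y. H \<in> \<H> \<Longrightarrow> p \<in> hcr_dom H \<Longrightarrow> x \<in> Q p \<Longrightarrow> y \<in> Q p \<Longrightarrow>
         ext_d A (\<theta> H a) p x y = l p * \<gamma>0 p (hcr_I H a p x) y"
      and gl: "\<And>p x y. x \<in> Q p \<Longrightarrow> y \<in> Q p \<Longrightarrow> g p x y = l p * \<gamma>0 p x y"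
      using ex by metis
    have sm: "smooth_fun A UNIV l"
    proof (rule smooth_fun_local[OF atlas])
      fix p
      obtain H where H: "H \<in> \<H>" "p \<in> hcr_dom H" using cover by blast
      interpret qc_hyper_CR A Q \<I> C H by (rule loc[OF H(1)])
      have "smooth_fun A (hcr_dom H) l"
        by (rule smooth_factor[OF \<gamma>0 open_dom subset_refl c[OF H(1)] l[OF H(1)]])
      then show "\<exists>W. open W \<and> p \<in> W \<and> smooth_fun A W l"
        using H(2) open_dom by blast
    qed
    have "connected (range l)"
      by (rule connected_continuous_image[OF smooth_fun_continuous[OF atlas open_UNIV sm] assms(2)])
    \<comment> \<open>The range of \<open>l\<close> is connected and omits 0.\<close>
    then have sign: "(\<forall>p. l p > 0) \<or> (\<forall>p. - l p > 0)"
      using connectedD_interval[of "range l" _ _ 0] l0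
      by (metis neg_0_less_iff_less linorder_neqE_linordered_idom neg_less_0_iff_less order_less_imp_le rangeE rangeI)
    have smm: "smooth_fun A UNIV (\<lambda>p. (- 1) * l p)"
      by (intro smooth_fun_mult smooth_fun_const atlas open_UNIV sm)
    obtain H where H: "H \<in> \<H>" using cover by blast
    interpret qc_hyper_CR A Q \<I> C H by (rule loc[OF H])
    from sign show ?thesis
    proof
      assume "\<forall>p. l p > 0"
      then have "g \<in> C" by (intro scaled_metric_mem[OF \<gamma>0 sm _ gl]) auto
      then show ?thesis ..
    next
      assume "\<forall>p. - l p > 0"
      then have "(\<lambda>p x y. - g p x y) \<in> C"
        by (intro scaled_metric_mem[OF \<gamma>0 smm]) (auto simp: gl)
      then show ?thesis ..
    qed
  qed
  have "levi_forms A \<H> = C \<union> {g. (\<lambda>p x y. - g p x y) \<in> C}"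
  proof (intro set_eqI iffI)
    fix g assume "g \<in> levi_forms A \<H>"
    then show "g \<in> C \<union> {g. (\<lambda>p x y. - g p x y) \<in> C}" using mem by blast
  next
    fix g assume "g \<in> C \<union> {g. (\<lambda>p x y. - g p x y) \<in> C}"
    then show "g \<in> levi_forms A \<H>"
      using signed[of g 1] signed[of "\<lambda>p x y. - g p x y" "-1"] by auto
  qed
  then show ?thesis
  proof (intro conjI ballI allI impI)
    show "levi A H \<theta> b p x y = ext_d A (\<theta> a) p x (hcr_I H a p y)"
      if "H \<in> \<H>" "open V \<and> V \<subseteq> hcr_dom H \<and> compatible A V H \<theta>" "p \<in> V" "x \<in> Q p" "y \<in> Q p"
      for H V \<theta> p x y a b
      using that(2) by (intro levi[of H V] that(1,3-5)) simp_all
  qed (assumption, rule ultra)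
qed

end
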